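(* (Borcherds identity.) Let $V$ be an $N_W=N$ SUSY vertex algebra. For all homogeneous $a,b\in V$, $k\in\mathbb Z$ and $K\subset\{1,\dots,N\}$, $$\bigl(i_{z,w}(Z-W)^{k|K}\bigr)Y(a,Z)Y(b,W)-(-1)^{ab}\bigl(i_{w,z}(Z-W)^{k|K}\bigr)Y(b,W)Y(a,Z)$$ $$=\sum_{j\ge0,\,J}\sigma(J,K)\,\sigma(J\cup K)\,\bigl(\partial_W^{(j|J)}\delta(Z,W)\bigr)\,Y\bigl(a_{(k+j|K\cup J)}b,\,W\bigr).$$
   Context: Ground field $\mathbb C$; $N\ge0$ a fixed integer. In exponents of $-1$, $a$ means the parity of $a$ and $J$ means $\#J$. $Z=(z,\theta^1,\dots,\theta^N)$, $W=(w,\zeta^1,\dots,\zeta^N)$, $z,w$ even, $\theta^i,\zeta^i$ odd; odd variables anticommute with each other and supercommute with elements of superspaces; $[\ ,\ ]$ is the supercommutator. For $J=\{j_1<\dots<j_k\}\subset\{1,\dots,N\}$, $\theta^J=\theta^{j_1}\cdots\theta^{j_k}$, $Z^{j|J}=z^j\theta^J$; "$N$" as a set means $\{1,\dots,N\}$. For disjoint $I,J$, $\sigma(I,J)=\pm1$ is defined by $\theta^I\theta^J=\sigma(I,J)\theta^{I\cup J}$, and $\sigma(I,J)=0$ if $I\cap J\neq\emptyset$; $\sigma(I)=\sigma(I,N\setminus I)$. $(Z-W)^{j|J}=(z-w)^j\prod_{i\in J}(\theta^i-\zeta^i)$ (increasing order); $\partial_W^{(j|J)}=\frac{(-1)^{J(J+1)/2}}{j!}\partial_w^j\partial_{\zeta^{j_1}}\cdots\partial_{\zeta^{j_k}}$;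 $i_{z,w}$, $i_{w,z}$ are expansions in the domains $|z|>|w|$, $|w|>|z|$; $\delta(Z,W)=(i_{z,w}-i_{w,z})(Z-W)^{-1|N}$. An $N_W=N$ SUSY vertex algebra is a vector superspace $V$ with an even vector $|0\rangle$, an even operator $T$, odd operators $S^1,\dots,S^N$, and a parity preserving linear map $Y$ sending $a\in V$ to an $\mathrm{End}(V)$-valued field $Y(a,Z)=\sum_{j\in\mathbb Z,J}Z^{-1-j|N\setminus J}a_{(j|J)}$, $a_{(j|J)}\in\mathrm{End}(V)$ (field: $Y(a,Z)b\in V((z))[\theta^1,\dots,\theta^N]$ for all $b$), such that: $Y(a,Z)|0\rangle\in V[[z]][\theta^1,\dots,\theta^N]$ has value $a$ at $Z=0$, $T|0\rangle=S^i|0\rangle=0$; $[T,Y(a,Z)]=\partial_zY(a,Z)$, $[S^i,Y(a,Z)]=\partial_{\theta^i}Y(a,Z)$; for all $a,b$, $(z-w)^n[Y(a,Z),Y(b,W)]=0$ for some $n\ge0$. One writes $a_{(j|J)}b=a_{(j|J)}(b)$. *)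

theory Defs
  imports Complex_Main "HOL-Library.Function_Algebras" "HOL-Library.Groups_Big_Fun"
begin

section \<open>Superspaces\<close>

class superspace = ab_group_add +
  fixes scaleC :: "complex \<Rightarrow> 'a \<Rightarrow> 'a" (infixr "*\<^sub>C" 75)
    and even_space :: "'a set"
    and odd_space :: "'a set"
  assumes scaleC_right_distrib: "c *\<^sub>C (x + y) = c *\<^sub>C x + c *\<^sub>C y"
    and scaleC_left_distrib: "(c + d) *\<^sub>C x = c *\<^sub>C x + d *\<^sub>C x"
    and scaleC_scaleC: "c *\<^sub>C d *\<^sub>C x = (c * d) *\<^sub>C x"
    and scaleC_one: "1 *\<^sub>C x = x"
    and even_space_zero: "0 \<in> even_space"
    and even_space_add: "x \<in> even_space \<Longrightarrow> y \<in> even_space \<Longrightarrow> x + y \<in> even_space"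
    and even_space_scale: "x \<in> even_space \<Longrightarrow> c *\<^sub>C x \<in> even_space"
    and odd_space_zero: "0 \<in> odd_space"
    and odd_space_add: "x \<in> odd_space \<Longrightarrow> y \<in> odd_space \<Longrightarrow> x + y \<in> odd_space"
    and odd_space_scale: "x \<in> odd_space \<Longrightarrow> c *\<^sub>C x \<in> odd_space"
    and even_odd_Int: "even_space \<inter> odd_space = {0}"
    and even_odd_decomp: "\<exists>y\<in>even_space. \<exists>z\<in>odd_space. x = y + z"

global_interpretation superspace: vector_space "scaleC :: complex \<Rightarrow> 'v \<Rightarrow> 'v::superspace"
  by unfold_locales
    (simp_all add: scaleC_right_distrib scaleC_left_distrib scaleC_scaleC scaleC_one)

text \<open>Parities are represented by natural numbers, of which only the residue modulo 2 matters.\<close>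

definition homog :: "nat \<Rightarrow> 'v::superspace set" where
  "homog p = (if even p then even_space else odd_space)"

definition component :: "nat \<Rightarrow> 'v::superspace \<Rightarrow> 'v" where
  "component p x = (THE y. y \<in> homog p \<and> x - y \<in> homog (Suc p))"

definition op_parity :: "nat \<Rightarrow> ('v::superspace \<Rightarrow> 'v) \<Rightarrow> bool" where
  "op_parity p A \<longleftrightarrow> (\<forall>q. \<forall>x\<in>homog q. A x \<in> homog (p + q))"

definition op_part :: "nat \<Rightarrow> ('v::superspace \<Rightarrow> 'v) \<Rightarrow> 'v \<Rightarrow> 'v" where
  "op_part p A x = (\<Sum>q<2. component (p + q) (A (component q x)))"


section \<open>Grassmann variables\<close>

text \<open>The sign in \<open>\<theta>\<^sup>I \<theta>\<^sup>J = \<sigma>(I, J) \<theta>\<^sup>I\<^sup>\<union>\<^sup>J\<close> counts the transpositions needed to sort the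
  concatenation of \<open>I\<close> and \<open>J\<close>.\<close>

definition sig :: "nat set \<Rightarrow> nat set \<Rightarrow> complex" where
  "sig I J = (if I \<inter> J = {} then (- 1) ^ card {(i, j) \<in> I \<times> J. j < i} else 0)"

definition sig1 :: "nat \<Rightarrow> nat set \<Rightarrow> complex" where
  "sig1 N I = sig I ({1..N} - I)"

text \<open>\<open>g I K\<close> is the coefficient of \<open>\<theta>\<^sup>I \<zeta>\<^sup>K\<close>. The sign \<open>koszul\<close> is the one in
  \<open>(\<theta>\<^sup>I \<zeta>\<^sup>K) (\<theta>\<^sup>I\<^sup>' \<zeta>\<^sup>K\<^sup>') = \<plusminus> \<theta>\<^sup>I\<^sup>\<union>\<^sup>I\<^sup>' \<zeta>\<^sup>K\<^sup>\<union>\<^sup>K\<^sup>'\<close>.\<close>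

type_synonym grassmann = "nat set \<Rightarrow> nat set \<Rightarrow> complex"

definition koszul :: "nat set \<Rightarrow> nat set \<Rightarrow> nat set \<Rightarrow> nat set \<Rightarrow> complex" where
  "koszul I K I' K' = (- 1) ^ (card K * card I') * sig I I' * sig K K'"

definition gr_monom :: "nat set \<Rightarrow> nat set \<Rightarrow> grassmann" where
  "gr_monom I K = (\<lambda>I' K'. if I' = I \<and> K' = K then 1 else 0)"

definition gr_mult :: "grassmann \<Rightarrow> grassmann \<Rightarrow> grassmann" where
  "gr_mult g h = (\<lambda>I K. \<Sum>I1\<in>Pow I. \<Sum>K1\<in>Pow K.
     koszul I1 K1 (I - I1) (K - K1) * g I1 K1 * h (I - I1) (K - K1))"

definition gr_prod_list :: "grassmann list \<Rightarrow> grassmann" where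
  "gr_prod_list gs = foldr gr_mult gs (gr_monom {} {})"

definition theta_minus_zeta :: "nat set \<Rightarrow> grassmann" where
  "theta_minus_zeta K =
     gr_prod_list (map (\<lambda>i. gr_monom {i} {} - gr_monom {} {i}) (sorted_list_of_set K))"

lemma sig_empty [simp]: "sig I {} = 1" "sig {} I = 1"
  by (simp_all add: sig_def)

lemma gr_mult_monom:
  assumes "finite I" "finite K" "finite I'" "finite K'"
  shows "gr_mult (gr_monom I K) (gr_monom I' K') =
    (\<lambda>A B. koszul I K I' K' * gr_monom (I \<union> I') (K \<union> K') A B)"
proof (intro ext)
  fix A B
  show "gr_mult (gr_monom I K) (gr_monom I' K') A B
    = koszul I K I' K' * gr_monom (I \<union> I') (K \<union> K') A B"
  proof (cases "I \<subseteq> A \<and> K \<subseteq> B \<and> A - I = I' \<and> B - K = K'")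
    case True
    then have fin: "finite (Pow A)" "finite (Pow B)" and AB: "A = I \<union> I'" "B = K \<union> K'"
      using assms by (auto intro: finite_subset[of A "I \<union> I'"] finite_subset[of B "K \<union> K'"])
    have "gr_mult (gr_monom I K) (gr_monom I' K') A B
      = (\<Sum>I1\<in>Pow A. \<Sum>K1\<in>Pow B. if K1 = K then (if I1 = I then koszul I K I' K' else 0) else 0)"
      unfolding gr_mult_def using True by (intro sum.cong refl) (auto simp: gr_monom_def)
    also have "\<dots> = koszul I K I' K'"
      using True fin by (simp add: sum.delta)
    finally show ?thesis using AB by (simp add: gr_monom_def)
  next
    case False
    have "gr_mult (gr_monom I K) (gr_monom I' K') A B = 0"
      unfolding gr_mult_def using False by (intro sum.neutral ballI) (auto simp: gr_monom_def)
    moreover have "koszul I K I' K' * gr_monom (I \<union> I') (K \<union> K') A B = 0"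
      using False by (auto simp: gr_monom_def koszul_def sig_def)
    ultimately show ?thesis by simp
  qed
qed

lemma gr_mult_theta:
  assumes "finite I" "finite J"
  shows "gr_mult (gr_monom I {}) (gr_monom J {}) = (\<lambda>A B. sig I J * gr_monom (I \<union> J) {} A B)"
  using gr_mult_monom[of I "{}" J "{}"] assms by (simp add: koszul_def)

lemma theta_anticommute:
  "gr_mult (gr_monom {i} {}) (gr_monom {j} {}) = - gr_mult (gr_monom {j} {}) (gr_monom {i} {})"
proof -
  have "{(a, b). a = i \<and> b = j \<and> b < a} = (if j < i then {(i, j)} else {})" for i j :: nat
    by auto
  then show ?thesis
    by (auto simp: gr_mult_theta sig_def fun_eq_iff insert_commute)
qed

lemma gr_prod_list_thetas:
  assumes "finite J"
  shows "gr_prod_list (map (\<lambda>i. gr_monom {i} {}) (sorted_list_of_set J)) = gr_monom J {}"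
proof -
  have "gr_prod_list (map (\<lambda>i. gr_monom {i} {}) xs) = gr_monom (set xs) {}"
    if "sorted_wrt (<) xs" for xs :: "nat list"
    using that
  proof (induction xs)
    case Nil
    then show ?case by (simp add: gr_prod_list_def)
  next
    case (Cons x xs)
    have "{(a, b) \<in> {x} \<times> set xs. b < a} = {}" and "x \<notin> set xs"
      using Cons.prems by (auto dest: order.asym)
    then have "sig {x} (set xs) = 1"
      unfolding sig_def by (metis Int_insert_left_if0 Int_empty_left card.empty power_0)
    then show ?case
      using Cons gr_mult_theta[of "{x}" "set xs"] by (simp add: gr_prod_list_def)
  qed
  from this[of "sorted_list_of_set J"] show ?thesis
    using assms by simp
qed


section \<open>Formal superdistributions in \<open>Z\<close> and \<open>W\<close>\<close>

text \<open>The coefficient of \<open>z\<^sup>m \<theta>\<^sup>I w\<^sup>n \<zeta>\<^sup>K\<close>, written to the right of the monomial, is \<open>f m I n K\<close>;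
  for a field in one variable the coefficient of \<open>Z\<^sup>m\<^sup>|\<^sup>I\<close> is \<open>f m I\<close>.\<close>

type_synonym scalar_dist = "int \<Rightarrow> nat set \<Rightarrow> int \<Rightarrow> nat set \<Rightarrow> complex"
type_synonym 'v op_field = "int \<Rightarrow> nat set \<Rightarrow> 'v \<Rightarrow> 'v"
type_synonym 'v op_dist = "int \<Rightarrow> nat set \<Rightarrow> int \<Rightarrow> nat set \<Rightarrow> 'v \<Rightarrow> 'v"

text \<open>\<open>i\<^bsub>z,w\<^esub> (Z - W)\<^sup>k\<^sup>|\<^sup>K\<close> and \<open>i\<^bsub>w,z\<^esub> (Z - W)\<^sup>k\<^sup>|\<^sup>K\<close>, from
  \<open>(z - w)\<^sup>k = \<Sum>\<^sub>j (k choose j) z\<^sup>k\<^sup>-\<^sup>j (-w)\<^sup>j\<close> for \<open>|z| > |w|\<close> and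
  \<open>(z - w)\<^sup>k = \<Sum>\<^sub>j (k choose j) z\<^sup>j (-w)\<^sup>k\<^sup>-\<^sup>j\<close> for \<open>|w| > |z|\<close>.\<close>

definition exp_zw :: "int \<Rightarrow> nat set \<Rightarrow> scalar_dist" where
  "exp_zw k K = (\<lambda>m I n L.
     (if n \<ge> 0 \<and> m + n = k then (- 1) powi n * (of_int k gchoose nat n) else 0)
       * theta_minus_zeta K I L)"

definition exp_wz :: "int \<Rightarrow> nat set \<Rightarrow> scalar_dist" where
  "exp_wz k K = (\<lambda>m I n L.
     (if m \<ge> 0 \<and> m + n = k then (- 1) powi n * (of_int k gchoose nat m) else 0)
       * theta_minus_zeta K I L)"

definition super_delta :: "nat \<Rightarrow> scalar_dist" where
  "super_delta N = exp_zw (- 1) {1..N} - exp_wz (- 1) {1..N}"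

text \<open>Odd derivatives are left derivatives; \<open>\<partial>\<^bsub>\<zeta>\<^sup>i\<^esub>\<close> has to pass \<open>\<theta>\<^sup>I\<close> and the smaller \<open>\<zeta>\<close>'s.\<close>

definition deriv_w :: "scalar_dist \<Rightarrow> scalar_dist" where
  "deriv_w f = (\<lambda>m I n K. of_int (n + 1) * f m I (n + 1) K)"

definition deriv_zeta :: "nat \<Rightarrow> scalar_dist \<Rightarrow> scalar_dist" where
  "deriv_zeta i f = (\<lambda>m I n K.
     if i \<in> K then 0 else (- 1) ^ (card I + card {l \<in> K. l < i}) * f m I n (insert i K))"

definition deriv_W :: "nat \<Rightarrow> nat set \<Rightarrow> scalar_dist \<Rightarrow> scalar_dist" where
  "deriv_W j J f = (\<lambda>m I n K. (- 1) ^ (card J * (card J + 1) div 2) / fact j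
     * (deriv_w ^^ j) (foldr deriv_zeta (sorted_list_of_set J) f) m I n K)"

definition od_scale :: "complex \<Rightarrow> 'v::superspace op_dist \<Rightarrow> 'v op_dist" where
  "od_scale c X = (\<lambda>m I n K v. c *\<^sub>C X m I n K v)"

definition od_deriv_z :: "'v::superspace op_dist \<Rightarrow> 'v op_dist" where
  "od_deriv_z X = (\<lambda>m I n K v. of_int (m + 1) *\<^sub>C X (m + 1) I n K v)"

definition od_deriv_theta :: "nat \<Rightarrow> 'v::superspace op_dist \<Rightarrow> 'v op_dist" where
  "od_deriv_theta i X = (\<lambda>m I n K v.
     if i \<in> I then 0 else (- 1) ^ card {l \<in> I. l < i} *\<^sub>C X m (insert i I) n K v)"

definition od_const :: "('v::superspace \<Rightarrow> 'v) \<Rightarrow> 'v op_dist" where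
  "od_const A = (\<lambda>m I n K. if m = 0 \<and> I = {} \<and> n = 0 \<and> K = {} then A else 0)"

definition in_Z :: "'v::superspace op_field \<Rightarrow> 'v op_dist" where
  "in_Z f = (\<lambda>m I n K. if n = 0 \<and> K = {} then f m I else 0)"

definition in_W :: "'v::superspace op_field \<Rightarrow> 'v op_dist" where
  "in_W f = (\<lambda>m I n K. if m = 0 \<and> I = {} then f n K else 0)"

text \<open>Products are formed coefficientwise and evaluated on vectors, where the sums over powers of
  \<open>z\<close> and \<open>w\<close> are finite for all products considered here. In \<open>od_mult\<close> the second sign comes
  from moving the left coefficient past the odd variables of the right factor.\<close>

definition od_smult :: "scalar_dist \<Rightarrow> 'v::superspace op_dist \<Rightarrow> 'v op_dist" where
  "od_smult c X = (\<lambda>m I n K v. Sum_any (\<lambda>(m1, n1). \<Sum>I1\<in>Pow I. \<Sum>K1\<in>Pow K.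
     (koszul I1 K1 (I - I1) (K - K1) * c m1 I1 n1 K1)
       *\<^sub>C X (m - m1) (I - I1) (n - n1) (K - K1) v))"

definition od_mult :: "'v::superspace op_dist \<Rightarrow> 'v op_dist \<Rightarrow> 'v op_dist" where
  "od_mult X Y = (\<lambda>m I n K v. Sum_any (\<lambda>(m1, n1). \<Sum>I1\<in>Pow I. \<Sum>K1\<in>Pow K. \<Sum>p<2.
     (koszul I1 K1 (I - I1) (K - K1) * (- 1) ^ (p * (card (I - I1) + card (K - K1))))
       *\<^sub>C op_part p (X m1 I1 n1 K1) (Y (m - m1) (I - I1) (n - n1) (K - K1) v)))"

lemma component_zero: "component p 0 = (0 :: 'v::superspace)"
  unfolding component_def
proof (rule the_equality)
  show "0 \<in> homog p \<and> 0 - 0 \<in> (homog (Suc p) :: 'v set)"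
    by (simp add: homog_def even_space_zero odd_space_zero)
next
  fix y :: 'v
  assume y: "y \<in> homog p \<and> 0 - y \<in> homog (Suc p)"
  have "y = (- 1) *\<^sub>C (0 - y)"
    by (simp add: superspace.scale_minus_left)
  then have "y \<in> homog (Suc p)"
    using y even_space_scale[of "0 - y" "- 1"] odd_space_scale[of "0 - y" "- 1"]
    by (auto simp: homog_def split: if_splits)
  then show "y = 0"
    using y even_odd_Int by (auto simp: homog_def split: if_splits)
qed

lemma op_part_0: "op_part p (0 :: 'v::superspace \<Rightarrow> 'v) = 0"
  by (rule ext) (simp add: op_part_def component_zero)

lemma op_part_at_0: "A 0 = 0 \<Longrightarrow> op_part p A 0 = (0 :: 'v::superspace)"
  by (simp add: op_part_def component_zero)

text \<open>The coefficients of \<open>Y(a, Z) Y(b, W)\<close> and \<open>Y(b, W) Y(a, Z)\<close>, with the signs spelled out.\<close>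

lemma od_mult_in_Z_in_W:
  assumes "finite I" "finite K" and f0: "\<And>m I. f m I 0 = 0"
  shows "od_mult (in_Z f) (in_W g) m I n K v
    = (\<Sum>p<2. (- 1) ^ (p * card K) *\<^sub>C op_part p (f m I) (g n K v))"
proof -
  define t where "t = (\<lambda>(m1, n1) I1 K1 p.
     (koszul I1 K1 (I - I1) (K - K1) * (- 1) ^ (p * (card (I - I1) + card (K - K1))))
       *\<^sub>C op_part p (in_Z f m1 I1 n1 K1) (in_W g (m - m1) (I - I1) (n - n1) (K - K1) v))"
  have t0: "t x I1 K1 p = 0" if "x \<noteq> (m, 0) \<or> I1 \<noteq> I \<or> K1 \<noteq> {}" "I1 \<subseteq> I" for x I1 K1 p
    using that by (cases x) (auto simp: t_def in_Z_def in_W_def op_part_0 op_part_at_0 f0)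
  have t1: "t (m, 0) I {} p = (- 1) ^ (p * card K) *\<^sub>C op_part p (f m I) (g n K v)" for p
    by (simp add: t_def in_Z_def in_W_def koszul_def)
  have "od_mult (in_Z f) (in_W g) m I n K v
      = Sum_any (\<lambda>x. \<Sum>I1\<in>Pow I. \<Sum>K1\<in>Pow K. \<Sum>p<2. t x I1 K1 p)"
    by (simp add: od_mult_def t_def case_prod_beta')
  also have "\<dots> = (\<Sum>x\<in>{(m, 0)}. \<Sum>I1\<in>Pow I. \<Sum>K1\<in>Pow K. \<Sum>p<2. t x I1 K1 p)"
  proof (rule Sum_any.expand_superset)
    have "(\<Sum>I1\<in>Pow I. \<Sum>K1\<in>Pow K. \<Sum>p<2. t x I1 K1 p) = 0" if "x \<noteq> (m, 0)" for x
      by (intro sum.neutral ballI t0) (use that in auto)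
    then show "{x. (\<Sum>I1\<in>Pow I. \<Sum>K1\<in>Pow K. \<Sum>p<2. t x I1 K1 p) \<noteq> 0} \<subseteq> {(m, 0)}"
      by blast
  qed simp
  also have "\<dots> = (\<Sum>I1\<in>Pow I. \<Sum>K1\<in>Pow K. \<Sum>p<2. t (m, 0) I1 K1 p)"
    by simp
  also have "\<dots> = (\<Sum>I1\<in>{I}. \<Sum>K1\<in>Pow K. \<Sum>p<2. t (m, 0) I1 K1 p)"
    by (rule sum.mono_neutral_right) (use assms in \<open>auto intro!: sum.neutral t0\<close>)
  also have "\<dots> = (\<Sum>K1\<in>Pow K. \<Sum>p<2. t (m, 0) I K1 p)"
    by simp
  also have "\<dots> = (\<Sum>K1\<in>{{}}. \<Sum>p<2. t (m, 0) I K1 p)"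
    by (rule sum.mono_neutral_right) (use assms in \<open>auto intro!: sum.neutral t0\<close>)
  finally show ?thesis by (simp add: t1)
qed

lemma od_mult_in_W_in_Z:
  assumes "finite I" "finite K" and g0: "\<And>n K. g n K 0 = 0"
  shows "od_mult (in_W g) (in_Z f) m I n K v
    = (\<Sum>p<2. (- 1) ^ (card K * card I + p * card I) *\<^sub>C op_part p (g n K) (f m I v))"
proof -
  define t where "t = (\<lambda>(m1, n1) I1 K1 p.
     (koszul I1 K1 (I - I1) (K - K1) * (- 1) ^ (p * (card (I - I1) + card (K - K1))))
       *\<^sub>C op_part p (in_W g m1 I1 n1 K1) (in_Z f (m - m1) (I - I1) (n - n1) (K - K1) v))"
  have t0: "t x I1 K1 p = 0" if "x \<noteq> (0, n) \<or> I1 \<noteq> {} \<or> K1 \<noteq> K" "K1 \<subseteq> K" for x I1 K1 p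
    using that by (cases x) (auto simp: t_def in_Z_def in_W_def op_part_0 op_part_at_0 g0)
  have t1: "t (0, n) {} K p = (- 1) ^ (card K * card I + p * card I) *\<^sub>C op_part p (g n K) (f m I v)" for p
    by (simp add: t_def in_Z_def in_W_def koszul_def power_add)
  have "od_mult (in_W g) (in_Z f) m I n K v
      = Sum_any (\<lambda>x. \<Sum>I1\<in>Pow I. \<Sum>K1\<in>Pow K. \<Sum>p<2. t x I1 K1 p)"
    by (simp add: od_mult_def t_def case_prod_beta')
  also have "\<dots> = (\<Sum>x\<in>{(0, n)}. \<Sum>I1\<in>Pow I. \<Sum>K1\<in>Pow K. \<Sum>p<2. t x I1 K1 p)"
  proof (rule Sum_any.expand_superset)
    have "(\<Sum>I1\<in>Pow I. \<Sum>K1\<in>Pow K. \<Sum>p<2. t x I1 K1 p) = 0" if "x \<noteq> (0, n)" for x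
      by (intro sum.neutral ballI t0) (use that in auto)
    then show "{x. (\<Sum>I1\<in>Pow I. \<Sum>K1\<in>Pow K. \<Sum>p<2. t x I1 K1 p) \<noteq> 0} \<subseteq> {(0, n)}"
      by blast
  qed simp
  also have "\<dots> = (\<Sum>I1\<in>Pow I. \<Sum>K1\<in>Pow K. \<Sum>p<2. t (0, n) I1 K1 p)"
    by simp
  also have "\<dots> = (\<Sum>I1\<in>{{}}. \<Sum>K1\<in>Pow K. \<Sum>p<2. t (0, n) I1 K1 p)"
    by (rule sum.mono_neutral_right) (use assms in \<open>auto intro!: sum.neutral t0\<close>)
  also have "\<dots> = (\<Sum>K1\<in>Pow K. \<Sum>p<2. t (0, n) {} K1 p)"
    by simp
  also have "\<dots> = (\<Sum>K1\<in>{K}. \<Sum>p<2. t (0, n) {} K1 p)"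
    by (rule sum.mono_neutral_right) (use assms in \<open>auto intro!: sum.neutral t0\<close>)
  finally show ?thesis by (simp add: t1)
qed

text \<open>The component of total parity \<open>p\<close>, the odd variables included.\<close>

definition od_part :: "nat \<Rightarrow> 'v::superspace op_dist \<Rightarrow> 'v op_dist" where
  "od_part p X = (\<lambda>m I n K. op_part (p + card I + card K) (X m I n K))"

definition supercomm :: "'v::superspace op_dist \<Rightarrow> 'v op_dist \<Rightarrow> 'v op_dist" where
  "supercomm X Y = (\<Sum>p<2. \<Sum>q<2. od_mult (od_part p X) (od_part q Y)
     - od_scale ((- 1) ^ (p * q)) (od_mult (od_part q Y) (od_part p X)))"


section \<open>SUSY vertex algebras\<close>

text \<open>\<open>Y a m I\<close> is the coefficient of \<open>Z\<^sup>m\<^sup>|\<^sup>I\<close> in \<open>Y(a, Z)\<close>; only \<open>I \<subseteq> {1..N}\<close> occur. In \<open>locality\<close>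
  the expansion of \<open>(z - w)\<^sup>r\<close> with \<open>r \<ge> 0\<close> is the polynomial itself.\<close>

locale NW_SUSY_vertex_algebra =
  fixes N :: nat
    and vac :: "'v::superspace"
    and T :: "'v \<Rightarrow> 'v"
    and S :: "nat \<Rightarrow> 'v \<Rightarrow> 'v"
    and Y :: "'v \<Rightarrow> 'v op_field"
  assumes vac_even: "vac \<in> homog 0"
    and T_linear: "Vector_Spaces.linear scaleC scaleC T"
    and T_even: "op_parity 0 T"
    and S_linear: "i \<in> {1..N} \<Longrightarrow> Vector_Spaces.linear scaleC scaleC (S i)"
    and S_odd: "i \<in> {1..N} \<Longrightarrow> op_parity 1 (S i)"
    and Y_support: "\<not> I \<subseteq> {1..N} \<Longrightarrow> Y a m I = 0"
    and Y_coeff_linear: "Vector_Spaces.linear scaleC scaleC (Y a m I)"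
    and Y_linear: "Vector_Spaces.linear scaleC scaleC (\<lambda>a. Y a m I b)"
    and Y_parity: "a \<in> homog p \<Longrightarrow> op_parity (p + card I) (Y a m I)"
    and Y_field: "\<exists>M. \<forall>m<M. \<forall>I. Y a m I b = 0"
    and vacuum_regular: "m < 0 \<Longrightarrow> Y a m I vac = 0"
    and vacuum_value: "Y a 0 {} vac = a"
    and T_vac: "T vac = 0"
    and S_vac: "i \<in> {1..N} \<Longrightarrow> S i vac = 0"
    and T_bracket: "supercomm (od_const T) (in_Z (Y a)) = od_deriv_z (in_Z (Y a))"
    and S_bracket: "i \<in> {1..N} \<Longrightarrow>
      supercomm (od_const (S i)) (in_Z (Y a)) = od_deriv_theta i (in_Z (Y a))"
    and locality: "\<exists>r::nat. od_smult (exp_zw (int r) {}) (supercomm (in_Z (Y a)) (in_W (Y b))) = 0"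

text \<open>\<open>a\<^bsub>(j|J)\<^esub>\<close> is the coefficient of \<open>Z\<^sup>-\<^sup>1\<^sup>-\<^sup>j\<^sup>|\<^sup>N\<^sup>-\<^sup>J\<close> in \<open>Y(a, Z)\<close>.\<close>

definition mode :: "nat \<Rightarrow> ('v \<Rightarrow> 'v op_field) \<Rightarrow> 'v \<Rightarrow> int \<Rightarrow> nat set \<Rightarrow> 'v \<Rightarrow> 'v" where
  "mode N Y a j J = Y a (- 1 - j) ({1..N} - J)"

text \<open>The sums over powers of \<open>z\<close> and \<open>w\<close> and over \<open>j\<close> occurring in Borcherds' identity are finite.\<close>

context NW_SUSY_vertex_algebra
begin

lemma Y_coeff_zero: "Y a m I 0 = 0"
  using Y_coeff_linear[of a m I]
  by (metis Vector_Spaces.linear.axioms(3) module_hom.zero)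

lemma finite_exp_zw:
  assumes "finite I" "finite L"
  shows "finite {(m1, n1). exp_zw k K m1 I1 n1 L1
    *\<^sub>C od_mult (in_Z (Y a)) (in_W (Y b)) (m - m1) I (n - n1) L v \<noteq> 0}" (is "finite ?A")
proof -
  obtain M where M: "\<And>m I. m < M \<Longrightarrow> Y b m I v = 0"
    using Y_field by blast
  have "?A \<subseteq> (\<lambda>n1. (k - n1, n1)) ` {0..n - M}"
  proof (clarify)
    fix m1 n1
    assume *: "exp_zw k K m1 I1 n1 L1
      *\<^sub>C od_mult (in_Z (Y a)) (in_W (Y b)) (m - m1) I (n - n1) L v \<noteq> 0"
    then have "n1 \<ge> 0" "m1 = k - n1"
      by (auto simp: exp_zw_def split: if_splits)
    moreover have "n - n1 \<ge> M"
      using * M[of "n - n1" L] assms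
      by (intro leI notI) (simp add: od_mult_in_Z_in_W Y_coeff_zero op_part_at_0)
    ultimately show "(m1, n1) \<in> (\<lambda>n1. (k - n1, n1)) ` {0..n - M}"
      by auto
  qed
  then show ?thesis
    by (rule finite_subset) simp
qed

lemma finite_exp_wz:
  assumes "finite I" "finite L"
  shows "finite {(m1, n1). exp_wz k K m1 I1 n1 L1
    *\<^sub>C od_mult (in_W (Y b)) (in_Z (Y a)) (m - m1) I (n - n1) L v \<noteq> 0}" (is "finite ?A")
proof -
  obtain M where M: "\<And>m I. m < M \<Longrightarrow> Y a m I v = 0"
    using Y_field by blast
  have "?A \<subseteq> (\<lambda>m1. (m1, k - m1)) ` {0..m - M}"
  proof (clarify)
    fix m1 n1
    assume *: "exp_wz k K m1 I1 n1 L1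
      *\<^sub>C od_mult (in_W (Y b)) (in_Z (Y a)) (m - m1) I (n - n1) L v \<noteq> 0"
    then have "m1 \<ge> 0" "n1 = k - m1"
      by (auto simp: exp_wz_def split: if_splits)
    moreover have "m - m1 \<ge> M"
      using * M[of "m - m1" I] assms
      by (intro leI notI) (simp add: od_mult_in_W_in_Z Y_coeff_zero op_part_at_0)
    ultimately show "(m1, n1) \<in> (\<lambda>m1. (m1, k - m1)) ` {0..m - M}"
      by auto
  qed
  then show ?thesis
    by (rule finite_subset) simp
qed

lemma finite_modes: "finite {j::nat. \<exists>J. mode N Y a (k + int j) J b \<noteq> 0}"
proof -
  obtain M where M: "\<And>m I. m < M \<Longrightarrow> Y a m I b = 0"
    using Y_field by blast
  have "{j::nat. \<exists>J. mode N Y a (k + int j) J b \<noteq> 0} \<subseteq> {..nat (- 1 - k - M)}"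
  proof clarify
    fix j J
    assume "mode N Y a (k + int j) J b \<noteq> 0"
    then have "\<not> - 1 - (k + int j) < M"
      using M by (auto simp: mode_def)
    then show "j \<le> nat (- 1 - k - M)"
      by linarith
  qed
  then show ?thesis
    by (rule finite_subset) simp
qed

end

end

theory Submission
  imports Defs
begin

text \<open>
  The operators \<open>S\<^sup>i\<close> reduce the identity to its even part. By uniqueness of covariant local fields
  \<open>Y(b, W) = Y(e\<^sup>\<zeta>\<^sup>S b, w)\<close>, and the commutators with \<open>S\<^sup>i\<close> give
  \<open>Y(a, Z) e\<^sup>\<zeta>\<^sup>S = e\<^sup>\<zeta>\<^sup>S Y(a, (z, \<theta> - \<zeta>))\<close>. Hence it is enough to treat one coefficient \<open>A(z)\<close> of
  \<open>Y(a, Z)\<close> and \<open>B(w) = Y(b, w)\<close>, for every integer \<open>k\<close>; the general \<open>K\<close> follows on multiplying by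
  \<open>(\<theta> - \<zeta>)\<^sup>K\<close>.

  In the even case let \<open>D\<^sub>k\<close> be the difference of the two sides. It vanishes for large \<open>k\<close> by locality, and
  \<open>D\<^sub>k\<^sub>+\<^sub>1 = (z - w) D\<^sub>k\<close>. So if \<open>D\<^sub>k\<^sub>+\<^sub>1 = 0\<close> then \<open>D\<^sub>k = \<delta>(z, w) d(w)\<close>. Both sides of the identity commute with a
  field \<open>Y(c, x)\<close> up to a power of \<open>(z - x)(w - x)\<close>, so \<open>d\<close> is local with respect to \<open>Y(c, x)\<close>; this replaces
  Dong's lemma. Since \<open>d\<close> is translation covariant and kills the vacuum, it vanishes by Goddard's argument,
  and the identity follows by downward induction on \<open>k\<close>.
\<close>


section \<open>Linear maps\<close>

text \<open>The defect series \<open>d(w)\<close> is the residue in \<open>z\<close> of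
  \<open>D\<close>, and on the vacuum it can be computed. In \<open>Y(b, W) Y(a, Z)|0>\<close>,
  multiplied by the expansion in \<open>|w| > |z|\<close>, no negative power of \<open>z\<close>
  occurs, so only the other product contributes to the residue. Its constant term in
  \<open>w\<close> is the mode \<open>a_(k) b\<close>, which is also the value at
  \<open>w = 0\<close> of the field on the right. This is where the modes in the identity come from.
  The sign between the two products is irrelevant to this argument; it enters only at the start of
  the descent, where locality makes the left side vanish.

  The dependence on \<open>K\<close> is pure Grassmann algebra. On the left, \<open>(\<theta> -
  \<zeta>)^K (\<theta> - \<zeta>)^U = \<sigma>(K, U) (\<theta> - \<zeta>)^(K \<union> U)\<close>; on
  the right, the odd derivatives of the delta distribution leave
  \<open>\<sigma>(J) (\<theta> - \<zeta>)^(N - J)\<close>. The sums match under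
  \<open>U = N - (J \<union> K)\<close>, separately for each \<open>j\<close>.\<close>

abbreviation linC :: "('v::superspace \<Rightarrow> 'v) \<Rightarrow> bool" where
  "linC \<equiv> Vector_Spaces.linear scaleC scaleC"

lemma linC_add: "linC f \<Longrightarrow> f (x + y) = f x + f y"
  by (rule module_hom.add[OF Vector_Spaces.linear.axioms(3)])

lemma linC_scale: "linC f \<Longrightarrow> f (c *\<^sub>C x) = c *\<^sub>C f x"
  by (rule module_hom.scale[OF Vector_Spaces.linear.axioms(3)])

lemma linC_zero: "linC f \<Longrightarrow> f 0 = 0"
  by (rule module_hom.zero[OF Vector_Spaces.linear.axioms(3)])

lemma linC_diff: "linC f \<Longrightarrow> f (x - y) = f x - f y"
  by (rule module_hom.diff[OF Vector_Spaces.linear.axioms(3)])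

lemma linC_sum: "linC f \<Longrightarrow> f (sum g A) = (\<Sum>x\<in>A. f (g x))"
  by (rule module_hom.sum[OF Vector_Spaces.linear.axioms(3)])

lemma linCI:
  assumes "\<And>x y. f (x + y) = f x + f y" "\<And>c x. f (c *\<^sub>C x) = c *\<^sub>C f x"
  shows "linC f"
  by unfold_locales (simp_all add: assms)

lemma linC_0: "linC 0"
  by unfold_locales simp_all

lemma linC_scaleC: "linC (\<lambda>x. c *\<^sub>C x)"
  by unfold_locales (simp_all add: scaleC_right_distrib scaleC_scaleC mult.commute)

lemma linC_comp_scale: "linC h \<Longrightarrow> linC (\<lambda>v. c *\<^sub>C h v)"
  using Vector_Spaces.linear_compose[OF _ linC_scaleC, of scaleC h c] by (simp add: comp_def)

lemma linC_minus: "linC f \<Longrightarrow> linC g \<Longrightarrow> linC (\<lambda>v. f v - g v)"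
  by (rule linCI) (simp_all add: linC_add linC_scale superspace.scale_right_diff_distrib)


section \<open>Expansions of powers of $z - w$\<close>

text \<open>A function of two integers stands for the coefficients of \<open>z\<^sup>m w\<^sup>n\<close>: \<open>mul_diff\<close> is multiplication by \<open>z - w\<close>, and
  \<open>expansion k\<close> is multiplication by \<open>i\<^bsub>z,w\<^esub> (z - w)\<^sup>k\<close>.\<close>

definition mul_diff :: "(int \<Rightarrow> int \<Rightarrow> 'v::ab_group_add) \<Rightarrow> int \<Rightarrow> int \<Rightarrow> 'v" where
  "mul_diff f m n = f (m - 1) n - f m (n - 1)"

text \<open>\<open>Sum_any\<close> over infinitely many nonzero terms is 0 by convention, so the
  laws of \<open>expansion\<close> need a finiteness hypothesis. A lower bound for the exponent of
  \<open>w\<close>, uniform in that of \<open>z\<close>, provides it.\<close>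

definition lower_bounded :: "(int \<Rightarrow> int \<Rightarrow> 'v::zero) \<Rightarrow> bool" where
  "lower_bounded f \<longleftrightarrow> (\<exists>M. \<forall>n<M. \<forall>m. f m n = 0)"

definition expansion :: "int \<Rightarrow> (int \<Rightarrow> int \<Rightarrow> 'v::superspace) \<Rightarrow> int \<Rightarrow> int \<Rightarrow> 'v" where
  "expansion k f m n = Sum_any (\<lambda>j::nat. ((- 1) ^ j * (of_int k gchoose j)) *\<^sub>C f (m - k + int j) (n - int j))"

lemma expansion_eq_sum:
  assumes "\<And>j. j \<ge> J \<Longrightarrow> (of_int k gchoose j) = (0 :: complex) \<or> f (m - k + int j) (n - int j) = 0"
  shows "expansion k f m n = (\<Sum>j<J. ((- 1) ^ j * (of_int k gchoose j)) *\<^sub>C f (m - k + int j) (n - int j))"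
  unfolding expansion_def
proof (rule Sum_any.expand_superset)
  show "{j. ((- 1) ^ j * (of_int k gchoose j)) *\<^sub>C f (m - k + int j) (n - int j) \<noteq> 0} \<subseteq> {..<J}"
  proof (rule subsetI, rule ccontr)
    fix j assume "j \<in> {j. ((- 1) ^ j * (of_int k gchoose j)) *\<^sub>C f (m - k + int j) (n - int j) \<noteq> 0}" "j \<notin> {..<J}"
    then show False using assms[of j] by auto
  qed
qed simp

lemma expansion_eq_sum_bounded:
  assumes "\<And>m n. n < M \<Longrightarrow> f m n = 0" "n - M < int J"
  shows "expansion k f m n = (\<Sum>j<J. ((- 1) ^ j * (of_int k gchoose j)) *\<^sub>C f (m - k + int j) (n - int j))"
  by (rule expansion_eq_sum) (use assms in auto)

lemma gbinomial_eq_0_of_int: "0 \<le> k \<Longrightarrow> k < int j \<Longrightarrow> (of_int k gchoose j) = (0 :: complex)"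
  using binomial_gbinomial[of "nat k" j, where 'a=complex] by (simp add: binomial_eq_0)

lemma expansion_0: "expansion 0 f m n = f m n"
proof -
  have "expansion 0 f m n = (\<Sum>j<1. ((- 1) ^ j * (of_int 0 gchoose j)) *\<^sub>C f (m - 0 + int j) (n - int j))"
    unfolding expansion_def
  proof (rule Sum_any.expand_superset)
    show "{j. ((- 1) ^ j * (of_int 0 gchoose j)) *\<^sub>C f (m - 0 + int j) (n - int j) \<noteq> 0} \<subseteq> {..<1}"
      by (auto simp: gbinomial_0_left)
  qed simp
  then show ?thesis by (simp add: superspace.scale_one)
qed

lemma expansion_add:
  assumes "lower_bounded f" "lower_bounded g"
  shows "expansion k (\<lambda>m n. f m n + g m n) m n = expansion k f m n + expansion k g m n"
proof -
  obtain M1 M2 where M: "\<And>m n. n < M1 \<Longrightarrow> f m n = 0" "\<And>m n. n < M2 \<Longrightarrow> g m n = 0"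
    using assms unfolding lower_bounded_def by blast
  define M where "M = min M1 M2"
  define J where "J = nat (n - M + 1)"
  have J: "n - M < int J" by (simp add: J_def)
  have "expansion k f m n = (\<Sum>j<J. ((- 1) ^ j * (of_int k gchoose j)) *\<^sub>C f (m - k + int j) (n - int j))"
    "expansion k g m n = (\<Sum>j<J. ((- 1) ^ j * (of_int k gchoose j)) *\<^sub>C g (m - k + int j) (n - int j))"
    "expansion k (\<lambda>m n. f m n + g m n) m n = (\<Sum>j<J. ((- 1) ^ j * (of_int k gchoose j)) *\<^sub>C
      (f (m - k + int j) (n - int j) + g (m - k + int j) (n - int j)))"
    using expansion_eq_sum_bounded[of M f n J k m] expansion_eq_sum_bounded[of M g n J k m]
      expansion_eq_sum_bounded[of M "\<lambda>m n. f m n + g m n" n J k m] M J by (simp_all add: M_def)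
  then show ?thesis
    by (simp only: superspace.scale_right_distrib sum.distrib)
qed

lemma expansion_linC:
  assumes "lower_bounded f" "linC h"
  shows "expansion k (\<lambda>m n. h (f m n)) m n = h (expansion k f m n)"
proof -
  obtain M where M: "\<And>m n. n < M \<Longrightarrow> f m n = 0"
    using assms unfolding lower_bounded_def by blast
  define J where "J = nat (n - M + 1)"
  have J: "n - M < int J" by (simp add: J_def)
  have "expansion k f m n = (\<Sum>j<J. ((- 1) ^ j * (of_int k gchoose j)) *\<^sub>C f (m - k + int j) (n - int j))"
    "expansion k (\<lambda>m n. h (f m n)) m n = (\<Sum>j<J. ((- 1) ^ j * (of_int k gchoose j)) *\<^sub>C
      h (f (m - k + int j) (n - int j)))"
    using expansion_eq_sum_bounded[of M f n J k m]
      expansion_eq_sum_bounded[of M "\<lambda>m n. h (f m n)" n J k m] M J by (simp_all add: linC_zero[OF assms(2)])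
  then show ?thesis
    by (simp only: linC_sum[OF assms(2)] linC_scale[OF assms(2)])
qed

lemma expansion_scaleC:
  "lower_bounded f \<Longrightarrow> expansion k (\<lambda>m n. c *\<^sub>C f m n) m n = c *\<^sub>C expansion k f m n"
  by (rule expansion_linC[OF _ linC_scaleC])

lemma expansion_diff:
  assumes "lower_bounded f" "lower_bounded g"
  shows "expansion k (\<lambda>m n. f m n - g m n) m n = expansion k f m n - expansion k g m n"
proof -
  have "lower_bounded (\<lambda>m n. (-1) *\<^sub>C g m n)"
    using assms(2) unfolding lower_bounded_def by (metis superspace.scale_zero_right)
  from expansion_add[OF assms(1) this, of k m n] show ?thesis
    using expansion_scaleC[OF assms(2), of k "-1" m n] by simp
qed

text \<open>Pascal's rule. Finiteness comes from \<open>f\<close>, or for \<open>k \<ge> 0\<close>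
  from the binomial coefficients; the second case serves brackets of fields, which need not be
  bounded in either variable.\<close>

lemma expansion_Suc:
  assumes "lower_bounded f \<or> 0 \<le> k"
  shows "expansion (k + 1) f m n = mul_diff (expansion k f) m n"
proof -
  define t where "t j = f (m - (k + 1) + int j) (n - int j)" for j
  define c where "c k j = ((- 1) ^ j * (of_int k gchoose j) :: complex)" for k :: int and j :: nat
  obtain J where J: "\<And>j. j \<ge> Suc J \<Longrightarrow> (of_int (k + 1) gchoose j) = (0 :: complex) \<or> t j = 0"
    "\<And>j. j \<ge> J \<Longrightarrow> (of_int k gchoose j) = (0 :: complex) \<or> t (Suc j) = 0"
    "\<And>j. j \<ge> Suc J \<Longrightarrow> (of_int k gchoose j) = (0 :: complex) \<or> t j = 0"
  proof (cases "0 \<le> k")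
    case True
    show ?thesis
      by (rule that[of "nat (k + 1)"]; rule disjI1, rule gbinomial_eq_0_of_int; use True in linarith)
  next
    case False
    then obtain M where M: "\<And>m n. n < M \<Longrightarrow> f m n = 0"
      using assms unfolding lower_bounded_def by blast
    show ?thesis
      by (rule that[of "nat (n - M + 1)"]; rule disjI2; unfold t_def; rule M; linarith)
  qed
  have c0: "c k 0 = 1" for k by (simp add: c_def)
  have cS: "c (k + 1) (Suc j) = c k (Suc j) - c k j" for j
    using gbinomial_Suc_Suc[of "of_int k :: complex" j] by (simp add: c_def algebra_simps)
  have 1: "expansion (k + 1) f m n = (\<Sum>j<Suc J. c (k + 1) j *\<^sub>C t j)"
    using expansion_eq_sum[of "Suc J" "k + 1" f m n] J(1) by (simp add: t_def c_def)
  have 2: "expansion k f (m - 1) n = (\<Sum>j<Suc J. c k j *\<^sub>C t j)"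
    using expansion_eq_sum[of "Suc J" k f "m - 1" n] J(3) by (simp add: t_def c_def diff_diff_eq add.commute)
  have 3: "expansion k f m (n - 1) = (\<Sum>j<J. c k j *\<^sub>C t (Suc j))"
    using expansion_eq_sum[of J k f m "n - 1"] J(2) by (simp add: t_def c_def diff_diff_eq add.commute)
  show ?thesis
    unfolding mul_diff_def 1 2 3 sum.lessThan_Suc_shift
    by (simp add: c0 cS superspace.scale_left_diff_distrib sum_subtractf)
qed

text \<open>The derivation \<open>\<partial>_z + \<partial>_w\<close> kills \<open>z - w\<close>,
  hence commutes with multiplication by its powers. In coefficients this is the absorption identity
  \<open>cS\<close>, which moves a factor between neighbouring terms.\<close>

lemma expansion_derivation:
  assumes "lower_bounded f"
  shows "expansion k (\<lambda>m n. of_int (m + 1) *\<^sub>C f (m + 1) n + of_int (n + 1) *\<^sub>C f m (n + 1)) m n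
    = of_int (m + 1) *\<^sub>C expansion k f (m + 1) n + of_int (n + 1) *\<^sub>C expansion k f m (n + 1)"
proof -
  obtain M where M: "\<And>m n. n < M \<Longrightarrow> f m n = 0"
    using assms unfolding lower_bounded_def by blast
  define J where "J = nat (n - M + 2)"
  have J: "n + 1 - M < int J" by (simp add: J_def)
  define t where "t j = f (m - k + int j) (n + 1 - int j)" for j
  define c where "c j = ((- 1) ^ j * (of_int k gchoose j) :: complex)" for j :: nat
  have cS: "of_nat (Suc j) * c (Suc j) = (of_nat j - of_int k) * c j" for j
    using arg_cong[OF gbinomial_mult_1'[of "of_int k :: complex" j], of "\<lambda>x. (- 1) ^ j * x"]
    by (simp add: c_def algebra_simps)
  have 1: "expansion k (\<lambda>m n. of_int (m + 1) *\<^sub>C f (m + 1) n + of_int (n + 1) *\<^sub>C f m (n + 1)) m n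
     = (\<Sum>j<Suc J. c j *\<^sub>C (of_int (m - k + int j + 1) *\<^sub>C t (Suc j) + of_int (n - int j + 1) *\<^sub>C t j))"
    using expansion_eq_sum_bounded[of "M - 1" "\<lambda>m n. of_int (m + 1) *\<^sub>C f (m + 1) n + of_int (n + 1) *\<^sub>C f m (n + 1)" n "Suc J" k m] M J
    by (simp add: t_def c_def algebra_simps)
  have 2: "expansion k f (m + 1) n = (\<Sum>j<Suc J. c j *\<^sub>C t (Suc j))"
    using expansion_eq_sum_bounded[of M f n "Suc J" k "m + 1"] M J by (simp add: t_def c_def algebra_simps)
  have 3: "expansion k f m (n + 1) = (\<Sum>j<Suc J. c j *\<^sub>C t j)"
    using expansion_eq_sum_bounded[of M f "n + 1" "Suc J" k m] M J by (simp add: t_def c_def)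
  have tJ: "t (Suc J) = 0" using M J by (auto simp: t_def)
  have "(\<Sum>j<Suc J. (of_nat j * c j) *\<^sub>C t j) = (\<Sum>j<Suc J. (of_nat (Suc j) * c (Suc j)) *\<^sub>C t (Suc j))"
    using tJ by (subst sum.lessThan_Suc_shift) simp
  also have "\<dots> = (\<Sum>j<Suc J. ((of_nat j - of_int k) * c j) *\<^sub>C t (Suc j))"
    by (simp only: cS)
  finally have *: "(\<Sum>j<Suc J. (of_nat j * c j) *\<^sub>C t j) = (\<Sum>j<Suc J. ((of_nat j - of_int k) * c j) *\<^sub>C t (Suc j))" .
  have "(\<Sum>j<Suc J. c j *\<^sub>C (of_int (m - k + int j + 1) *\<^sub>C t (Suc j) + of_int (n - int j + 1) *\<^sub>C t j))
     = (\<Sum>j<Suc J. of_int (m + 1) *\<^sub>C c j *\<^sub>C t (Suc j) + ((of_nat j - of_int k) * c j) *\<^sub>C t (Suc j)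
        + (of_int (n + 1) *\<^sub>C c j *\<^sub>C t j - (of_nat j * c j) *\<^sub>C t j))"
    by (intro sum.cong refl) (simp add: algebra_simps)
  also have "\<dots> = of_int (m + 1) *\<^sub>C (\<Sum>j<Suc J. c j *\<^sub>C t (Suc j)) + of_int (n + 1) *\<^sub>C (\<Sum>j<Suc J. c j *\<^sub>C t j)"
    unfolding sum.distrib sum_subtractf * superspace.scale_sum_right by simp
  finally show ?thesis unfolding 1 2 3 .
qed

text \<open>Moves powers of multiplication operators through an embedding \<open>e\<close> of
  coefficient functions. The class \<open>P\<close> is there for the case where \<open>e\<close> is
  an expansion and the intertwining holds only for truncated series.\<close>

lemma funpow_intertwine:
  assumes "\<And>g. P g \<Longrightarrow> f (e g) = e (f' g)" "\<And>g. P g \<Longrightarrow> P (f' g)" "P g"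
  shows "(f ^^ r) (e g) = e ((f' ^^ r) g)" "P ((f' ^^ r) g)"
proof -
  have "(f ^^ r) (e g) = e ((f' ^^ r) g) \<and> P ((f' ^^ r) g)"
    by (induction r) (auto simp: assms)
  then show "(f ^^ r) (e g) = e ((f' ^^ r) g)" "P ((f' ^^ r) g)" by auto
qed

lemma funpow_commuting:
  assumes "\<And>x. f (g x) = g (f x)"
  shows "(f ^^ r) ((g ^^ s) x) = (g ^^ s) ((f ^^ r) x)"
proof -
  have *: "f ((g ^^ s) x) = (g ^^ s) (f x)" for x
    by (induction s) (auto simp: assms)
  show ?thesis
    by (induction r) (auto simp: *)
qed

lemma funpow_additive:
  fixes f :: "'a::ab_group_add \<Rightarrow> 'a"
  assumes "\<And>x y. f (x + y) = f x + f y"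
  shows "(f ^^ r) (x + y) = (f ^^ r) x + (f ^^ r) y"
  by (induction r) (auto simp: assms)

lemma mul_diff_zero: "mul_diff (\<lambda>_ _. 0) = (\<lambda>_ _. 0)"
  by (simp add: fun_eq_iff mul_diff_def)

lemma funpow_mul_diff_zero: "(mul_diff ^^ r) (\<lambda>_ _. 0) = (\<lambda>_ _. 0)"
  by (induction r) (simp_all add: mul_diff_zero)

lemma funpow_mul_diff_mono:
  assumes "(mul_diff ^^ r) f = (\<lambda>_ _. 0)" "r \<le> s"
  shows "(mul_diff ^^ s) f = (\<lambda>_ _. 0)"
proof -
  have "(mul_diff ^^ s) f = (mul_diff ^^ (s - r)) ((mul_diff ^^ r) f)"
    using assms(2) by (metis comp_apply funpow_add le_add_diff_inverse2)
  then show ?thesis by (simp add: assms funpow_mul_diff_zero)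
qed

lemma funpow_mul_diff_diff:
  "(mul_diff ^^ r) (\<lambda>m n. f m n - g m n) = (\<lambda>m n. (mul_diff ^^ r) f m n - (mul_diff ^^ r) g m n)"
  by (induction r) (simp_all add: fun_eq_iff mul_diff_def)

lemma funpow_mul_diff_expansion:
  assumes "lower_bounded f \<or> 0 \<le> k"
  shows "(mul_diff ^^ r) (expansion k f) = expansion (k + int r) f"
proof (induction r)
  case (Suc r)
  have "expansion (k + int r + 1) f = mul_diff (expansion (k + int r) f)"
    using expansion_Suc[of f "k + int r"] assms by fastforce
  with Suc show ?case by (simp add: add_ac)
qed simp

text \<open>Without negative powers of the second variable one may set it to 0, and then
  \<open>(z - w)^r\<close> becomes \<open>z^r\<close>.\<close>

lemma funpow_mul_diff_regular:
  fixes g :: "int \<Rightarrow> int \<Rightarrow> 'v::ab_group_add"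
  assumes "\<And>n l. l < 0 \<Longrightarrow> g n l = 0"
  shows "(mul_diff ^^ r) g n 0 = g (n - int r) 0"
proof -
  have "(\<forall>n l. l < 0 \<longrightarrow> (mul_diff ^^ r) g n l = 0) \<and> (\<forall>n. (mul_diff ^^ r) g n 0 = g (n - int r) 0)"
  proof (induction r)
    case 0 then show ?case using assms by simp
  next
    case (Suc r)
    then show ?case
      by (auto simp: mul_diff_def algebra_simps)
  qed
  then show ?thesis by blast
qed


section \<open>Locality in three variables\<close>

text \<open>The variables are \<open>z\<close>, \<open>w\<close>, \<open>x\<close>, in this order.\<close>

type_synonym 'v coeff3 = "int \<Rightarrow> int \<Rightarrow> int \<Rightarrow> 'v"

definition mul_z_minus_x :: "'v::ab_group_add coeff3 \<Rightarrow> 'v coeff3" where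
  "mul_z_minus_x G m n l = G (m - 1) n l - G m n (l - 1)"

definition mul_w_minus_x :: "'v::ab_group_add coeff3 \<Rightarrow> 'v coeff3" where
  "mul_w_minus_x G m n l = G m (n - 1) l - G m n (l - 1)"

text \<open>Locality of a distribution in \<open>z\<close> and \<open>w\<close> with respect to a
  field in \<open>x\<close>. A single exponent for both factors is no restriction, since exponents
  can be raised.\<close>

definition annihilated :: "nat \<Rightarrow> 'v::ab_group_add coeff3 \<Rightarrow> bool" where
  "annihilated r G \<longleftrightarrow> (mul_z_minus_x ^^ r) ((mul_w_minus_x ^^ r) G) = (\<lambda>_ _ _. 0)"

lemma mul_zx_wx: "mul_z_minus_x (mul_w_minus_x G) = mul_w_minus_x (mul_z_minus_x G)"
  by (simp add: fun_eq_iff mul_z_minus_x_def mul_w_minus_x_def)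

lemma mul_zx_add: "mul_z_minus_x (G + H) = mul_z_minus_x G + mul_z_minus_x H"
  by (simp add: fun_eq_iff mul_z_minus_x_def)

lemma mul_wx_add: "mul_w_minus_x (G + H) = mul_w_minus_x G + mul_w_minus_x H"
  by (simp add: fun_eq_iff mul_w_minus_x_def)

lemma funpow_mul_zero: "(mul_z_minus_x ^^ r) (\<lambda>_ _ _. 0) = (\<lambda>_ _ _. 0)" "(mul_w_minus_x ^^ r) (\<lambda>_ _ _. 0) = (\<lambda>_ _ _. 0)"
  by (induction r) (simp_all add: fun_eq_iff mul_z_minus_x_def mul_w_minus_x_def)

lemma annihilated_add: "annihilated r G \<Longrightarrow> annihilated r H \<Longrightarrow> annihilated r (G + H)"
  unfolding annihilated_def
  by (simp add: funpow_additive[of mul_z_minus_x, OF mul_zx_add] funpow_additive[of mul_w_minus_x, OF mul_wx_add])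
    (simp add: fun_eq_iff)

lemma annihilated_linC:
  assumes "annihilated r G" "linC h"
  shows "annihilated r (\<lambda>m n l. h (G m n l))"
proof -
  let ?e = "\<lambda>G m n l. h (G m n l)"
  have z: "mul_z_minus_x (?e G) = ?e (mul_z_minus_x G)" and w: "mul_w_minus_x (?e G) = ?e (mul_w_minus_x G)" for G :: "'a coeff3"
    by (simp_all add: fun_eq_iff mul_z_minus_x_def mul_w_minus_x_def linC_diff[OF assms(2)])
  have "(mul_z_minus_x ^^ r) ((mul_w_minus_x ^^ r) (?e G)) = (mul_z_minus_x ^^ r) (?e ((mul_w_minus_x ^^ r) G))"
    by (rule arg_cong[OF funpow_intertwine(1)[of "\<lambda>_. True" mul_w_minus_x ?e, OF w TrueI TrueI]])
  also have "\<dots> = ?e ((mul_z_minus_x ^^ r) ((mul_w_minus_x ^^ r) G))"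
    by (rule funpow_intertwine(1)[of "\<lambda>_. True" mul_z_minus_x ?e, OF z TrueI TrueI])
  finally show ?thesis
    using assms(1) by (simp add: annihilated_def linC_zero[OF assms(2)])
qed

lemma annihilated_diff_linC:
  assumes "annihilated r G" "annihilated r H"
  shows "annihilated r (\<lambda>m n l. G m n l - c *\<^sub>C H m n l)"
proof -
  have "annihilated r (G + (\<lambda>m n l. (- c) *\<^sub>C H m n l))"
    by (rule annihilated_add[OF assms(1) annihilated_linC[OF assms(2) linC_scaleC]])
  then show ?thesis by (simp add: plus_fun_def)
qed

lemma annihilated_mono:
  assumes "annihilated r G" "r \<le> s"
  shows "annihilated s G"
proof -
  obtain t where s: "s = t + r" using assms(2) by (metis add.commute le_iff_add)
  have "(mul_z_minus_x ^^ s) ((mul_w_minus_x ^^ s) G) = (mul_z_minus_x ^^ t) ((mul_w_minus_x ^^ t) ((mul_z_minus_x ^^ r) ((mul_w_minus_x ^^ r) G)))"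
    unfolding s funpow_add by (simp add: funpow_commuting[of mul_z_minus_x mul_w_minus_x, OF mul_zx_wx])
  then show ?thesis
    using assms(1) by (simp add: annihilated_def funpow_mul_zero)
qed

lemma annihilated_swap:
  assumes "annihilated r G"
  shows "annihilated r (\<lambda>m n l. G n m l)"
proof -
  let ?e = "\<lambda>G m n l. G n m l"
  have z: "mul_z_minus_x (?e G) = ?e (mul_w_minus_x G)" and w: "mul_w_minus_x (?e G) = ?e (mul_z_minus_x G)" for G :: "'a coeff3"
    by (simp_all add: fun_eq_iff mul_z_minus_x_def mul_w_minus_x_def)
  have "(mul_z_minus_x ^^ r) ((mul_w_minus_x ^^ r) (?e G)) = (mul_z_minus_x ^^ r) (?e ((mul_z_minus_x ^^ r) G))"
    by (rule arg_cong[OF funpow_intertwine(1)[of "\<lambda>_. True" mul_w_minus_x ?e, OF w TrueI TrueI]])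
  also have "\<dots> = ?e ((mul_w_minus_x ^^ r) ((mul_z_minus_x ^^ r) G))"
    by (rule funpow_intertwine(1)[of "\<lambda>_. True" mul_z_minus_x ?e, OF z TrueI TrueI])
  finally show ?thesis
    using assms(1) by (simp add: annihilated_def funpow_commuting[of mul_z_minus_x mul_w_minus_x, OF mul_zx_wx])
qed

lemma lower_bounded_mul_zx:
  assumes "\<forall>l. lower_bounded (\<lambda>m n. G m n l)"
  shows "\<forall>l. lower_bounded (\<lambda>m n. mul_z_minus_x G m n l)"
proof
  fix l
  obtain M1 M2 where "\<forall>n<M1. \<forall>m. G m n l = 0" "\<forall>n<M2. \<forall>m. G m n (l - 1) = 0"
    using assms unfolding lower_bounded_def by meson
  then have "\<forall>n < min M1 M2. \<forall>m. mul_z_minus_x G m n l = 0"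
    by (simp add: mul_z_minus_x_def)
  then show "lower_bounded (\<lambda>m n. mul_z_minus_x G m n l)"
    unfolding lower_bounded_def by blast
qed

lemma lower_bounded_mul_wx:
  assumes "\<forall>l. lower_bounded (\<lambda>m n. G m n l)"
  shows "\<forall>l. lower_bounded (\<lambda>m n. mul_w_minus_x G m n l)"
proof
  fix l
  obtain M1 M2 where "\<forall>n<M1. \<forall>m. G m n l = 0" "\<forall>n<M2. \<forall>m. G m n (l - 1) = 0"
    using assms unfolding lower_bounded_def by meson
  then have "\<forall>n < min M1 M2. \<forall>m. mul_w_minus_x G m n l = 0"
    by (simp add: mul_w_minus_x_def)
  then show "lower_bounded (\<lambda>m n. mul_w_minus_x G m n l)"
    unfolding lower_bounded_def by blast
qed

lemma lower_bounded_shift1: "lower_bounded (\<lambda>m n. f m n) \<Longrightarrow> lower_bounded (\<lambda>m n. f (m - 1) n)"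
  unfolding lower_bounded_def by blast

lemma lower_bounded_shift2: "lower_bounded (\<lambda>m n. f m n) \<Longrightarrow> lower_bounded (\<lambda>m n. f m (n - 1))"
  unfolding lower_bounded_def by (elim ex_forward) auto

lemma expansion_shift1: "expansion k (\<lambda>m n. f (m - 1) n) m n = expansion k f (m - 1) n"
  by (simp add: expansion_def algebra_simps)

lemma expansion_shift2: "expansion k (\<lambda>m n. f m (n - 1)) m n = expansion k f m (n - 1)"
  by (simp add: expansion_def algebra_simps)

text \<open>Multiplication by \<open>z - x\<close> or \<open>w - x\<close> commutes with
  multiplication by powers of \<open>z - w\<close>. The bound in \<open>w\<close>, for each fixed
  power of \<open>x\<close>, has to be carried along to keep the expansions finite.\<close>

lemma annihilated_expansion:
  assumes "annihilated r G" "\<And>l. lower_bounded (\<lambda>m n. G m n l)"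
  shows "annihilated r (\<lambda>m n l. expansion k (\<lambda>m n. G m n l) m n)"
proof -
  let ?e = "\<lambda>G m n l. expansion k (\<lambda>m n. G m n l) m n"
  let ?P = "\<lambda>G :: 'a coeff3. \<forall>l. lower_bounded (\<lambda>m n. G m n l)"
  have z: "mul_z_minus_x (?e G) = ?e (mul_z_minus_x G)" and w: "mul_w_minus_x (?e G) = ?e (mul_w_minus_x G)"
    if "?P G" for G :: "'a coeff3"
    using that
      expansion_diff[OF lower_bounded_shift1[OF that[rule_format]] that[rule_format], of k]
      expansion_diff[OF lower_bounded_shift2[OF that[rule_format]] that[rule_format], of k]
    by (simp_all add: fun_eq_iff mul_z_minus_x_def mul_w_minus_x_def flip: expansion_shift1 expansion_shift2)
  have P: "?P G" "?P ((mul_w_minus_x ^^ r) G)"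
    using assms(2) funpow_intertwine(2)[of ?P mul_w_minus_x ?e mul_w_minus_x, OF w] lower_bounded_mul_wx
    by blast+
  have "(mul_z_minus_x ^^ r) ((mul_w_minus_x ^^ r) (?e G)) = (mul_z_minus_x ^^ r) (?e ((mul_w_minus_x ^^ r) G))"
    by (rule arg_cong[OF funpow_intertwine(1)[of ?P mul_w_minus_x ?e, OF w lower_bounded_mul_wx P(1)]])
  also have "\<dots> = ?e ((mul_z_minus_x ^^ r) ((mul_w_minus_x ^^ r) G))"
    by (rule funpow_intertwine(1)[of ?P mul_z_minus_x ?e, OF z lower_bounded_mul_zx P(2)])
  finally show ?thesis
    using assms(1) by (simp add: annihilated_def expansion_def)
qed

text \<open>The coefficients \<open>g (m + n + 1) l\<close> are those of
  \<open>\<delta>(z, w) g(w, x)\<close>. Against the delta distribution \<open>z - x\<close> acts as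
  \<open>w - x\<close>, so the two exponents add up.\<close>

lemma annihilated_diagonal:
  assumes "annihilated r (\<lambda>m n l. g (m + n + 1) l)"
  shows "(mul_diff ^^ (r + r)) g = (\<lambda>_ _. 0)"
proof -
  let ?e = "\<lambda>g m n l. g (m + n + 1) l"
  have z: "mul_z_minus_x (?e g) = ?e (mul_diff g)" and w: "mul_w_minus_x (?e g) = ?e (mul_diff g)"
    for g :: "int \<Rightarrow> int \<Rightarrow> 'a"
    by (simp_all add: fun_eq_iff mul_z_minus_x_def mul_w_minus_x_def mul_diff_def algebra_simps)
  have "(mul_z_minus_x ^^ r) ((mul_w_minus_x ^^ r) (?e g)) = (mul_z_minus_x ^^ r) (?e ((mul_diff ^^ r) g))"
    by (rule arg_cong[OF funpow_intertwine(1)[of "\<lambda>_. True" mul_w_minus_x ?e, OF w TrueI TrueI]])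
  also have "\<dots> = ?e ((mul_diff ^^ r) ((mul_diff ^^ r) g))"
    by (rule funpow_intertwine(1)[of "\<lambda>_. True" mul_z_minus_x ?e, OF z TrueI TrueI])
  finally have "?e ((mul_diff ^^ (r + r)) g) = (\<lambda>_ _ _. 0)"
    using assms(1) by (simp add: annihilated_def funpow_add)
  then have "(mul_diff ^^ (r + r)) g (0 + (n - 1) + 1) l = 0" for n l
    by metis
  then show ?thesis by (simp add: fun_eq_iff)
qed

text \<open>The factor \<open>w - x\<close> alone annihilates, with \<open>z\<close> as a parameter.
  The shift \<open>f m\<close> is allowed for this reason, and the singular part needs it: there the
  exponent of \<open>w\<close> depends on that of \<open>z\<close>.\<close>

lemma annihilated_wx:
  assumes "\<And>m. (mul_diff ^^ r) (g m) = (\<lambda>_ _. 0)" "\<And>m. linC (h m)"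
  shows "annihilated r (\<lambda>m n l. h m (g m (n + f m) l))"
proof -
  let ?e = "\<lambda>g m n l. h m (g m (n + f m) l)"
  let ?d = "\<lambda>g m. mul_diff (g m)"
  have w: "mul_w_minus_x (?e g) = ?e (?d g)" for g
    by (simp add: fun_eq_iff mul_w_minus_x_def mul_diff_def linC_diff[OF assms(2)] algebra_simps)
  have "(?d ^^ r) g m = (mul_diff ^^ r) (g m)" for m
    by (induction r) simp_all
  then show ?thesis
    unfolding annihilated_def funpow_intertwine(1)[of "\<lambda>_. True" mul_w_minus_x ?e, OF w TrueI TrueI]
    by (simp add: assms linC_zero[OF assms(2)] funpow_mul_zero)
qed

lemma annihilated_wx_sum:
  assumes "\<And>j. j \<in> J \<Longrightarrow> (mul_diff ^^ r) (g j) = (\<lambda>_ _. 0)" "finite J"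
  shows "annihilated r (\<lambda>m n l. \<Sum>j\<in>J. c j m *\<^sub>C g j (n + f j m) l)"
  using assms(2,1)
proof (induction J)
  case empty
  then show ?case by (simp add: annihilated_def funpow_mul_zero)
next
  case (insert j J)
  have "annihilated r ((\<lambda>m n l. c j m *\<^sub>C g j (n + f j m) l) + (\<lambda>m n l. \<Sum>j\<in>J. c j m *\<^sub>C g j (n + f j m) l))"
    by (rule annihilated_add; (rule annihilated_wx[of r "\<lambda>_. g j" "\<lambda>m v. c j m *\<^sub>C v"] insert.IH)?)
      (use insert.prems in \<open>auto intro: linC_scaleC\<close>)
  then show ?case using insert by (simp add: plus_fun_def)
qed

text \<open>The left-hand side of Borcherds' identity for two fields without odd variables; the factor
  \<open>(- 1)\<^sup>k\<close> turns \<open>i\<^bsub>w,z\<^esub> (w - z)\<^sup>k\<close> into \<open>i\<^bsub>w,z\<^esub> (z - w)\<^sup>k\<close>.\<close>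

definition ope :: "int \<Rightarrow> complex \<Rightarrow> (int \<Rightarrow> 'v \<Rightarrow> 'v) \<Rightarrow> (int \<Rightarrow> 'v \<Rightarrow> 'v) \<Rightarrow> int \<Rightarrow> int \<Rightarrow> 'v \<Rightarrow> 'v::superspace" where
  "ope k \<epsilon> A B m n v = expansion k (\<lambda>m n. A m (B n v)) m n
     - (\<epsilon> * (- 1) powi k) *\<^sub>C expansion k (\<lambda>n m. B n (A m v)) n m"

definition bracket :: "complex \<Rightarrow> (int \<Rightarrow> 'v \<Rightarrow> 'v) \<Rightarrow> (int \<Rightarrow> 'v \<Rightarrow> 'v) \<Rightarrow> 'v \<Rightarrow> int \<Rightarrow> int \<Rightarrow> 'v::superspace" where
  "bracket s A C v m l = A m (C l v) - s *\<^sub>C C l (A m v)"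

definition is_field :: "(int \<Rightarrow> 'v \<Rightarrow> 'v::superspace) \<Rightarrow> bool" where
  "is_field A \<longleftrightarrow> (\<forall>m. linC (A m)) \<and> (\<forall>v. \<exists>M. \<forall>m<M. A m v = 0)"

lemma field_linC: "is_field A \<Longrightarrow> linC (A m)"
  by (simp add: is_field_def)

lemma lower_bounded_field:
  assumes "\<And>m. linC (A m)" "is_field B"
  shows "lower_bounded (\<lambda>m n. A m (B n v))"
proof -
  obtain M where "\<forall>n<M. B n v = 0" using assms(2) unfolding is_field_def by blast
  then show ?thesis unfolding lower_bounded_def by (intro exI[of _ M]) (simp add: linC_zero assms(1))
qed

lemma lower_bounded_minus:
  fixes f g :: "int \<Rightarrow> int \<Rightarrow> 'v::ab_group_add"
  assumes "lower_bounded f" "lower_bounded g"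
  shows "lower_bounded (\<lambda>m n. f m n - g m n)"
proof -
  obtain M1 M2 where "\<forall>n<M1. \<forall>m. f m n = 0" "\<forall>n<M2. \<forall>m. g m n = 0"
    using assms unfolding lower_bounded_def by meson
  then show ?thesis
    unfolding lower_bounded_def by (intro exI[of _ "min M1 M2"]) simp
qed

text \<open>\<open>A B C - s t C A B = A (B C - t C B) + t (A C - s C A) B\<close>. A power of
  \<open>w - x\<close> kills the first summand, a power of \<open>z - x\<close> the second.\<close>

lemma annihilated_triple:
  assumes "\<And>v. (mul_diff ^^ r) (bracket s A C v) = (\<lambda>_ _. 0)"
    and "\<And>v. (mul_diff ^^ r) (bracket t B C v) = (\<lambda>_ _. 0)"
    and lin: "is_field A" "is_field B"
  shows "annihilated r (\<lambda>m n l. A m (B n (C l v)) - (s * t) *\<^sub>C C l (A m (B n v)))"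
proof -
  have "annihilated r (\<lambda>m n l. A m (bracket t B C v n l))"
    using annihilated_wx[of r "\<lambda>_. bracket t B C v" A "\<lambda>_. 0"] assms by (simp add: field_linC)
  moreover have "annihilated r (\<lambda>m n l. bracket s A C (B n v) m l)"
    using annihilated_swap[OF annihilated_wx[of r "\<lambda>n. bracket s A C (B n v)" "\<lambda>_ v. v" "\<lambda>_. 0"]] assms
    by (simp add: superspace.linear_ident)
  ultimately have "annihilated r (\<lambda>m n l. A m (bracket t B C v n l) - (- t) *\<^sub>C bracket s A C (B n v) m l)"
    by (rule annihilated_diff_linC)
  moreover have "A m (bracket t B C v n l) - (- t) *\<^sub>C bracket s A C (B n v) m l
    = A m (B n (C l v)) - (s * t) *\<^sub>C C l (A m (B n v))" for m n l
    by (simp add: bracket_def field_linC[OF lin(1)] linC_diff linC_scale superspace.scale_right_diff_distrib mult.commute)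
  ultimately show ?thesis by simp
qed

lemma annihilated_ope:
  assumes A: "\<And>v. (mul_diff ^^ r) (bracket s A C v) = (\<lambda>_ _. 0)"
    and B: "\<And>v. (mul_diff ^^ r) (bracket t B C v) = (\<lambda>_ _. 0)"
    and lin: "is_field A" "is_field B" "\<And>l. linC (C l)"
  shows "annihilated r (\<lambda>m n l. ope k \<epsilon> A B m n (C l v) - (s * t) *\<^sub>C C l (ope k \<epsilon> A B m n v))"
proof -
  define g1 where "g1 m n l = A m (B n (C l v)) - (s * t) *\<^sub>C C l (A m (B n v))" for m n l
  define g2 where "g2 n m l = B n (A m (C l v)) - (t * s) *\<^sub>C C l (B n (A m v))" for m n l
  have lb: "lower_bounded (\<lambda>m n. A m (B n v))" "lower_bounded (\<lambda>n m. B n (A m v))" for v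
    by (intro lower_bounded_field lin field_linC)+
  have lbC: "lower_bounded (\<lambda>m n. c *\<^sub>C C l (A m (B n v)))"
    "lower_bounded (\<lambda>n m. c *\<^sub>C C l (B n (A m v)))" for l v c
    using lb unfolding lower_bounded_def by (metis linC_zero[OF lin(3)] superspace.scale_zero_right)+
  have lbg: "lower_bounded (\<lambda>m n. g1 m n l)" "lower_bounded (\<lambda>n m. g2 n m l)" for l
    unfolding g1_def g2_def by (intro lower_bounded_minus lb lbC)+
  have "annihilated r (\<lambda>m n l. expansion k (\<lambda>m n. g1 m n l) m n)"
    using annihilated_triple[OF A B lin(1,2)] lbg(1) by (intro annihilated_expansion) (simp_all add: g1_def)
  moreover have "annihilated r (\<lambda>n m l. expansion k (\<lambda>n m. g2 n m l) n m)"
    using annihilated_triple[OF B A lin(2,1)] lbg(2) by (intro annihilated_expansion) (simp_all add: g2_def)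
  then have "annihilated r (\<lambda>m n l. expansion k (\<lambda>n m. g2 n m l) n m)"
    by (rule annihilated_swap)
  ultimately have "annihilated r (\<lambda>m n l. expansion k (\<lambda>m n. g1 m n l) m n
      - (\<epsilon> * (- 1) powi k) *\<^sub>C expansion k (\<lambda>n m. g2 n m l) n m)"
    by (rule annihilated_diff_linC)
  moreover have "expansion k (\<lambda>m n. g1 m n l) m n = expansion k (\<lambda>m n. A m (B n (C l v))) m n
    - (s * t) *\<^sub>C C l (expansion k (\<lambda>m n. A m (B n v)) m n)" for m n l
    unfolding g1_def using expansion_diff[OF lb(1) lbC(1)[of "s * t"]]
      expansion_linC[OF lb(1) linC_comp_scale[OF lin(3)]] by simp
  moreover have "expansion k (\<lambda>n m. g2 n m l) n m = expansion k (\<lambda>n m. B n (A m (C l v))) n m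
    - (s * t) *\<^sub>C C l (expansion k (\<lambda>n m. B n (A m v)) n m)" for m n l
    unfolding g2_def using expansion_diff[OF lb(2) lbC(2)[of "s * t"]]
      expansion_linC[OF lb(2) linC_comp_scale[OF lin(3)]] by (simp add: mult.commute)
  ultimately show ?thesis
    by (simp add: ope_def linC_diff[OF lin(3)] linC_scale[OF lin(3)] algebra_simps)
qed

lemma linC_ope:
  assumes "is_field A" "is_field B"
  shows "linC (ope k \<epsilon> A B m n)"
proof -
  have lb: "lower_bounded (\<lambda>m n. A m (B n v))" "lower_bounded (\<lambda>n m. B n (A m v))" for v
    by (intro lower_bounded_field assms field_linC)+
  note l = field_linC[OF assms(1)] field_linC[OF assms(2)]
  show ?thesis
    by (rule linCI)
      (simp_all add: ope_def linC_add[OF l(1)] linC_add[OF l(2)] linC_scale[OF l(1)] linC_scale[OF l(2)]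
        expansion_add expansion_scaleC lb superspace.scale_right_distrib superspace.scale_right_diff_distrib scaleC_scaleC mult_ac)
qed

lemma ope_Suc:
  assumes "is_field A" "is_field B"
  shows "ope (k + 1) \<epsilon> A B m n v = ope k \<epsilon> A B (m - 1) n v - ope k \<epsilon> A B m (n - 1) v"
proof -
  have lb: "lower_bounded (\<lambda>m n. A m (B n v))" "lower_bounded (\<lambda>n m. B n (A m v))"
    by (intro lower_bounded_field assms field_linC)+
  have "(- 1) powi (k + 1) = - ((- 1) powi k :: complex)"
    by (simp add: power_int_add)
  then show ?thesis
    unfolding ope_def expansion_Suc[OF disjI1[OF lb(1)]] expansion_Suc[OF disjI1[OF lb(2)]]
    by (simp add: mul_diff_def superspace.scale_right_diff_distrib)
qed

lemma ope_0: "ope 0 \<epsilon> A B m n v = bracket \<epsilon> A B v m n"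
  by (simp add: ope_def bracket_def expansion_0)

lemma funpow_mul_diff_ope:
  assumes "is_field A" "is_field B"
  shows "(mul_diff ^^ r) (bracket \<epsilon> A B v) = (\<lambda>m n. ope (int r) \<epsilon> A B m n v)"
proof (induction r)
  case 0
  then show ?case by (simp add: ope_0)
next
  case (Suc r)
  have "int (Suc r) = int r + 1" by simp
  then show ?case
    unfolding funpow.simps comp_apply Suc by (simp only: ope_Suc[OF assms]) (simp add: mul_diff_def fun_eq_iff)
qed

section \<open>Translation covariance of the left-hand side\<close>

definition covariant :: "('v \<Rightarrow> 'v) \<Rightarrow> (int \<Rightarrow> 'v \<Rightarrow> 'v::superspace) \<Rightarrow> bool" where
  "covariant D A \<longleftrightarrow> (\<forall>m v. D (A m v) - A m (D v) = of_int (m + 1) *\<^sub>C A (m + 1) v)"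

lemma covariant_minus:
  assumes "linC D" "covariant D A" "covariant D B"
  shows "covariant D (\<lambda>m v. A m v - B m v)"
  unfolding covariant_def
proof (intro allI)
  fix m v
  have "D (A m v - B m v) - (A m (D v) - B m (D v)) = (D (A m v) - A m (D v)) - (D (B m v) - B m (D v))"
    by (simp add: linC_diff[OF assms(1)])
  also have "\<dots> = of_int (m + 1) *\<^sub>C A (m + 1) v - of_int (m + 1) *\<^sub>C B (m + 1) v"
    using assms(2,3) by (simp only: covariant_def)
  finally show "D (A m v - B m v) - (A m (D v) - B m (D v)) = of_int (m + 1) *\<^sub>C (A (m + 1) v - B (m + 1) v)"
    by (simp only: superspace.scale_right_diff_distrib)
qed

lemma expansion_commutator:
  assumes D: "linC D" and AB: "is_field A" "is_field B" and rel: "covariant D A" "covariant D B"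
  shows "D (expansion k (\<lambda>m n. A m (B n v)) m n) - expansion k (\<lambda>m n. A m (B n (D v))) m n
    = of_int (m + 1) *\<^sub>C expansion k (\<lambda>m n. A m (B n v)) (m + 1) n
      + of_int (n + 1) *\<^sub>C expansion k (\<lambda>m n. A m (B n v)) m (n + 1)"
proof -
  have lb: "lower_bounded (\<lambda>m n. A m (B n v))" for v
    by (intro lower_bounded_field AB field_linC)
  have lbD: "lower_bounded (\<lambda>m n. D (A m (B n v)))"
    using lb[of v] linC_zero[OF D] unfolding lower_bounded_def by metis
  have "D (A m (B n v)) - A m (B n (D v)) = of_int (m + 1) *\<^sub>C A (m + 1) (B n v) + of_int (n + 1) *\<^sub>C A m (B (n + 1) v)" for m n
  proof -
    have "D (A m (B n v)) - A m (B n (D v)) = (D (A m (B n v)) - A m (D (B n v))) + A m (D (B n v) - B n (D v))"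
      by (simp add: linC_diff[OF field_linC[OF AB(1)]])
    also have "\<dots> = of_int (m + 1) *\<^sub>C A (m + 1) (B n v) + A m (of_int (n + 1) *\<^sub>C B (n + 1) v)"
      using rel unfolding covariant_def by metis
    finally show ?thesis by (simp only: linC_scale[OF field_linC[OF AB(1)]])
  qed
  then have "expansion k (\<lambda>m n. D (A m (B n v)) - A m (B n (D v))) m n
    = expansion k (\<lambda>m n. of_int (m + 1) *\<^sub>C A (m + 1) (B n v) + of_int (n + 1) *\<^sub>C A m (B (n + 1) v)) m n"
    by simp
  then show ?thesis
    using expansion_derivation[OF lb[of v]] expansion_diff[OF lbD lb[of "D v"]] expansion_linC[OF lb[of v] D]
    by simp
qed

lemma ope_commutator:
  assumes D: "linC D" and AB: "is_field A" "is_field B" and rel: "covariant D A" "covariant D B"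
  shows "D (ope k \<epsilon> A B m n v) - ope k \<epsilon> A B m n (D v)
    = of_int (m + 1) *\<^sub>C ope k \<epsilon> A B (m + 1) n v + of_int (n + 1) *\<^sub>C ope k \<epsilon> A B m (n + 1) v"
proof -
  let ?c = "\<epsilon> * (- 1) powi k"
  have "D (ope k \<epsilon> A B m n v) - ope k \<epsilon> A B m n (D v)
    = (D (expansion k (\<lambda>m n. A m (B n v)) m n) - expansion k (\<lambda>m n. A m (B n (D v))) m n)
     - ?c *\<^sub>C (D (expansion k (\<lambda>n m. B n (A m v)) n m) - expansion k (\<lambda>n m. B n (A m (D v))) n m)"
    by (simp add: ope_def linC_diff[OF D] linC_scale[OF D] superspace.scale_right_diff_distrib)
  also have "\<dots> = of_int (m + 1) *\<^sub>C ope k \<epsilon> A B (m + 1) n v + of_int (n + 1) *\<^sub>C ope k \<epsilon> A B m (n + 1) v"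
    unfolding expansion_commutator[OF assms] expansion_commutator[OF D AB(2,1) rel(2,1)] ope_def
    by (simp add: superspace.scale_right_diff_distrib superspace.scale_right_distrib scaleC_scaleC mult.commute)
  finally show ?thesis .
qed

text \<open>A distribution annihilated by \<open>z - w\<close> is \<open>\<delta>(z, w)\<close> times a distribution in \<open>w\<close>.\<close>

lemma antidiagonal_constant:
  fixes f :: "int \<Rightarrow> int \<Rightarrow> 'v"
  assumes "\<And>m n. f (m - 1) n = f m (n - 1)"
  shows "f m n = f (- 1) (m + n + 1)"
proof -
  have h: "f (m - 1) (n - (m - 1)) = f m (n - m)" for m n
    using assms[of m "n - (m - 1)"] by (simp add: algebra_simps)
  have "f m (n - m) = f (- 1) (n - (- 1))" for n
  proof (induction m rule: int_induct[where k = "- 1"])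
    case (step1 i)
    then show ?case using h[of "i + 1" n] by simp
  next
    case (step2 i)
    then show ?case using h[of i n] by simp
  qed simp
  from this[of "m + n"] show ?thesis by (simp add: algebra_simps)
qed


section \<open>Grassmann signs\<close>

lemma sig_Un_left:
  assumes "finite I" "finite J" "finite L" "I \<inter> J = {}"
  shows "sig (I \<union> J) L = sig I L * sig J L"
proof (cases "(I \<union> J) \<inter> L = {}")
  case True
  then have 0: "I \<inter> L = {}" "J \<inter> L = {}" by auto
  have "{(i, j) \<in> (I \<union> J) \<times> L. j < i} = {(i, j) \<in> I \<times> L. j < i} \<union> {(i, j) \<in> J \<times> L. j < i}"
    by auto
  moreover have "finite {(i, j) \<in> I \<times> L. j < i}" "finite {(i, j) \<in> J \<times> L. j < i}"
    by (rule finite_subset[of _ "I \<times> L"]; use assms in auto)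
      (rule finite_subset[of _ "J \<times> L"]; use assms in auto)
  moreover have "{(i, j) \<in> I \<times> L. j < i} \<inter> {(i, j) \<in> J \<times> L. j < i} = {}"
    using assms by auto
  ultimately show ?thesis
    using True 0 by (simp add: sig_def card_Un_disjoint power_add)
next
  case False
  then show ?thesis by (auto simp: sig_def)
qed

lemma sig_Un_right:
  assumes "finite I" "finite J" "finite L" "I \<inter> J = {}"
  shows "sig L (I \<union> J) = sig L I * sig L J"
proof (cases "L \<inter> (I \<union> J) = {}")
  case True
  then have 0: "L \<inter> I = {}" "L \<inter> J = {}" by auto
  have "{(i, j) \<in> L \<times> (I \<union> J). j < i} = {(i, j) \<in> L \<times> I. j < i} \<union> {(i, j) \<in> L \<times> J. j < i}"
    by auto
  moreover have "finite {(i, j) \<in> L \<times> I. j < i}" "finite {(i, j) \<in> L \<times> J. j < i}"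
    by (rule finite_subset[of _ "L \<times> I"]; use assms in auto)
      (rule finite_subset[of _ "L \<times> J"]; use assms in auto)
  moreover have "{(i, j) \<in> L \<times> I. j < i} \<inter> {(i, j) \<in> L \<times> J. j < i} = {}"
    using assms by auto
  ultimately show ?thesis
    using True 0 by (simp add: sig_def card_Un_disjoint power_add)
next
  case False
  then show ?thesis by (auto simp: sig_def)
qed

text \<open>Each pair in \<open>I \<times> J\<close> is an inversion in exactly one of the two
  orders.\<close>

lemma sig_swap:
  assumes "finite I" "finite J" "I \<inter> J = {}"
  shows "sig I J * sig J I = (- 1) ^ (card I * card J)"
proof -
  let ?A = "{(i, j) \<in> I \<times> J. j < i}" and ?B = "{(i, j) \<in> J \<times> I. j < i}"
  have eq: "I \<times> J = ?A \<union> prod.swap ` ?B"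
    using assms(3) by (auto simp: image_iff)
  have fin: "finite ?A" "finite ?B"
    using assms by (auto intro: finite_subset[of _ "I \<times> J"] finite_subset[of _ "J \<times> I"])
  have "card (I \<times> J) = card (?A \<union> prod.swap ` ?B)"
    by (rule arg_cong[OF eq])
  also have "\<dots> = card ?A + card (prod.swap ` ?B)"
    using fin by (intro card_Un_disjoint) auto
  also have "card (prod.swap ` ?B) = card ?B" by (simp add: card_image)
  finally have "card I * card J = card ?A + card ?B" by (simp add: card_cartesian_product)
  then show ?thesis using assms(3) by (auto simp: sig_def power_add Int_commute)
qed

lemma sig_square: "I \<inter> J = {} \<Longrightarrow> sig I J * sig I J = 1"
  by (simp add: sig_def flip: power_mult_distrib)

lemma sig_singleton_left:
  assumes "finite L" "x \<notin> L"
  shows "sig {x} L = (- 1) ^ card {l \<in> L. l < x}"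
proof -
  have "{(i, j) \<in> {x} \<times> L. j < i} = Pair x ` {l \<in> L. l < x}" by auto
  then show ?thesis using assms by (simp add: sig_def card_image inj_on_def)
qed

lemma sig_singleton_below:
  assumes "finite L" "\<And>l. l \<in> L \<Longrightarrow> x < l"
  shows "sig {x} L = 1" "sig L {x} = (- 1) ^ card L"
proof -
  have x: "x \<notin> L" "{x} \<inter> L = {}" using assms(2) by auto
  have e: "{l \<in> L. l < x} = {}" using assms(2) by (metis (no_types, lifting) Collect_empty_eq order.asym)
  show 1: "sig {x} L = 1"
    unfolding sig_singleton_left[OF assms(1) x(1)] e by simp
  show "sig L {x} = (- 1) ^ card L" using sig_swap[of "{x}" L] assms(1) x 1 by simp
qed

lemma gr_mult_linear_factor:
  assumes "finite I" "finite L"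
  shows "gr_mult (gr_monom {x} {} - gr_monom {} {x}) h I L
    = (if x \<in> I then koszul {x} {} (I - {x}) L * h (I - {x}) L else 0)
      - (if x \<in> L then koszul {} {x} I (L - {x}) * h I (L - {x}) else 0)"
proof -
  have "gr_mult (gr_monom {x} {} - gr_monom {} {x}) h I L
    = (\<Sum>I1\<in>Pow I. \<Sum>K1\<in>Pow L. (if I1 = {x} \<and> K1 = {} then koszul {x} {} (I - {x}) L * h (I - {x}) L else 0)
      - (if I1 = {} \<and> K1 = {x} then koszul {} {x} I (L - {x}) * h I (L - {x}) else 0))"
    unfolding gr_mult_def by (intro sum.cong refl) (auto simp: gr_monom_def)
  also have "\<dots> = (\<Sum>I1\<in>Pow I. \<Sum>K1\<in>Pow L. (if K1 = {} then if I1 = {x} then koszul {x} {} (I - {x}) L * h (I - {x}) L else 0 else 0))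
      - (\<Sum>I1\<in>Pow I. \<Sum>K1\<in>Pow L. if K1 = {x} then if I1 = {} then koszul {} {x} I (L - {x}) * h I (L - {x}) else 0 else 0)"
    unfolding sum_subtractf by (intro arg_cong2[of _ _ _ _ "(-)"] sum.cong refl) auto
  also have "\<dots> = (if x \<in> I then koszul {x} {} (I - {x}) L * h (I - {x}) L else 0)
      - (if x \<in> L then koszul {} {x} I (L - {x}) * h I (L - {x}) else 0)"
    using assms by (simp add: sum.delta)
  finally show ?thesis .
qed

lemma gr_mult_infinite: "infinite I \<or> infinite L \<Longrightarrow> gr_mult g h I L = 0"
  by (auto simp: gr_mult_def)

text \<open>Expanding the product chooses \<open>\<theta>^i\<close> or \<open>- \<zeta>^i\<close>
  for each \<open>i \<in> K\<close>. Moving the chosen \<open>\<zeta>\<close>'s to the right costs a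
  sign for each \<open>l \<in> L\<close> and \<open>i \<in> I\<close> with \<open>l < i\<close>, and
  \<open>sig I L\<close> counts these pairs.\<close>

lemma theta_minus_zeta_eq:
  assumes "finite K"
  shows "theta_minus_zeta K I L = (if I \<union> L = K then (- 1) ^ card L * sig I L else 0)"
proof -
  have "gr_prod_list (map (\<lambda>i. gr_monom {i} {} - gr_monom {} {i}) xs) I L
    = (if I \<union> L = set xs then (- 1) ^ card L * sig I L else 0)" if "sorted_wrt (<) xs" for xs
    using that
  proof (induction xs arbitrary: I L)
    case Nil
    then show ?case by (auto simp: gr_prod_list_def gr_monom_def)
  next
    case (Cons x xs)
    define G where "G = gr_prod_list (map (\<lambda>i. gr_monom {i} {} - gr_monom {} {i}) xs)"
    have G: "G I L = (if I \<union> L = set xs then (- 1) ^ card L * sig I L else 0)" for I L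
      unfolding G_def by (rule Cons.IH) (use Cons.prems in simp)
    have x: "x \<notin> set xs" "\<And>l. l \<in> set xs \<Longrightarrow> x < l" using Cons.prems by auto
    have eq: "gr_prod_list (map (\<lambda>i. gr_monom {i} {} - gr_monom {} {i}) (x # xs)) I L
      = gr_mult (gr_monom {x} {} - gr_monom {} {x}) G I L"
      by (simp add: gr_prod_list_def G_def)
    show ?case
    proof (cases "I \<union> L = set (x # xs)")
      case False
      have "gr_mult (gr_monom {x} {} - gr_monom {} {x}) G I L = 0"
      proof (cases "finite I \<and> finite L")
        case True
        have "G (I - {x}) L = 0" if "x \<in> I" using that False x by (auto simp: G)
        moreover have "G I (L - {x}) = 0" if "x \<in> L" using that False x by (auto simp: G)
        ultimately show ?thesis using True by (simp add: gr_mult_linear_factor)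
      qed (use gr_mult_infinite in blast)
      then show ?thesis unfolding eq using False by simp
    next
      case True
      have "finite (I \<union> L)" unfolding True by simp
      then have fin: "finite I" "finite L" by auto
      have lt: "x < l" if "l \<in> I \<union> L" "l \<noteq> x" for l using that True x by auto
      consider "x \<in> I" "x \<in> L" | "x \<in> I" "x \<notin> L" | "x \<notin> I" "x \<in> L" using True by auto
      then show ?thesis
      proof cases
        case 1
        have "G (I - {x}) L = 0" "G I (L - {x}) = 0" using 1 x by (auto simp: G)
        moreover have "sig I L = 0" using 1 by (auto simp: sig_def)
        ultimately show ?thesis unfolding eq using fin by (simp add: gr_mult_linear_factor)
      next
        case 2
        have "(I - {x}) \<union> L = (I \<union> L) - {x}" using 2 by blast
        then have "(I - {x}) \<union> L = set xs" unfolding True using x(1) by simp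
        then have "G (I - {x}) L = (- 1) ^ card L * sig (I - {x}) L" by (simp add: G)
        moreover have "sig ({x} \<union> (I - {x})) L = sig {x} L * sig (I - {x}) L"
          using fin by (intro sig_Un_left) auto
        moreover have "sig {x} L = 1" using fin 2 lt by (intro sig_singleton_below) auto
        moreover have "sig {x} (I - {x}) = 1" using fin lt by (intro sig_singleton_below) auto
        moreover have "{x} \<union> (I - {x}) = I" using 2 by auto
        ultimately show ?thesis unfolding eq using fin 2 True by (simp add: gr_mult_linear_factor koszul_def)
      next
        case 3
        have "I \<union> (L - {x}) = (I \<union> L) - {x}" using 3 by blast
        then have "I \<union> (L - {x}) = set xs" unfolding True using x(1) by simp
        then have g: "G I (L - {x}) = (- 1) ^ card (L - {x}) * sig I (L - {x})" by (simp add: G)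
        have xL: "{x} \<union> (L - {x}) = L" using 3 by auto
        have "sig I ({x} \<union> (L - {x})) = sig I {x} * sig I (L - {x})"
          using fin by (intro sig_Un_right) auto
        moreover have "sig I {x} = (- 1) ^ card I" using fin 3 lt by (intro sig_singleton_below) auto
        ultimately have s: "sig I L = (- 1) ^ card I * sig I (L - {x})" unfolding xL by simp
        have k: "koszul {} {x} I (L - {x}) = (- 1) ^ card I"
          using sig_singleton_below(1)[of "L - {x}" x] fin lt by (simp add: koszul_def)
        have c: "(- 1) ^ card L = - ((- 1) ^ card (L - {x}) :: complex)"
          unfolding card.remove[OF fin(2) 3(2)] by simp
        have "gr_mult (gr_monom {x} {} - gr_monom {} {x}) G I L = - (koszul {} {x} I (L - {x}) * G I (L - {x}))"
          using fin 3 by (simp add: gr_mult_linear_factor)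
        then show ?thesis unfolding eq k g s c if_P[OF True] by simp
      qed
    qed
  qed
  from this[of "sorted_list_of_set K"] show ?thesis
    using assms by (simp add: theta_minus_zeta_def)
qed

lemma sum_Pow_insert:
  assumes "finite A" "x \<notin> A"
  shows "(\<Sum>B\<in>Pow (insert x A). f B) = (\<Sum>B\<in>Pow A. f B + f (insert x B))"
proof -
  have "Pow A \<inter> insert x ` Pow A = {}" using assms(2) by auto
  then have "(\<Sum>B\<in>Pow (insert x A). f B) = (\<Sum>B\<in>Pow A. f B) + (\<Sum>B\<in>insert x ` Pow A. f B)"
    unfolding Pow_insert using assms(1) by (intro sum.union_disjoint) auto
  also have "(\<Sum>B\<in>insert x ` Pow A. f B) = (\<Sum>B\<in>Pow A. f (insert x B))"
    using assms(2) by (subst sum.reindex) (auto simp: inj_on_def)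
  finally show ?thesis by (simp add: sum.distrib)
qed

text \<open>The elements \<open>\<theta>^i - \<zeta>^i\<close> anticommute, so they multiply like
  the \<open>\<theta>^i\<close>. In coefficients a single term of the double sum survives, the one
  with \<open>I1 = I \<inter> K\<close> and \<open>K1 = L \<inter> K\<close>, and signs remain to be
  compared.\<close>

lemma gr_mult_theta_minus_zeta_disjoint:
  assumes fin: "finite K" "finite M" "finite I" "finite L" and dis: "K \<inter> M = {}"
  shows "gr_mult (theta_minus_zeta K) (theta_minus_zeta M) I L = sig K M * theta_minus_zeta (K \<union> M) I L"
proof (cases "I \<union> L = K \<union> M")
  case False
  have "koszul I1 K1 (I - I1) (L - K1) * theta_minus_zeta K I1 K1 * theta_minus_zeta M (I - I1) (L - K1) = 0"
    if "I1 \<in> Pow I" "K1 \<in> Pow L" for I1 K1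
    using that False fin by (auto simp: theta_minus_zeta_eq)
  then show ?thesis
    using False fin unfolding gr_mult_def by (simp add: theta_minus_zeta_eq sum.neutral)
next
  case True
  define A B C D where "A = I \<inter> K" and "B = L \<inter> K" and "C = I \<inter> M" and "D = L \<inter> M"
  note defs = A_def B_def C_def D_def
  have f: "finite A" "finite B" "finite C" "finite D" using fin by (auto simp: defs)
  have U: "K = A \<union> B" "M = C \<union> D" "I = A \<union> C" "L = B \<union> D" "I - A = C" "L - B = D"
    using True dis by (auto simp: defs)
  have d: "A \<inter> C = {}" "A \<inter> D = {}" "B \<inter> C = {}" "B \<inter> D = {}" using dis by (auto simp: defs)
  have "gr_mult (theta_minus_zeta K) (theta_minus_zeta M) I L
    = (\<Sum>I1\<in>Pow I. if I1 = A then (\<Sum>K1\<in>Pow L. if K1 = B then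
        koszul A B C D * theta_minus_zeta K A B * theta_minus_zeta M C D else 0) else 0)"
  proof -
    have "koszul I1 K1 (I - I1) (L - K1) * theta_minus_zeta K I1 K1 * theta_minus_zeta M (I - I1) (L - K1) =
      (if I1 = A then if K1 = B then koszul A B C D * theta_minus_zeta K A B * theta_minus_zeta M C D else 0 else 0)"
      if "I1 \<subseteq> I" "K1 \<subseteq> L" for I1 K1
    proof (cases "I1 \<union> K1 = K \<and> (I - I1) \<union> (L - K1) = M")
      case True
      then have "I1 = A" "K1 = B" using that dis by (auto simp: defs)
      then show ?thesis using U by simp
    next
      case False
      then have "\<not> (I1 = A \<and> K1 = B)" using U by auto
      then show ?thesis using False fin by (auto simp: theta_minus_zeta_eq)
    qed
    then show ?thesis
      unfolding gr_mult_def by (intro sum.cong refl) (auto intro!: sum.cong sum.neutral)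
  qed
  also have "\<dots> = koszul A B C D * theta_minus_zeta K A B * theta_minus_zeta M C D"
    using fin U by (simp add: sum.delta)
  also have "\<dots> = sig K M * theta_minus_zeta (K \<union> M) I L"
  proof (cases "A \<inter> B = {} \<and> C \<inter> D = {}")
    case False
    then have "sig A B * sig C D = 0" "sig I L = 0" unfolding U by (auto simp: sig_def)
    then show ?thesis using fin by (auto simp: theta_minus_zeta_eq)
  next
    case True': True
    \<comment> \<open>\<open>A\<close> and \<open>D\<close> are compared in the same order in
      \<open>sig K M\<close> and in \<open>sig I L\<close> and cancel; \<open>B\<close> and
      \<open>C\<close> are compared in opposite orders, which leaves the Koszul sign.\<close>
    have 1: "sig A D * sig A D = 1" by (rule sig_square[OF d(2)])
    have 2: "sig B C * sig C B = (- 1) ^ (card B * card C)" by (rule sig_swap[OF f(2,3) d(3)])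
    have "sig K M * theta_minus_zeta (K \<union> M) I L = sig K M * ((- 1) ^ card L * sig I L)"
      using fin True by (simp add: theta_minus_zeta_eq)
    also have "\<dots> = (sig A C * sig A D * (sig B C * sig B D)) * ((- 1) ^ (card B + card D) * (sig A B * sig A D * (sig C B * sig C D)))"
      unfolding U(1-4) using f d True' by (simp add: sig_Un_left sig_Un_right card_Un_disjoint Int_Un_distrib)
    also have "\<dots> = (sig A D * sig A D) * (sig B C * sig C B) * (- 1) ^ (card B + card D) * sig A C * sig B D * sig A B * sig C D"
      by (simp only: mult_ac)
    also have "\<dots> = koszul A B C D * theta_minus_zeta K A B * theta_minus_zeta M C D"
      unfolding 1 2 using fin U by (simp add: koszul_def theta_minus_zeta_eq power_add mult_ac)
    finally show ?thesis ..
  qed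
  finally show ?thesis .
qed

text \<open>The terms cancel in pairs: a common index \<open>i\<close> contributes \<open>\<theta>\<^sup>i\<close> from one factor and \<open>\<zeta>\<^sup>i\<close> from the other,
  and exchanging the two changes the sign.\<close>

lemma gr_mult_theta_minus_zeta_overlap:
  assumes fin: "finite K" "finite M" "finite I" "finite L" and i: "i \<in> K" "i \<in> M"
  shows "gr_mult (theta_minus_zeta K) (theta_minus_zeta M) I L = 0"
proof -
  define h where "h I1 K1 = koszul I1 K1 (I - I1) (L - K1) * theta_minus_zeta K I1 K1 * theta_minus_zeta M (I - I1) (L - K1)" for I1 K1
  have eq: "gr_mult (theta_minus_zeta K) (theta_minus_zeta M) I L = (\<Sum>I1\<in>Pow I. \<Sum>K1\<in>Pow L. h I1 K1)"
    by (simp add: gr_mult_def h_def)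
  show ?thesis
  proof (cases "i \<in> I \<and> i \<in> L")
    case False
    have "h I1 K1 = 0" if "I1 \<subseteq> I" "K1 \<subseteq> L" for I1 K1
    proof -
      have "\<not> (I1 \<union> K1 = K \<and> (I - I1) \<union> (L - K1) = M)" using that False i by blast
      then show ?thesis using fin by (auto simp: h_def theta_minus_zeta_eq)
    qed
    then show ?thesis unfolding eq by (simp add: sum.neutral)
  next
    case True
    define I' L' where "I' = I - {i}" and "L' = L - {i}"
    have IL: "I = insert i I'" "L = insert i L'" "i \<notin> I'" "i \<notin> L'" "finite I'" "finite L'"
      using True fin by (auto simp: I'_def L'_def)
    have "h A B + h A (insert i B) + (h (insert i A) B + h (insert i A) (insert i B)) = 0"
      if "A \<subseteq> I'" "B \<subseteq> L'" for A B
    proof -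
      have n: "i \<notin> A" "i \<notin> B" using that IL by auto
      define C D where "C = I' - A" and "D = L' - B"
      have f: "finite A" "finite B" "finite C" "finite D" "i \<notin> C" "i \<notin> D"
        using that IL fin by (auto simp: C_def D_def intro: finite_subset)
      have dd: "I - insert i A = C" "L - B = insert i D" "I - A = insert i C" "L - insert i B = D"
        using that IL n by (auto simp: C_def D_def)
      have 0: "h A B = 0" using n i fin by (auto simp: h_def theta_minus_zeta_eq)
      have 1: "h (insert i A) (insert i B) = 0" using n i fin by (auto simp: h_def theta_minus_zeta_eq sig_def)
      have "h (insert i A) B + h A (insert i B) = 0"
      proof (cases "insert i (A \<union> B) = K \<and> insert i (C \<union> D) = M")
        case False
        then show ?thesis using fin by (auto simp: h_def dd theta_minus_zeta_eq)
      next
        case True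
        have l: "sig (insert i E) F = sig {i} F * sig E F" if "finite E" "finite F" "i \<notin> E" for E F
          using sig_Un_left[of "{i}" E F] that by simp
        have r: "sig F (insert i E) = sig F {i} * sig F E" if "finite E" "finite F" "i \<notin> E" for E F
          using sig_Un_right[of "{i}" E F] that by simp
        have sw: "sig {i} E * sig E {i} = (- 1) ^ card E" if "finite E" "i \<notin> E" for E
          using sig_swap[of "{i}" E] that by simp
        have sq: "sig {i} E * sig {i} E = 1" "sig E {i} * sig E {i} = 1" if "i \<notin> E" for E
          by (rule sig_square, use that in simp)+
        \<comment> \<open>The sign shared by the two configurations, with all contributions of
          \<open>i\<close> removed. The latter pair up to \<open>(-1)^(card B + card C)\<close> in
          both cases, with opposite overall signs.\<close>
        define z where "z = sig A C * sig B D * sig A B * sig C D * (- 1) ^ (card B * card C) * (- 1) ^ (card B + card D)"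
        have "h (insert i A) B = - z * (sig {i} C * sig C {i}) * (sig {i} B * sig B {i})"
        proof -
          have "theta_minus_zeta K (insert i A) B = (- 1) ^ card B * (sig {i} B * sig A B)"
            "theta_minus_zeta M C (insert i D) = - ((- 1) ^ card D * (sig C {i} * sig C D))"
            "koszul (insert i A) B C (insert i D) = (- 1) ^ (card B * card C) * (sig {i} C * sig A C) * (sig B {i} * sig B D)"
            using True f n fin by (simp_all add: theta_minus_zeta_eq koszul_def l[of A B] l[of A C] r[of D C] r[of D B])
          then show ?thesis
            unfolding h_def dd z_def by (simp add: power_add mult_ac)
        qed
        moreover have "h A (insert i B) = z * (- 1) ^ (card B + card C) * (sig A {i} * sig A {i}) * (sig {i} D * sig {i} D)"
        proof -
          have "theta_minus_zeta K A (insert i B) = - ((- 1) ^ card B * (sig A {i} * sig A B))"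
            "theta_minus_zeta M (insert i C) D = (- 1) ^ card D * (sig {i} D * sig C D)"
            "koszul A (insert i B) (insert i C) D
              = - ((- 1) ^ (card B * card C) * (- 1) ^ card B * (- 1) ^ card C * (sig A {i} * sig A C) * (sig {i} D * sig B D))"
            using True f n fin by (simp_all add: theta_minus_zeta_eq koszul_def l[of B D] l[of C D] r[of B A] r[of C A] power_add)
          then show ?thesis
            unfolding h_def dd z_def by (simp add: power_add mult_ac)
        qed
        ultimately show ?thesis using sw[of C] sw[of B] sq[of A] sq[of D] f n by (simp add: power_add)
      qed
      then show ?thesis using 0 1 by (simp add: add.commute)
    qed
    then have "(\<Sum>A\<in>Pow I'. \<Sum>B\<in>Pow L'. h A B + h A (insert i B) + (h (insert i A) B + h (insert i A) (insert i B))) = 0"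
      by (intro sum.neutral ballI) simp
    then show ?thesis
      unfolding eq unfolding IL(1,2) sum_Pow_insert[OF IL(5,3)] sum_Pow_insert[OF IL(6,4)]
      by (simp add: sum.distrib)
  qed
qed

lemma gr_mult_theta_minus_zeta:
  assumes fin: "finite K" "finite M" "finite I" "finite L"
  shows "gr_mult (theta_minus_zeta K) (theta_minus_zeta M) I L = sig K M * theta_minus_zeta (K \<union> M) I L"
proof (cases "K \<inter> M = {}")
  case False
  then have "sig K M = 0" by (simp add: sig_def)
  then show ?thesis using False gr_mult_theta_minus_zeta_overlap[OF fin] by auto
qed (rule gr_mult_theta_minus_zeta_disjoint[OF fin])

text \<open>The sign with which \<open>\<theta>^I \<zeta>^L\<close> arises from
  \<open>(\<theta> - \<zeta>)^(I \<union> L1)\<close> and a factor \<open>\<zeta>^(L - L1)\<close>: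
  the coefficient of \<open>\<theta>^I \<zeta>^L1\<close> in the power, times the sign that sorts
  the \<open>\<zeta>\<close>'s.\<close>

definition shuffle_sign :: "nat set \<Rightarrow> nat set \<Rightarrow> nat set \<Rightarrow> complex" where
  "shuffle_sign I L1 L = (- 1) ^ card L1 * sig I L1 * sig L1 (L - L1)"

text \<open>For a new least index, \<open>\<zeta>^i\<close> belongs either to the separate factor or
  to the power of \<open>\<theta> - \<zeta>\<close>. The latter is impossible if that power already
  contributes \<open>\<theta>^i\<close>.\<close>

lemma shuffle_sign_insert:
  assumes fin: "finite I" "finite L" and i: "\<And>l. l \<in> L \<Longrightarrow> i < l" and L1: "L1 \<subseteq> L"
  shows "shuffle_sign I L1 (insert i L) = (- 1) ^ card L1 * shuffle_sign I L1 L"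
    and "i \<notin> I \<Longrightarrow> shuffle_sign I (insert i L1) (insert i L) = - ((- 1) ^ (card I + card {l \<in> I. l < i}) * shuffle_sign (insert i I) L1 L)"
    and "i \<in> I \<Longrightarrow> shuffle_sign I (insert i L1) (insert i L) = 0"
proof -
  have iL: "i \<notin> L" "i \<notin> L1" using i L1 by auto
  have f: "finite L1" "finite (L - L1)" using fin L1 finite_subset by auto
  have d: "insert i L - L1 = insert i (L - L1)" "insert i L - insert i L1 = L - L1" using iL by auto
  have 1: "sig L1 (insert i (L - L1)) = (- 1) ^ card L1 * sig L1 (L - L1)"
    using sig_Un_right[of "{i}" "L - L1" L1] sig_singleton_below(2)[of L1 i] f iL i L1 by auto
  show "shuffle_sign I L1 (insert i L) = (- 1) ^ card L1 * shuffle_sign I L1 L"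
    by (simp add: shuffle_sign_def d 1 mult_ac)
  have 2: "sig (insert i L1) (L - L1) = sig L1 (L - L1)"
    using sig_Un_left[of "{i}" L1 "L - L1"] sig_singleton_below(1)[of "L - L1" i] f iL i L1 by auto
  have 3: "sig I (insert i L1) = sig I {i} * sig I L1"
    using sig_Un_right[of "{i}" L1 I] f iL fin by auto
  {
    assume iI: "i \<notin> I"
    have 4: "sig (insert i I) L1 = sig I L1"
      using sig_Un_left[of "{i}" I L1] sig_singleton_below(1)[of L1 i] f iL iI fin i L1 by auto
    have "sig I {i} * sig {i} I = (- 1) ^ card I"
      using sig_swap[of I "{i}"] fin iI by simp
    then have "sig I {i} * sig {i} I * sig {i} I = (- 1) ^ card I * sig {i} I"
      by simp
    moreover have "sig {i} I * sig {i} I = 1" by (rule sig_square) (use iI in simp)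
    ultimately have 5: "sig I {i} = (- 1) ^ (card I + card {l \<in> I. l < i})"
      using sig_singleton_left[OF fin(1) iI] by (simp add: mult.assoc power_add)
    show "shuffle_sign I (insert i L1) (insert i L) = - ((- 1) ^ (card I + card {l \<in> I. l < i}) * shuffle_sign (insert i I) L1 L)"
      using f iL by (simp add: shuffle_sign_def d 2 3 4 5 mult_ac)
  }
  show "shuffle_sign I (insert i L1) (insert i L) = 0" if "i \<in> I"
    using that by (simp add: shuffle_sign_def sig_def)
qed

lemma sum_Pow_shuffle:
  assumes "finite L"
  shows "(\<Sum>K1\<in>Pow L. \<Sum>L1\<in>Pow (L - K1). f K1 L1) = (\<Sum>L2\<in>Pow L. \<Sum>K1\<in>Pow L2. f K1 (L2 - K1))"
proof -
  have fin: "\<forall>A\<in>Pow L. finite (Pow (L - A))" "\<forall>A\<in>Pow L. finite (Pow A)" "finite (Pow L)"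
    using assms by (auto intro: finite_subset)
  show ?thesis
    unfolding sum.Sigma[OF fin(3,1)] sum.Sigma[OF fin(3,2)]
    by (rule sum.reindex_bij_witness[of _ "\<lambda>(L2, K1). (K1, L2 - K1)" "\<lambda>(K1, L1). (K1 \<union> L1, K1)"])
      (auto simp: Un_Diff intro!: arg_cong[of _ _ "f _"])
qed

text \<open>Associativity of the product of \<open>\<zeta>^K1\<close>,
  \<open>\<zeta>^(L2 - K1)\<close> and \<open>\<zeta>^(L - L2)\<close>.\<close>

lemma koszul_shuffle:
  assumes "finite I" "finite L" "I1 \<subseteq> I" "K1 \<subseteq> L2" "L2 \<subseteq> L"
  shows "koszul I1 K1 (I - I1) (L - K1) * sig (L2 - K1) (L - L2)
    = koszul I1 K1 (I - I1) (L2 - K1) * sig L2 (L - L2)"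
proof -
  have fin: "finite K1" "finite L2" "finite (L2 - K1)" "finite (L - L2)"
    using assms by (auto intro: finite_subset)
  have "sig K1 (L - K1) = sig K1 (L2 - K1) * sig K1 (L - L2)"
  proof -
    have "L - K1 = (L2 - K1) \<union> (L - L2)" using assms by auto
    then show ?thesis using sig_Un_right[of "L2 - K1" "L - L2" K1] fin by auto
  qed
  moreover have "sig L2 (L - L2) = sig K1 (L - L2) * sig (L2 - K1) (L - L2)"
  proof -
    have "K1 \<union> (L2 - K1) = L2" using assms by auto
    then show ?thesis using sig_Un_left[of K1 "L2 - K1" "L - L2"] fin by auto
  qed
  ultimately show ?thesis by (simp add: koszul_def mult_ac)
qed

text \<open>Only \<open>U = A \<union> B\<close> contributes. The effect wanted later is the
  reverse: one coefficient is spread over all \<open>U\<close>, so that products with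
  \<open>(\<theta> - \<zeta>)^U\<close> can be formed.\<close>

lemma sum_theta_minus_zeta_delta:
  fixes y :: "nat set \<Rightarrow> 'v::superspace"
  assumes "\<And>U. \<not> U \<subseteq> {1..N} \<Longrightarrow> y U = 0"
  shows "(\<Sum>U\<in>Pow {1..N}. (c * theta_minus_zeta U A B) *\<^sub>C y U) = (c * ((- 1) ^ card B * sig A B)) *\<^sub>C y (A \<union> B)"
proof -
  have "(\<Sum>U\<in>Pow {1..N}. (c * theta_minus_zeta U A B) *\<^sub>C y U)
    = (\<Sum>U\<in>Pow {1..N}. if U = A \<union> B then (c * ((- 1) ^ card B * sig A B)) *\<^sub>C y (A \<union> B) else 0)"
    by (intro sum.cong refl) (auto simp: theta_minus_zeta_eq finite_subset)
  then show ?thesis using assms[of "A \<union> B"] by (auto simp: sum.delta)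
qed

text \<open>This multiplies a sum of terms \<open>(\<theta> - \<zeta>)^U y_U\<close> by
  \<open>(\<theta> - \<zeta>)^K\<close>. Collecting in \<open>L2\<close> the
  \<open>\<zeta>\<close>'s of both powers separates them from those of the field, and the inner sums
  become a Grassmann product.\<close>

lemma borcherds_signs_left:
  fixes y :: "nat set \<Rightarrow> nat set \<Rightarrow> 'v::superspace"
  assumes fin: "finite I" "finite L" and K: "K \<subseteq> {1..N}"
    and y: "\<And>U P. \<not> U \<subseteq> {1..N} \<Longrightarrow> y U P = 0"
  shows "(\<Sum>I1\<in>Pow I. \<Sum>K1\<in>Pow L. \<Sum>L1\<in>Pow (L - K1).
      (koszul I1 K1 (I - I1) (L - K1) * theta_minus_zeta K I1 K1 * shuffle_sign (I - I1) L1 (L - K1))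
        *\<^sub>C y ((I - I1) \<union> L1) (L - K1 - L1))
    = (\<Sum>L2\<in>Pow L. \<Sum>U\<in>Pow {1..N}. (sig L2 (L - L2) * (sig K U * theta_minus_zeta (K \<union> U) I L2)) *\<^sub>C y U (L - L2))"
proof -
  have fK: "finite K" using K finite_subset by blast
  have "(\<Sum>I1\<in>Pow I. \<Sum>K1\<in>Pow L. \<Sum>L1\<in>Pow (L - K1).
      (koszul I1 K1 (I - I1) (L - K1) * theta_minus_zeta K I1 K1 * shuffle_sign (I - I1) L1 (L - K1))
        *\<^sub>C y ((I - I1) \<union> L1) (L - K1 - L1))
    = (\<Sum>I1\<in>Pow I. \<Sum>L2\<in>Pow L. \<Sum>K1\<in>Pow L2.
      (koszul I1 K1 (I - I1) (L - K1) * theta_minus_zeta K I1 K1 * shuffle_sign (I - I1) (L2 - K1) (L - K1))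
        *\<^sub>C y ((I - I1) \<union> (L2 - K1)) (L - K1 - (L2 - K1)))"
    by (simp only: sum_Pow_shuffle[OF fin(2)])
  also have "\<dots> = (\<Sum>I1\<in>Pow I. \<Sum>L2\<in>Pow L. \<Sum>K1\<in>Pow L2. \<Sum>U\<in>Pow {1..N}.
     (sig L2 (L - L2) * (koszul I1 K1 (I - I1) (L2 - K1) * theta_minus_zeta K I1 K1) * theta_minus_zeta U (I - I1) (L2 - K1))
        *\<^sub>C y U (L - L2))"
  proof (intro sum.cong refl)
    fix I1 L2 K1 assume "I1 \<in> Pow I" "L2 \<in> Pow L" "K1 \<in> Pow L2"
    then have s: "I1 \<subseteq> I" "K1 \<subseteq> L2" "L2 \<subseteq> L" by auto
    have d: "L - K1 - (L2 - K1) = L - L2" using s by auto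
    have "koszul I1 K1 (I - I1) (L - K1) * theta_minus_zeta K I1 K1 * shuffle_sign (I - I1) (L2 - K1) (L - K1)
      = (koszul I1 K1 (I - I1) (L - K1) * sig (L2 - K1) (L - L2)) * theta_minus_zeta K I1 K1 * ((- 1) ^ card (L2 - K1) * sig (I - I1) (L2 - K1))"
      by (simp add: shuffle_sign_def d mult_ac)
    also have "\<dots> = sig L2 (L - L2) * (koszul I1 K1 (I - I1) (L2 - K1) * theta_minus_zeta K I1 K1) * ((- 1) ^ card (L2 - K1) * sig (I - I1) (L2 - K1))"
      unfolding koszul_shuffle[OF fin s] by (simp add: mult_ac)
    finally show "(koszul I1 K1 (I - I1) (L - K1) * theta_minus_zeta K I1 K1 * shuffle_sign (I - I1) (L2 - K1) (L - K1))
        *\<^sub>C y ((I - I1) \<union> (L2 - K1)) (L - K1 - (L2 - K1))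
      = (\<Sum>U\<in>Pow {1..N}. (sig L2 (L - L2) * (koszul I1 K1 (I - I1) (L2 - K1) * theta_minus_zeta K I1 K1) * theta_minus_zeta U (I - I1) (L2 - K1))
        *\<^sub>C y U (L - L2))"
      unfolding d by (subst sum_theta_minus_zeta_delta) (use y in auto)
  qed
  also have "\<dots> = (\<Sum>L2\<in>Pow L. \<Sum>U\<in>Pow {1..N}. \<Sum>I1\<in>Pow I. \<Sum>K1\<in>Pow L2.
     (sig L2 (L - L2) * (koszul I1 K1 (I - I1) (L2 - K1) * theta_minus_zeta K I1 K1) * theta_minus_zeta U (I - I1) (L2 - K1))
        *\<^sub>C y U (L - L2))"
    by (subst sum.swap, rule sum.cong[OF refl], subst (2) sum.swap, subst sum.swap, rule refl)
  also have "\<dots> = (\<Sum>L2\<in>Pow L. \<Sum>U\<in>Pow {1..N}. (sig L2 (L - L2) * gr_mult (theta_minus_zeta K) (theta_minus_zeta U) I L2) *\<^sub>C y U (L - L2))"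
    unfolding gr_mult_def
    by (intro sum.cong refl) (simp add: sum_distrib_left superspace.scale_sum_left mult_ac)
  also have "\<dots> = (\<Sum>L2\<in>Pow L. \<Sum>U\<in>Pow {1..N}. (sig L2 (L - L2) * (sig K U * theta_minus_zeta (K \<union> U) I L2)) *\<^sub>C y U (L - L2))"
    using fin fK by (intro sum.cong refl) (auto simp: gr_mult_theta_minus_zeta finite_subset)
  finally show ?thesis .
qed

text \<open>Splitting \<open>\<sigma>(J \<union> K)\<close> and \<open>\<sigma>(J)\<close> along
  \<open>J\<close>, \<open>K\<close> and the rest, every factor except
  \<open>\<sigma>(K, rest)\<close> occurs twice. This accounts for the coefficient
  \<open>\<sigma>(J, K) \<sigma>(J \<union> K)\<close> in the identity.\<close>

lemma sig_complement:
  assumes "J \<subseteq> {1..N}" "K \<subseteq> {1..N}" "J \<inter> K = {}"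
  shows "sig J K * sig1 N (J \<union> K) * sig1 N J = sig K ({1..N} - (K \<union> J))"
proof -
  let ?U = "{1..N} - (K \<union> J)"
  have fin: "finite J" "finite K" "finite ?U"
    using finite_subset[OF assms(1)] finite_subset[OF assms(2)] by auto
  have 1: "sig1 N (J \<union> K) = sig J ?U * sig K ?U"
    using sig_Un_left[of J K ?U] fin assms by (simp add: sig1_def Un_commute)
  have "{1..N} - J = K \<union> ?U" using assms by auto
  then have 2: "sig1 N J = sig J K * sig J ?U"
    using sig_Un_right[of K ?U J] fin by (auto simp: sig1_def)
  have "sig J K * sig1 N (J \<union> K) * sig1 N J = (sig J K * sig J K) * (sig J ?U * sig J ?U) * sig K ?U"
    unfolding 1 2 by (simp add: mult_ac)
  moreover have "sig J K * sig J K = 1" by (rule sig_square[OF assms(3)])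
  moreover have "sig J ?U * sig J ?U = 1" by (rule sig_square) auto
  ultimately show ?thesis by simp
qed

text \<open>The substitution \<open>U = N - (J \<union> K)\<close> permutes the subsets disjoint
  from \<open>K\<close>; all other \<open>J\<close> and \<open>U\<close> drop out because
  \<open>sig\<close> vanishes on overlapping sets.\<close>

lemma borcherds_signs_right:
  fixes y :: "nat set \<Rightarrow> nat set \<Rightarrow> 'v::superspace"
  assumes K: "K \<subseteq> {1..N}"
  shows "(\<Sum>J\<in>Pow {1..N}. (sig J K * sig1 N (J \<union> K)) *\<^sub>C (\<Sum>L2\<in>Pow L.
      (sig L2 (L - L2) * (sig1 N J * theta_minus_zeta ({1..N} - J) I L2)) *\<^sub>C y ({1..N} - (K \<union> J)) (L - L2)))
    = (\<Sum>L2\<in>Pow L. \<Sum>U\<in>Pow {1..N}. (sig L2 (L - L2) * (sig K U * theta_minus_zeta (K \<union> U) I L2)) *\<^sub>C y U (L - L2))"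
proof -
  let ?f = "\<lambda>L2 U. (sig L2 (L - L2) * (sig K U * theta_minus_zeta (K \<union> U) I L2)) *\<^sub>C y U (L - L2)"
  have "(\<Sum>J\<in>Pow {1..N}. (sig J K * sig1 N (J \<union> K)) *\<^sub>C (\<Sum>L2\<in>Pow L.
      (sig L2 (L - L2) * (sig1 N J * theta_minus_zeta ({1..N} - J) I L2)) *\<^sub>C y ({1..N} - (K \<union> J)) (L - L2)))
    = (\<Sum>J\<in>Pow ({1..N} - K). (sig J K * sig1 N (J \<union> K)) *\<^sub>C (\<Sum>L2\<in>Pow L.
      (sig L2 (L - L2) * (sig1 N J * theta_minus_zeta ({1..N} - J) I L2)) *\<^sub>C y ({1..N} - (K \<union> J)) (L - L2)))"
    by (rule sum.mono_neutral_right) (auto simp: sig_def)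
  also have "\<dots> = (\<Sum>J\<in>Pow ({1..N} - K). \<Sum>L2\<in>Pow L. ?f L2 ({1..N} - (K \<union> J)))"
  proof (intro sum.cong refl)
    fix J assume "J \<in> Pow ({1..N} - K)"
    then have J: "J \<subseteq> {1..N}" "J \<inter> K = {}" by auto
    have U: "K \<union> ({1..N} - (K \<union> J)) = {1..N} - J" using J K by auto
    show "(sig J K * sig1 N (J \<union> K)) *\<^sub>C (\<Sum>L2\<in>Pow L.
      (sig L2 (L - L2) * (sig1 N J * theta_minus_zeta ({1..N} - J) I L2)) *\<^sub>C y ({1..N} - (K \<union> J)) (L - L2))
      = (\<Sum>L2\<in>Pow L. ?f L2 ({1..N} - (K \<union> J)))"
      unfolding U sig_complement[OF J(1) K J(2), symmetric]
      by (simp add: superspace.scale_sum_right scaleC_scaleC mult_ac)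
  qed
  also have "\<dots> = (\<Sum>U\<in>Pow ({1..N} - K). \<Sum>L2\<in>Pow L. ?f L2 U)"
    by (rule sum.reindex_bij_witness[of _ "\<lambda>U. {1..N} - (K \<union> U)" "\<lambda>J. {1..N} - (K \<union> J)"])
      (use K in \<open>auto intro!: arg_cong[where f = "\<lambda>U. \<Sum>L2\<in>Pow L. ?f L2 U"]\<close>)
  also have "\<dots> = (\<Sum>U\<in>Pow {1..N}. \<Sum>L2\<in>Pow L. ?f L2 U)"
    by (rule sum.mono_neutral_left) (auto simp: sig_def intro!: sum.neutral)
  also have "\<dots> = (\<Sum>L2\<in>Pow L. \<Sum>U\<in>Pow {1..N}. ?f L2 U)"
    by (rule sum.swap)
  finally show ?thesis .
qed


section \<open>The super delta distribution\<close>

text \<open>If \<open>m + n = -1\<close>, exactly one exponent is nonnegative, so each coefficient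
  comes from exactly one of the two expansions.\<close>

lemma super_delta_eq: "super_delta N m I n L = (if m + n = - 1 then theta_minus_zeta {1..N} I L else 0)"
proof -
  have neg: "((- 1 :: complex) gchoose j) = (- 1) ^ j" for j
    using gbinomial_minus[of "1 :: complex" j] binomial_gbinomial[of j j, where 'a = complex] by simp
  have "(- 1) powi n * (- 1) ^ nat m = (- 1 :: complex)" if "m + n = - 1" "m \<ge> 0"
  proof -
    have "(- 1 :: complex) ^ nat m = (- 1) powi m" using that by (simp add: power_int_def)
    then have "(- 1) powi n * (- 1) ^ nat m = (- 1 :: complex) powi (m + n)" by (simp add: power_int_add mult.commute)
    then show ?thesis using that by simp
  qed
  moreover have "(- 1) powi n * (- 1) ^ nat n = (1 :: complex)" if "n \<ge> 0"
    using that by (simp add: power_int_def flip: power_mult_distrib)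
  ultimately show ?thesis
    by (auto simp: super_delta_def exp_zw_def exp_wz_def neg)
qed

lemma funpow_deriv_w:
  "(deriv_w ^^ j) f m I n K = pochhammer (of_int n + 1) j * f m I (n + int j) K"
proof (induction j arbitrary: n)
  case (Suc j)
  have "(deriv_w ^^ Suc j) f m I n K = of_int (n + 1) * (deriv_w ^^ j) f m I (n + 1) K"
    by (simp add: deriv_w_def[of "(deriv_w ^^ j) f"])
  then show ?case
    by (simp add: Suc pochhammer_rec add_ac)
qed simp

text \<open>With \<open>r = length xs\<close>, passing \<open>\<theta>^I\<close> costs
  \<open>r * card I\<close> signs and the order of the derivatives \<open>r (r - 1) / 2\<close>.
  Modulo 2 the latter is \<open>r (r + 1) / 2 + r\<close>, a form in which the normalisation in
  \<open>deriv_W\<close> cancels the first term.\<close>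

lemma foldr_deriv_zeta:
  assumes "sorted_wrt (<) xs" "finite L"
  shows "foldr deriv_zeta xs f m I n L = (- 1) ^ (length xs * card I + length xs * (length xs + 1) div 2 + length xs)
    * sig (set xs) L * f m I n (L \<union> set xs)"
  using assms
proof (induction xs arbitrary: L)
  case Nil
  then show ?case by simp
next
  case (Cons x xs)
  have x: "x \<notin> set xs" "\<And>l. l \<in> set xs \<Longrightarrow> x < l" using Cons.prems by auto
  have tri: "Suc r * (Suc r + 1) div 2 = r * (r + 1) div 2 + Suc r" for r :: nat
  proof -
    have "Suc r * (Suc r + 1) = r * (r + 1) + Suc r * 2" by simp
    then show ?thesis by (simp only:) simp
  qed
  have len: "length xs = card (set xs)" using Cons.prems by (simp add: distinct_card strict_sorted_iff)
  show ?case
  proof (cases "x \<in> L")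
    case True
    then show ?thesis by (auto simp: deriv_zeta_def sig_def)
  next
    case False
    have l: "sig (insert x (set xs)) L = sig {x} L * sig (set xs) L"
      using sig_Un_left[of "{x}" "set xs" L] x Cons.prems by simp
    have r: "sig (set xs) (insert x L) = (- 1) ^ length xs * sig (set xs) L"
      using sig_Un_right[of "{x}" L "set xs"] x Cons.prems False sig_singleton_below(2)[of "set xs" x] len by simp
    have "foldr deriv_zeta (x # xs) f m I n L = (- 1) ^ (card I + card {l \<in> L. l < x}) *
      ((- 1) ^ (length xs * card I + length xs * (length xs + 1) div 2 + length xs)
    * ((- 1) ^ length xs * sig (set xs) L) * f m I n (insert x L \<union> set xs))"
    proof -
      have "foldr deriv_zeta (x # xs) f m I n L = (- 1) ^ (card I + card {l \<in> L. l < x})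
        * foldr deriv_zeta xs f m I n (insert x L)"
        using False by (simp add: deriv_zeta_def[of x "foldr deriv_zeta xs f"])
      also have "foldr deriv_zeta xs f m I n (insert x L) = (- 1) ^ (length xs * card I + length xs * (length xs + 1) div 2 + length xs)
        * ((- 1) ^ length xs * sig (set xs) L) * f m I n (insert x L \<union> set xs)"
        unfolding r[symmetric] by (rule Cons.IH) (use Cons.prems in simp_all)
      finally show ?thesis .
    qed
    then show ?thesis
      using False Cons.prems unfolding tri length_Cons
      by (simp add: l sig_singleton_left power_add mult_ac)
  qed
qed

text \<open>The odd derivatives strip \<open>J\<close> off \<open>(\<theta> - \<zeta>)^N\<close>.
  After the normalising sign, what remains of the signs is just \<open>\<sigma>(J)\<close>, from
  splitting \<open>N\<close> into \<open>J\<close> and its complement.\<close>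

lemma deriv_W_super_delta:
  assumes J: "J \<subseteq> {1..N}" and fin: "finite I" "finite L"
  shows "deriv_W j J (super_delta N) m I n L
    = (if m + n = - 1 - int j then (of_int (- 1 - m) gchoose j) * sig1 N J * theta_minus_zeta ({1..N} - J) I L else 0)"
proof -
  have fJ: "finite J" using J finite_subset by blast
  have fold: "foldr deriv_zeta (sorted_list_of_set J) f m I n L = (- 1) ^ (card J * card I + card J * (card J + 1) div 2 + card J)
    * sig J L * f m I n (L \<union> J)" for f n
    using foldr_deriv_zeta[of "sorted_list_of_set J" L f m I n] fJ fin by simp
  have s: "(- 1) ^ (card J * card I + card J) * sig J L * theta_minus_zeta {1..N} I (L \<union> J)
    = sig1 N J * theta_minus_zeta ({1..N} - J) I L"
  proof (cases "I \<union> L = {1..N} - J")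
    case True
    have d: "I \<inter> J = {}" "L \<inter> J = {}" "I \<union> (L \<union> J) = {1..N}" using True J by auto
    have sw: "sig I J * sig J I = (- 1) ^ (card J * card I)"
      using sig_swap[of I J] fin fJ d by (simp add: mult.commute)
    show ?thesis
    proof (cases "I \<inter> L = {}")
      case False
      then have "sig I (L \<union> J) = 0" "sig I L = 0" by (auto simp: sig_def)
      then show ?thesis by (simp add: theta_minus_zeta_eq)
    next
      case d': True
      have "sig1 N J * theta_minus_zeta ({1..N} - J) I L = sig J (I \<union> L) * ((- 1) ^ card L * sig I L)"
        by (simp add: sig1_def theta_minus_zeta_eq True)
      also have "\<dots> = sig J I * sig J L * ((- 1) ^ card L * sig I L)"
        using fin fJ d' by (simp add: sig_Un_right)
      also have "\<dots> = (sig I J * sig I J) * (sig J I * sig J L * ((- 1) ^ card L * sig I L))"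
        using d by (simp add: sig_square)
      also have "\<dots> = (sig I J * sig J I) * (sig J L * (- 1) ^ card L * sig I L * sig I J)"
        by (simp add: mult_ac)
      also have "\<dots> = (- 1) ^ (card J * card I) * (sig J L * (- 1) ^ card L * sig I (L \<union> J))"
        unfolding sw using fin fJ d by (simp add: sig_Un_right mult_ac)
      also have "\<dots> = (- 1) ^ (card J * card I + card J) * sig J L * theta_minus_zeta {1..N} I (L \<union> J)"
        using d fin fJ by (simp add: theta_minus_zeta_eq card_Un_disjoint power_add mult_ac flip: power_mult_distrib)
      finally show ?thesis ..
    qed
  next
    case False
    then have R: "theta_minus_zeta ({1..N} - J) I L = 0" by (simp add: theta_minus_zeta_eq)
    have "sig J L * theta_minus_zeta {1..N} I (L \<union> J) = 0"
    proof (rule ccontr)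
      assume "sig J L * theta_minus_zeta {1..N} I (L \<union> J) \<noteq> 0"
      then have "J \<inter> L = {}" "I \<union> (L \<union> J) = {1..N}" "I \<inter> (L \<union> J) = {}"
        by (auto simp: sig_def theta_minus_zeta_eq split: if_splits)
      then show False using False by auto
    qed
    then show ?thesis using R by (simp add: mult.assoc)
  qed
  let ?t = "card J * (card J + 1) div 2"
  have "deriv_W j J (super_delta N) m I n L = (- 1) ^ ?t / fact j * (pochhammer (of_int n + 1) j *
    ((- 1) ^ (card J * card I + ?t + card J) * sig J L * super_delta N m I (n + int j) (L \<union> J)))"
    by (simp add: deriv_W_def funpow_deriv_w fold)
  also have "\<dots> = (if m + n = - 1 - int j then pochhammer (of_int n + 1) j / fact j *
     ((- 1) ^ (card J * card I + card J) * sig J L * theta_minus_zeta {1..N} I (L \<union> J)) else 0)"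
    by (auto simp: super_delta_eq power_add mult_ac simp flip: power_mult_distrib)
  also have "\<dots> = (if m + n = - 1 - int j then (of_int (- 1 - m) gchoose j) *
     (sig1 N J * theta_minus_zeta ({1..N} - J) I L) else 0)"
  proof -
    \<comment> \<open>The rising factorial of length \<open>j\<close> from
      \<open>n + 1 = - m - j\<close> ends at \<open>- 1 - m\<close>, so it is the falling factorial
      from there.\<close>
    have "pochhammer (of_int n + 1) j / fact j = ((of_int (- 1 - m) :: complex) gchoose j)" if "m + n = - 1 - int j"
    proof -
      have "n = - 1 - m - int j" using that by simp
      then show ?thesis by (simp add: gbinomial_pochhammer')
    qed
    then show ?thesis by (simp only: s) simp
  qed
  finally show ?thesis by (simp add: mult.assoc)
qed


section \<open>Parities and products of distributions\<close>

lemma homog_zero: "0 \<in> homog p"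
  by (simp add: homog_def even_space_zero odd_space_zero)

lemma homog_add: "x \<in> homog p \<Longrightarrow> y \<in> homog p \<Longrightarrow> x + y \<in> homog p"
  by (auto simp: homog_def intro: even_space_add odd_space_add)

lemma homog_scaleC: "x \<in> homog p \<Longrightarrow> c *\<^sub>C x \<in> homog p"
  by (auto simp: homog_def intro: even_space_scale odd_space_scale)

lemma homog_diff: "x \<in> homog p \<Longrightarrow> y \<in> homog p \<Longrightarrow> x - y \<in> homog p"
  using homog_add[of x p "(- 1) *\<^sub>C y"] homog_scaleC[of y p "- 1"] by simp

lemma homog_Int: "x \<in> homog p \<Longrightarrow> x \<in> homog (Suc p) \<Longrightarrow> x = 0"
  using even_odd_Int by (auto simp: homog_def split: if_splits)

lemma component_eqI:
  assumes "y \<in> homog p" "x - y \<in> homog (Suc p)"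
  shows "component p x = y"
  unfolding component_def
proof (rule the_equality)
  fix y' assume y': "y' \<in> homog p \<and> x - y' \<in> homog (Suc p)"
  have "y' - y = (x - y) - (x - y')" by simp
  then have "y' - y \<in> homog (Suc p)" using assms y' by (metis homog_diff)
  moreover have "y' - y \<in> homog p" using assms y' by (metis homog_diff)
  ultimately show "y' = y" using homog_Int[of "y' - y" p] by simp
qed (use assms in auto)

lemma component_homog:
  assumes "x \<in> homog q"
  shows "component p x = (if even (p + q) then x else 0)"
proof (cases "even (p + q)")
  case True
  then have "x \<in> homog p" using assms by (auto simp: homog_def)
  then show ?thesis using True by (simp add: component_eqI homog_zero)
next
  case False
  then have "x \<in> homog (Suc p)" using assms by (auto simp: homog_def)
  then show ?thesis using False by (simp add: component_eqI homog_zero)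
qed

lemma homog_decomp:
  obtains x0 x1 where "x0 \<in> homog 0" "x1 \<in> homog 1" "x = x0 + x1"
    "component 0 x = x0" "component 1 x = x1"
proof -
  obtain x0 x1 where x: "x0 \<in> homog 0" "x1 \<in> homog 1" "x = x0 + x1"
    using even_odd_decomp[of x] by (auto simp: homog_def)
  moreover have "component 0 x = x0" by (rule component_eqI) (use x in auto)
  moreover have "component 1 x = x1"
    by (rule component_eqI) (use x in \<open>auto simp: homog_def\<close>)
  ultimately show ?thesis by (rule that)
qed

lemma sum_lessThan_2: "(\<Sum>q<2. f q) = f 0 + f (1::nat)"
  by (simp add: numeral_2_eq_2)

lemma op_part_homog:
  assumes "op_parity r A" "linC A"
  shows "op_part p A v = (if even (p + r) then A v else 0)"
proof -
  obtain x0 x1 where x: "x0 \<in> homog 0" "x1 \<in> homog 1" "v = x0 + x1"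
    "component 0 v = x0" "component 1 v = x1"
    by (rule homog_decomp)
  have "A x0 \<in> homog r" "A x1 \<in> homog (r + 1)"
    using assms(1) x(1,2) unfolding op_parity_def by (metis add_0_right)+
  then have "component p (A x0) = (if even (p + r) then A x0 else 0)"
    "component (p + 1) (A x1) = (if even (p + r) then A x1 else 0)"
    by (auto simp: component_homog)
  then show ?thesis
    unfolding op_part_def sum_lessThan_2 x(4,5) by (simp add: x(3) linC_add[OF assms(2)])
qed

text \<open>Coefficients are arbitrary functions, so their value at 0 is recorded as well: it makes
  products with a zero right factor vanish.\<close>

definition od_homog :: "nat \<Rightarrow> 'v::superspace op_dist \<Rightarrow> bool" where
  "od_homog p X \<longleftrightarrow> (\<forall>r. od_part r X = (if even (r + p) then X else 0)) \<and> (\<forall>m I n K. X m I n K 0 = 0)"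

lemma od_mult_0_left: "od_mult 0 X = 0"
  by (simp add: fun_eq_iff od_mult_def op_part_0)

lemma od_mult_0_right: "(\<And>m I n K. X m I n K 0 = 0) \<Longrightarrow> od_mult X 0 = 0"
  by (simp add: fun_eq_iff od_mult_def op_part_at_0)

lemma od_scale_0: "od_scale c 0 = 0"
  by (simp add: fun_eq_iff od_scale_def)

lemma supercomm_homog:
  assumes "od_homog p X" "od_homog q Z"
  shows "supercomm X Z = od_mult X Z - od_scale ((- 1) ^ (p * q)) (od_mult Z X)"
proof -
  have X: "od_part r X = (if even (r + p) then X else 0)" "X m I n K 0 = 0"
    and Z: "od_part r Z = (if even (r + q) then Z else 0)" "Z m I n K 0 = 0" for r m I n K
    using assms by (auto simp: od_homog_def)
  show ?thesis
    unfolding supercomm_def sum_lessThan_2 X(1) Z(1)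
    by (auto simp: od_mult_0_left od_mult_0_right X(2) Z(2) od_scale_0)
qed

lemma od_homog_in_Z:
  assumes "\<And>m I. op_parity (p + card I) (f m I)" "\<And>m I. linC (f m I)"
  shows "od_homog p (in_Z f)"
  unfolding od_homog_def od_part_def in_Z_def
  by (auto simp: fun_eq_iff op_part_homog[OF assms] op_part_0 linC_zero[OF assms(2)])

lemma od_homog_in_W:
  assumes "\<And>m I. op_parity (p + card I) (f m I)" "\<And>m I. linC (f m I)"
  shows "od_homog p (in_W f)"
  unfolding od_homog_def od_part_def in_W_def
  by (auto simp: fun_eq_iff op_part_homog[OF assms] op_part_0 linC_zero[OF assms(2)])

lemma op_parity_0: "op_parity p (0 :: 'v \<Rightarrow> 'v::superspace)"
  by (simp add: op_parity_def homog_zero)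

text \<open>With a constant viewed as a field in \<open>W\<close>, its brackets with fields in
  \<open>Z\<close> follow from the product formulas for two fields.\<close>

lemma od_const_in_W: "od_const A = in_W (\<lambda>n K. if n = 0 \<and> K = {} then A else 0)"
  by (auto simp: fun_eq_iff od_const_def in_W_def)

lemma od_mult_in_Z_in_W_homog:
  assumes "finite I" "finite K" "\<And>m I. op_parity (p + card I) (f m I)" "\<And>m I. linC (f m I)"
  shows "od_mult (in_Z f) (in_W g) m I n K v = (- 1) ^ ((p + card I) * card K) *\<^sub>C f m I (g n K v)"
  using assms(1,2)
  by (subst od_mult_in_Z_in_W)
    (auto simp: sum_lessThan_2 op_part_homog[OF assms(3,4)] linC_zero[OF assms(4)] minus_one_power_iff)

text \<open>Sorting \<open>\<zeta>^K \<theta>^I\<close> cancels the sign that the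
  \<open>card K\<close> part of the parity of \<open>g n K\<close> produces, so only
  \<open>p\<close> remains.\<close>

lemma od_mult_in_W_in_Z_homog:
  assumes "finite I" "finite K" "\<And>m I. op_parity (p + card I) (g m I)" "\<And>m I. linC (g m I)"
  shows "od_mult (in_W g) (in_Z f) m I n K v = (- 1) ^ (p * card I) *\<^sub>C g n K (f m I v)"
  using assms(1,2)
  by (subst od_mult_in_W_in_Z)
    (auto simp: sum_lessThan_2 op_part_homog[OF assms(3,4)] linC_zero[OF assms(4)] minus_one_power_iff)

text \<open>Common to both expansions: \<open>h\<close> enumerates the half-line of exponents that
  supports \<open>c\<close>, and \<open>J\<close> is a cut-off valid for all subsets of
  \<open>I\<close> and \<open>L\<close> at once.\<close>

lemma od_smult_eq_sum:
  assumes fin: "finite I" "finite L" and "inj h"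
    and c: "\<And>j I K. c (fst (h j)) I (snd (h j)) K = \<kappa> j * \<theta> I K"
    and c0: "\<And>m n I K. (m, n) \<notin> range h \<Longrightarrow> c m I n K = 0"
    and X: "\<And>j I' L'. j \<ge> J \<Longrightarrow> I' \<subseteq> I \<Longrightarrow> L' \<subseteq> L \<Longrightarrow> \<kappa> j = 0 \<or> X (m - fst (h j)) I' (n - snd (h j)) L' v = 0"
  shows "od_smult c X m I n L v = (\<Sum>I1\<in>Pow I. \<Sum>K1\<in>Pow L. (koszul I1 K1 (I - I1) (L - K1) * \<theta> I1 K1)
    *\<^sub>C (\<Sum>j<J::nat. \<kappa> j *\<^sub>C X (m - fst (h j)) (I - I1) (n - snd (h j)) (L - K1) v))"
proof -
  define t where "t x = (\<Sum>I1\<in>Pow I. \<Sum>K1\<in>Pow L. (koszul I1 K1 (I - I1) (L - K1) * c (fst x) I1 (snd x) K1)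
       *\<^sub>C X (m - fst x) (I - I1) (n - snd x) (L - K1) v)" for x
  have "od_smult c X m I n L v = Sum_any t"
    unfolding od_smult_def t_def by (simp add: case_prod_beta')
  also have "\<dots> = sum t (h ` {..<J})"
  proof (rule Sum_any.expand_superset)
    show "{x. t x \<noteq> 0} \<subseteq> h ` {..<J}"
    proof (rule subsetI, rule ccontr)
      fix x assume x: "x \<in> {x. t x \<noteq> 0}" "x \<notin> h ` {..<J}"
      have "t x = 0"
      proof (cases "x \<in> range h")
        case True
        then obtain j where "x = h j" by blast
        then have "j \<ge> J" using x(2) by (meson imageI lessThan_iff not_le)
        then show ?thesis unfolding t_def \<open>x = h j\<close> by (intro sum.neutral ballI) (use X in \<open>force simp: c\<close>)
      next
        case False
        then show ?thesis unfolding t_def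
          by (intro sum.neutral ballI) (simp add: c0[of "fst x" "snd x"])
      qed
      then show False using x by simp
    qed
  qed simp
  also have "\<dots> = (\<Sum>j<J. t (h j))"
    using \<open>inj h\<close> by (simp add: sum.reindex inj_on_subset comp_def)
  also have "\<dots> = (\<Sum>j<J. \<Sum>I1\<in>Pow I. \<Sum>K1\<in>Pow L. (koszul I1 K1 (I - I1) (L - K1) * \<theta> I1 K1)
       *\<^sub>C \<kappa> j *\<^sub>C X (m - fst (h j)) (I - I1) (n - snd (h j)) (L - K1) v)"
    unfolding t_def c by (simp add: scaleC_scaleC mult_ac)
  also have "\<dots> = (\<Sum>I1\<in>Pow I. \<Sum>K1\<in>Pow L. \<Sum>j<J. (koszul I1 K1 (I - I1) (L - K1) * \<theta> I1 K1)
       *\<^sub>C \<kappa> j *\<^sub>C X (m - fst (h j)) (I - I1) (n - snd (h j)) (L - K1) v)"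
    by (subst sum.swap, rule sum.cong[OF refl], subst sum.swap, rule refl)
  finally show ?thesis by (simp add: superspace.scale_sum_right)
qed

lemma lower_bounded_uniform:
  assumes "finite A" "\<And>x. x \<in> A \<Longrightarrow> lower_bounded (f x)"
  obtains M where "\<And>x m n. x \<in> A \<Longrightarrow> n < M \<Longrightarrow> f x m n = 0"
proof -
  obtain B where B: "\<And>x n m. x \<in> A \<Longrightarrow> n < B x \<Longrightarrow> f x m n = 0"
    using assms(2) unfolding lower_bounded_def by metis
  show ?thesis
  proof (rule that)
    fix x m n assume "x \<in> A" "n < Min (insert 0 (B ` A))"
    then show "f x m n = 0" using B assms(1) by auto
  qed
qed

lemma od_smult_exp_zw:
  assumes fin: "finite I" "finite L"
    and X: "0 \<le> k \<or> (\<forall>I' L'. I' \<subseteq> I \<longrightarrow> L' \<subseteq> L \<longrightarrow> lower_bounded (\<lambda>m n. X m I' n L' v))"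
  shows "od_smult (exp_zw k K) X m I n L v = (\<Sum>I1\<in>Pow I. \<Sum>K1\<in>Pow L.
    (koszul I1 K1 (I - I1) (L - K1) * theta_minus_zeta K I1 K1)
      *\<^sub>C expansion k (\<lambda>m n. X m (I - I1) n (L - K1) v) m n)"
proof -
  obtain J where J: "\<And>j I' L'. j \<ge> J \<Longrightarrow> I' \<subseteq> I \<Longrightarrow> L' \<subseteq> L \<Longrightarrow>
    (of_int k gchoose j) = (0 :: complex) \<or> X (m - k + int j) I' (n - int j) L' v = 0"
  proof (cases "0 \<le> k")
    case True
    show ?thesis
      by (rule that[of "nat (k + 1)"]; rule disjI1, rule gbinomial_eq_0_of_int; use True in linarith)
  next
    case False
    obtain M where M: "\<And>x m n. x \<in> Pow I \<times> Pow L \<Longrightarrow> n < M \<Longrightarrow> X m (fst x) n (snd x) v = 0"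
      by (rule lower_bounded_uniform[of "Pow I \<times> Pow L" "\<lambda>x m n. X m (fst x) n (snd x) v"])
        (use fin X False in auto)
    have "X m I' n L' v = 0" if "I' \<subseteq> I" "L' \<subseteq> L" "n < M" for I' L' n m
      using M[of "(I', L')"] that by simp
    then show ?thesis
      by (intro that[of "nat (n - M + 1)"] disjI2) auto
  qed
  have "od_smult (exp_zw k K) X m I n L v = (\<Sum>I1\<in>Pow I. \<Sum>K1\<in>Pow L.
    (koszul I1 K1 (I - I1) (L - K1) * theta_minus_zeta K I1 K1)
      *\<^sub>C (\<Sum>j<J. ((- 1) ^ j * (of_int k gchoose j)) *\<^sub>C X (m - fst (k - int j, int j)) (I - I1) (n - snd (k - int j, int j)) (L - K1) v))"
  proof (rule od_smult_eq_sum[OF fin])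
    show "inj (\<lambda>j. (k - int j, int j))" by (simp add: inj_def)
    show "exp_zw k K (fst (k - int j, int j)) I (snd (k - int j, int j)) L =
          (- 1) ^ j * (of_int k gchoose j) * theta_minus_zeta K I L" for j I L
      by (simp add: exp_zw_def)
    show "exp_zw k K m I n L = 0" if "(m, n) \<notin> range (\<lambda>j. (k - int j, int j))" for m n I L
    proof -
      have "\<not> (n \<ge> 0 \<and> m + n = k)"
        using that by (metis (mono_tags, lifting) add_diff_cancel_right' nat_0_le rangeI)
      then show ?thesis by (auto simp: exp_zw_def)
    qed
    show "(- 1) ^ j * (of_int k gchoose j) = (0 :: complex) \<or> X (m - fst (k - int j, int j)) I' (n - snd (k - int j, int j)) L' v = 0"
      if "j \<ge> J" "I' \<subseteq> I" "L' \<subseteq> L" for j I' L'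
      using J[OF that] by (simp add: algebra_simps)
  qed
  moreover have "expansion k (\<lambda>m n. X m (I - I1) n (L - K1) v) m n =
    (\<Sum>j<J. ((- 1) ^ j * (of_int k gchoose j)) *\<^sub>C X (m - k + int j) (I - I1) (n - int j) (L - K1) v)" for I1 K1
    by (rule expansion_eq_sum) (rule J; simp)
  ultimately show ?thesis by (simp add: algebra_simps)
qed

lemma od_smult_exp_wz:
  assumes fin: "finite I" "finite L"
    and X: "\<And>I' L'. I' \<subseteq> I \<Longrightarrow> L' \<subseteq> L \<Longrightarrow> lower_bounded (\<lambda>n m. X m I' n L' v)"
  shows "od_smult (exp_wz k K) X m I n L v = (\<Sum>I1\<in>Pow I. \<Sum>K1\<in>Pow L.
    (koszul I1 K1 (I - I1) (L - K1) * theta_minus_zeta K I1 K1)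
      *\<^sub>C (- 1) powi k *\<^sub>C expansion k (\<lambda>n m. X m (I - I1) n (L - K1) v) n m)"
proof -
  obtain M where M: "\<And>x n m. x \<in> Pow I \<times> Pow L \<Longrightarrow> m < M \<Longrightarrow> X m (fst x) n (snd x) v = 0"
    by (rule lower_bounded_uniform[of "Pow I \<times> Pow L" "\<lambda>x n m. X m (fst x) n (snd x) v"])
      (use fin X in auto)
  define J where "J = nat (m - M + 1)"
  have J: "m - M < int J" by (simp add: J_def)
  have M': "I' \<subseteq> I \<Longrightarrow> L' \<subseteq> L \<Longrightarrow> m < M \<Longrightarrow> X m I' n L' v = 0" for I' L' n m
    using M[of "(I', L')"] by simp
  have "od_smult (exp_wz k K) X m I n L v = (\<Sum>I1\<in>Pow I. \<Sum>K1\<in>Pow L.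
    (koszul I1 K1 (I - I1) (L - K1) * theta_minus_zeta K I1 K1)
      *\<^sub>C (\<Sum>j<J. ((- 1) powi k * ((- 1) ^ j * (of_int k gchoose j))) *\<^sub>C X (m - fst (int j, k - int j)) (I - I1) (n - snd (int j, k - int j)) (L - K1) v))"
  proof (rule od_smult_eq_sum[OF fin])
    show "inj (\<lambda>j. (int j, k - int j))" by (simp add: inj_def)
    show "exp_wz k K (fst (int j, k - int j)) I (snd (int j, k - int j)) L =
          (- 1) powi k * ((- 1) ^ j * (of_int k gchoose j)) * theta_minus_zeta K I L" for j I L
      by (simp add: exp_wz_def power_int_diff power_int_minus_one_mult_self field_simps)
    show "exp_wz k K m I n L = 0" if "(m, n) \<notin> range (\<lambda>j. (int j, k - int j))" for m n I L
    proof -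
      have "\<not> (m \<ge> 0 \<and> m + n = k)"
        using that by (metis (mono_tags, lifting) add_diff_cancel_left' nat_0_le rangeI)
      then show ?thesis by (auto simp add: exp_wz_def)
    qed
    show "(- 1) powi k * ((- 1) ^ j * (of_int k gchoose j)) = (0 :: complex) \<or> X (m - fst (int j, k - int j)) I' (n - snd (int j, k - int j)) L' v = 0"
      if "j \<ge> J" "I' \<subseteq> I" "L' \<subseteq> L" for j I' L'
      using that J by (simp add: M')
  qed
  moreover have "expansion k (\<lambda>n m. X m (I - I1) n (L - K1) v) n m =
    (\<Sum>j<J. ((- 1) ^ j * (of_int k gchoose j)) *\<^sub>C X (m - int j) (I - I1) (n - k + int j) (L - K1) v)" for I1 K1
    by (rule expansion_eq_sum_bounded[of M "\<lambda>n m. X m (I - I1) n (L - K1) v"]) (use J in \<open>auto simp: M'\<close>)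
  ultimately show ?thesis by (simp add: superspace.scale_sum_right algebra_simps)
qed

text \<open>Sums over infinite sets are 0 by convention, and \<open>Pow\<close> of an infinite set
  is infinite. So coefficients with infinite index sets agree trivially.\<close>

lemma od_smult_infinite: "infinite I \<or> infinite L \<Longrightarrow> od_smult c X m I n L v = 0"
  by (auto simp: od_smult_def case_prod_beta')

text \<open>A field in \<open>W\<close> leaves the exponent of \<open>z\<close> and the set
  \<open>I\<close> to \<open>c\<close>. For derivatives of the delta distribution these determine
  the exponent of \<open>w\<close>, so no infinite sum arises.\<close>

lemma od_smult_in_W:
  assumes fin: "finite I" "finite L" and c: "\<And>n K. K \<subseteq> L \<Longrightarrow> n \<noteq> n1 \<Longrightarrow> c m I n K = 0"
  shows "od_smult c (in_W f) m I n L v = (\<Sum>K1\<in>Pow L. (sig K1 (L - K1) * c m I n1 K1) *\<^sub>C f (n - n1) (L - K1) v)"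
proof -
  define t where "t x = (\<Sum>I1\<in>Pow I. \<Sum>K1\<in>Pow L. (koszul I1 K1 (I - I1) (L - K1) * c (fst x) I1 (snd x) K1)
       *\<^sub>C in_W f (m - fst x) (I - I1) (n - snd x) (L - K1) v)" for x
  have "od_smult c (in_W f) m I n L v = Sum_any t"
    unfolding od_smult_def t_def by (simp add: case_prod_beta')
  also have "\<dots> = sum t {(m, n1)}"
  proof (rule Sum_any.expand_superset)
    show "{x. t x \<noteq> 0} \<subseteq> {(m, n1)}"
    proof (rule subsetI, rule ccontr)
      fix x assume x: "x \<in> {x. t x \<noteq> 0}" "x \<notin> {(m, n1)}"
      have "t x = 0" unfolding t_def
      proof (intro sum.neutral ballI)
        fix I1 K1 assume "I1 \<in> Pow I" "K1 \<in> Pow L"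
        then show "(koszul I1 K1 (I - I1) (L - K1) * c (fst x) I1 (snd x) K1)
          *\<^sub>C in_W f (m - fst x) (I - I1) (n - snd x) (L - K1) v = 0"
          using x(2) c[of K1 "snd x"] by (cases x; cases "I1 = I") (auto simp: in_W_def)
      qed
      then show False using x by simp
    qed
  qed simp
  also have "\<dots> = (\<Sum>I1\<in>Pow I. if I1 = I then \<Sum>K1\<in>Pow L. (sig K1 (L - K1) * c m I n1 K1) *\<^sub>C f (n - n1) (L - K1) v else 0)"
    unfolding t_def by simp (intro sum.cong refl, auto simp: in_W_def koszul_def intro!: sum.cong sum.neutral)
  finally show ?thesis using fin by (simp add: sum.delta)
qed

lemma sum_apply_fun: "(sum f A) x = (\<Sum>a\<in>A. f a x)"
  by (induction A rule: infinite_finite_induct) simp_all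

lemma sum_apply_coeff: "(sum F A) m I n L v = (\<Sum>j\<in>A. F j m I n L v)"
  by (simp only: sum_apply_fun)

lemma theta_minus_zeta_empty: "theta_minus_zeta {} = gr_monom {} {}"
  by (simp add: theta_minus_zeta_def gr_prod_list_def)


section \<open>Borcherds' identity\<close>

context NW_SUSY_vertex_algebra
begin

section \<open>The axioms in terms of coefficients\<close>

lemma Y_infinite: "infinite I \<Longrightarrow> Y a m I = 0"
  by (rule Y_support) (auto intro: finite_subset)

lemma field_Y: "is_field (\<lambda>m. Y a m I)"
  unfolding is_field_def using Y_coeff_linear Y_field by blast

lemma T_commutator:
  assumes "a \<in> homog p"
  shows "T (Y a m I v) - Y a m I (T v) = of_int (m + 1) *\<^sub>C Y a (m + 1) I v"
proof (cases "finite I")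
  case False
  then show ?thesis using linC_zero[OF T_linear] by (simp add: Y_infinite)
next
  case True
  define g where "g = (\<lambda>(n :: int) (K :: nat set). if n = 0 \<and> K = {} then T else (0 :: 'v \<Rightarrow> 'v))"
  have g: "op_parity (0 + card K) (g n K)" "linC (g n K)" for n :: int and K :: "nat set"
    using T_even T_linear by (auto simp: g_def op_parity_0 linC_0)
  have c: "od_const T = in_W g" by (simp add: od_const_in_W g_def)
  have Ya: "op_parity (p + card I) (Y a m I)" "linC (Y a m I)" for m I
    using Y_parity[OF assms] Y_coeff_linear by auto
  have "supercomm (od_const T) (in_Z (Y a)) m I 0 {} v = T (Y a m I v) - Y a m I (T v)"
    unfolding c supercomm_homog[OF od_homog_in_W[OF g] od_homog_in_Z[OF Ya]]
    by (simp add: od_scale_def od_mult_in_W_in_Z_homog[OF True _ g] od_mult_in_Z_in_W_homog[OF True _ Ya])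
      (simp add: g_def)
  then show ?thesis
    unfolding T_bracket by (simp add: od_deriv_z_def in_Z_def)
qed

text \<open>Moving \<open>S i\<close> past \<open>\<theta>^I\<close> gives
  \<open>(- 1) ^ card I\<close>; the sign \<open>(- 1) ^ p\<close> is that of the
  supercommutator.\<close>

lemma S_commutator:
  assumes "a \<in> homog p" "i \<in> {1..N}"
  shows "(- 1) ^ card I *\<^sub>C S i (Y a m I v) - (- 1) ^ p *\<^sub>C Y a m I (S i v)
    = (if i \<in> I then 0 else (- 1) ^ card {l \<in> I. l < i} *\<^sub>C Y a m (insert i I) v)"
proof (cases "finite I")
  case False
  then show ?thesis using linC_zero[OF S_linear[OF assms(2)]] by (simp add: Y_infinite)
next
  case True
  define g where "g = (\<lambda>(n :: int) (K :: nat set). if n = 0 \<and> K = {} then S i else (0 :: 'v \<Rightarrow> 'v))"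
  have g: "op_parity (1 + card K) (g n K)" "linC (g n K)" for n :: int and K :: "nat set"
    using S_odd S_linear assms(2) by (auto simp: g_def op_parity_0 linC_0)
  have c: "od_const (S i) = in_W g" by (simp add: od_const_in_W g_def)
  have Ya: "op_parity (p + card I) (Y a m I)" "linC (Y a m I)" for m I
    using Y_parity[OF assms(1)] Y_coeff_linear by auto
  have "supercomm (od_const (S i)) (in_Z (Y a)) m I 0 {} v
    = (- 1) ^ card I *\<^sub>C S i (Y a m I v) - (- 1) ^ p *\<^sub>C Y a m I (S i v)"
    unfolding c supercomm_homog[OF od_homog_in_W[OF g] od_homog_in_Z[OF Ya]]
    by (simp add: od_scale_def od_mult_in_W_in_Z_homog[OF True _ g] od_mult_in_Z_in_W_homog[OF True _ Ya])
      (simp add: g_def)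
  then show ?thesis
    unfolding S_bracket[OF assms(2)] by (cases "i \<in> I") (simp_all add: od_deriv_theta_def in_Z_def)
qed

text \<open>One exponent serves all coefficients, because \<open>(z - w)^r\<close> contains no odd
  variables and so acts on each coefficient separately.\<close>

lemma locality_coeff:
  assumes "a \<in> homog p" "b \<in> homog q"
  obtains r where "\<And>I L v. (mul_diff ^^ r)
    (bracket ((- 1) ^ ((p + card I) * (q + card L))) (\<lambda>m. Y a m I) (\<lambda>n. Y b n L) v) = (\<lambda>_ _. 0)"
proof -
  have Ya: "op_parity (p + card I) (Y a m I)" "linC (Y a m I)" for m I
    using Y_parity[OF assms(1)] Y_coeff_linear by auto
  have Yb: "op_parity (q + card I) (Y b m I)" "linC (Y b m I)" for m I
    using Y_parity[OF assms(2)] Y_coeff_linear by auto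
  define X where "X = supercomm (in_Z (Y a)) (in_W (Y b))"
  obtain r where r: "od_smult (exp_zw (int r) {}) X = 0"
    using locality unfolding X_def by blast
  have X: "X m I n L v = (- 1) ^ ((p + card I) * card L) *\<^sub>C
      bracket ((- 1) ^ ((p + card I) * (q + card L))) (\<lambda>m. Y a m I) (\<lambda>n. Y b n L) v m n"
    if "finite I" "finite L" for m I n L v
    unfolding X_def supercomm_homog[OF od_homog_in_Z[OF Ya] od_homog_in_W[OF Yb]] bracket_def
    by (simp add: od_scale_def od_mult_in_W_in_Z_homog[OF that Yb] od_mult_in_Z_in_W_homog[OF that Ya])
      (auto simp: superspace.scale_right_diff_distrib scaleC_scaleC minus_one_power_iff)
  show ?thesis
  proof (rule that)
    fix I L v
    let ?b = "bracket ((- 1) ^ ((p + card I) * (q + card L))) (\<lambda>m. Y a m I) (\<lambda>n. Y b n L) v"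
    show "(mul_diff ^^ r) ?b = (\<lambda>_ _. 0)"
    proof (cases "finite I \<and> finite L")
      case False
      then have "?b = (\<lambda>_ _. 0)"
        by (auto simp: fun_eq_iff bracket_def Y_infinite Y_coeff_zero)
      then show ?thesis by (simp add: funpow_mul_diff_zero)
    next
      case True
      let ?s = "(- 1) ^ ((p + card I) * card L) :: complex"
      have f: "expansion 0 ?b = ?b" by (intro ext expansion_0)
      have "(mul_diff ^^ r) ?b m n = 0" for m n
      proof -
        have "0 = (\<Sum>I1\<in>Pow I. \<Sum>K1\<in>Pow L. (koszul I1 K1 (I - I1) (L - K1) * theta_minus_zeta {} I1 K1)
            *\<^sub>C expansion (int r) (\<lambda>m n. X m (I - I1) n (L - K1) v) m n)"
          using od_smult_exp_zw[of I L "int r" X v "{}" m n] True r by simp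
        also have "\<dots> = (\<Sum>I1\<in>Pow I. if I1 = {} then \<Sum>K1\<in>Pow L. if K1 = {} then
            expansion (int r) (\<lambda>m n. X m I n L v) m n else 0 else 0)"
          by (intro sum.cong refl) (auto simp: theta_minus_zeta_empty gr_monom_def koszul_def intro!: sum.neutral sum.cong)
        also have "\<dots> = expansion (int r) (\<lambda>m n. ?s *\<^sub>C ?b m n) m n"
          using True by (simp add: X)
        \<comment> \<open>The bracket need not be bounded, so the scalar is pulled out using that
          the binomial coefficients vanish for \<open>j > r\<close>.\<close>
        also have "\<dots> = ?s *\<^sub>C expansion (int r) ?b m n"
          using expansion_eq_sum[of "Suc r" "int r" ?b m n]
            expansion_eq_sum[of "Suc r" "int r" "\<lambda>m n. ?s *\<^sub>C ?b m n" m n] gbinomial_eq_0_of_int[of "int r"]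
          by (simp add: superspace.scale_sum_right superspace.scale_right_distrib mult_ac)
        finally have "expansion (int r) ?b m n = 0" by simp
        then show ?thesis
          using funpow_mul_diff_expansion[of ?b 0 r] f by simp
      qed
      then show ?thesis by (simp add: fun_eq_iff)
    qed
  qed
qed

section \<open>Uniqueness of covariant local fields\<close>

lemma covariant_Y: "a \<in> homog p \<Longrightarrow> covariant T (\<lambda>m. Y a m I)"
  by (simp add: covariant_def T_commutator)

text \<open>Covariance reads \<open>T d_i |0> = (i + 1) d_(i+1) |0>\<close>, so the value at
  \<open>w = 0\<close> determines \<open>d(w)|0>\<close>.\<close>

lemma covariant_annihilates_vac:
  assumes "\<And>n. linC (d n)" "covariant T d" "\<And>n. n < 0 \<Longrightarrow> d n vac = 0" "d 0 vac = 0"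
  shows "d n vac = 0"
proof (cases "n \<ge> 0")
  case True
  then show ?thesis
  proof (induction n rule: int_ge_induct)
    case (step i)
    have "T (d i vac) - d i (T vac) = of_int (i + 1) *\<^sub>C d (i + 1) vac"
      using assms(2) by (simp add: covariant_def)
    then have "of_int (i + 1) *\<^sub>C d (i + 1) vac = 0"
      using step.IH by (simp add: T_vac linC_zero[OF assms(1)] linC_zero[OF T_linear])
    moreover have "(of_int (i + 1) :: complex) \<noteq> 0" using step.hyps by (simp only: of_int_eq_0_iff)
    ultimately show ?case by (simp only: superspace.scale_eq_0_iff) simp
  qed (rule assms)
qed (use assms in simp)

text \<open>Locality rewrites \<open>d(z) Y(c, x)|0>\<close>, up to a power of \<open>z - x\<close>,
  as a term in which \<open>d\<close> acts on the vacuum. That term is 0 whatever its sign, so some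
  \<open>\<sigma>\<close> suffices.\<close>

lemma goddard_uniqueness:
  assumes lin: "\<And>n. linC (d n)" and "covariant T d"
    and "\<And>n. n < 0 \<Longrightarrow> d n vac = 0" "d 0 vac = 0"
    and loc: "\<And>c s. c \<in> homog s \<Longrightarrow> \<exists>r \<sigma>. (mul_diff ^^ r) (bracket \<sigma> d (\<lambda>l. Y c l {}) vac) = (\<lambda>_ _. 0)"
  shows "d n v = 0"
proof -
  have vac: "d n vac = 0" for n
    using covariant_annihilates_vac assms by blast
  have hom: "d n c = 0" if c: "c \<in> homog s" for n c s
  proof -
    obtain r \<sigma> where r: "(mul_diff ^^ r) (bracket \<sigma> d (\<lambda>l. Y c l {}) vac) = (\<lambda>_ _. 0)"
      using loc[OF c] by blast
    have "bracket \<sigma> d (\<lambda>l. Y c l {}) vac m l = d m (Y c l {} vac)" for m l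
      by (simp add: bracket_def vac Y_coeff_zero)
    \<comment> \<open>At \<open>x = 0\<close> the factor \<open>(z - x)^r\<close> is
      \<open>z^r\<close>; the index \<open>n + int r\<close> compensates for it.\<close>
    then have "(mul_diff ^^ r) (bracket \<sigma> d (\<lambda>l. Y c l {}) vac) (n + int r) 0 = d n (Y c 0 {} vac)"
      by (subst funpow_mul_diff_regular) (simp_all add: vacuum_regular linC_zero[OF lin])
    then show ?thesis by (simp add: r vacuum_value)
  qed
  obtain x0 x1 where "x0 \<in> homog 0" "x1 \<in> homog 1" "v = x0 + x1"
    by (rule homog_decomp)
  then show ?thesis by (simp add: linC_add[OF lin] hom)
qed

lemma Y_homog: "a \<in> homog p \<Longrightarrow> b \<in> homog q \<Longrightarrow> Y a m I b \<in> homog (p + card I + q)"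
  using Y_parity unfolding op_parity_def by blast

text \<open>Each coefficient of an odd monomial is itself a covariant local field, hence the field
  of its value on the vacuum. This both removes \<open>\<zeta>\<close> from the second field and
  restores it in the result.\<close>

lemma Y_lower:
  assumes b: "b \<in> homog q"
  shows "Y b n L v = Y (Y b 0 L vac) n {} v"
proof -
  define b' where "b' = Y b 0 L vac"
  have b': "b' \<in> homog (q + card L)"
    unfolding b'_def using Y_homog[OF b vac_even, of 0 L] by simp
  define d where "d n v = Y b n L v - Y b' n {} v" for n v
  have "d n v = 0"
  proof (rule goddard_uniqueness[where d = d])
    show "linC (d n)" for n
      unfolding d_def by (intro linC_minus Y_coeff_linear)
    show "covariant T d"
      unfolding d_def[abs_def] by (rule covariant_minus[OF T_linear covariant_Y[OF b] covariant_Y[OF b']])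
    show "d n vac = 0" if "n < 0" for n using that by (simp add: d_def vacuum_regular)
    show "d 0 vac = 0" by (simp add: d_def vacuum_value b'_def)
    fix c :: 'v and s assume c: "c \<in> homog s"
    let ?s = "(- 1) ^ ((q + card L) * s) :: complex"
    obtain r1 where r1: "\<And>I L v. (mul_diff ^^ r1) (bracket ((- 1) ^ ((q + card I) * (s + card L))) (\<lambda>m. Y b m I) (\<lambda>n. Y c n L) v) = (\<lambda>_ _. 0)"
      using locality_coeff[OF b c] by blast
    obtain r2 where r2: "\<And>I K v. (mul_diff ^^ r2) (bracket ((- 1) ^ ((q + card L + card I) * (s + card K))) (\<lambda>m. Y b' m I) (\<lambda>n. Y c n K) v) = (\<lambda>_ _. 0)"
      using locality_coeff[OF b' c] by blast
    define r where "r = max r1 r2"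
    have "(mul_diff ^^ r) (bracket ?s (\<lambda>m. Y b m L) (\<lambda>n. Y c n {}) vac) = (\<lambda>_ _. 0)"
      using funpow_mul_diff_mono[OF r1[of L "{}" vac], of r] by (simp add: r_def)
    moreover have "(mul_diff ^^ r) (bracket ?s (\<lambda>m. Y b' m {}) (\<lambda>n. Y c n {}) vac) = (\<lambda>_ _. 0)"
      using funpow_mul_diff_mono[OF r2[of "{}" "{}" vac], of r] by (simp add: r_def)
    moreover have "bracket ?s d (\<lambda>l. Y c l {}) vac = (\<lambda>m n. bracket ?s (\<lambda>m. Y b m L) (\<lambda>n. Y c n {}) vac m n
        - bracket ?s (\<lambda>m. Y b' m {}) (\<lambda>n. Y c n {}) vac m n)"
      by (simp add: fun_eq_iff bracket_def d_def linC_diff[OF Y_coeff_linear] superspace.scale_right_diff_distrib)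
    ultimately show "\<exists>r \<sigma>. (mul_diff ^^ r) (bracket \<sigma> d (\<lambda>l. Y c l {}) vac) = (\<lambda>_ _. 0)"
      by (intro exI[of _ r] exI[of _ ?s]) (simp only: funpow_mul_diff_diff, simp)
  qed
  then show ?thesis by (simp add: d_def b'_def)
qed

text \<open>The coefficient of \<open>z\<^sup>m w\<^sup>n\<close> in \<open>\<Sum>\<^sub>j (\<partial>\<^sub>w\<^sup>j \<delta>(z, w) / j!) Y(A\<^sub>(\<^sub>k\<^sub>+\<^sub>j\<^sub>) b, w)\<close>, where \<open>A(z)\<close> is the coefficient of
  \<open>\<theta>\<^sup>I\<close> in \<open>Y(a, Z)\<close>.\<close>

definition singular_part :: "'v \<Rightarrow> nat set \<Rightarrow> 'v \<Rightarrow> int \<Rightarrow> int \<Rightarrow> int \<Rightarrow> 'v \<Rightarrow> 'v" where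
  "singular_part a I b k m n v = Sum_any (\<lambda>j::nat. (of_int (- 1 - m) gchoose j) *\<^sub>C Y (Y a (- 1 - k - int j) I b) (n + 1 + m + int j) {} v)"

lemma Y_zero: "Y 0 m I v = 0"
  by (rule linC_zero[OF Y_linear])

lemma singular_part_eq_sum:
  assumes "\<And>m. m < M \<Longrightarrow> Y a m I b = 0" "- 1 - k - int J < M"
  shows "singular_part a I b k m n v = (\<Sum>j<J. (of_int (- 1 - m) gchoose j) *\<^sub>C Y (Y a (- 1 - k - int j) I b) (n + 1 + m + int j) {} v)"
  unfolding singular_part_def
proof (rule Sum_any.expand_superset)
  have *: "Y a (- 1 - k - int j) I b = 0" if "J \<le> j" for j
    using that assms by auto
  show "{j. (of_int (- 1 - m) gchoose j) *\<^sub>C Y (Y a (- 1 - k - int j) I b) (n + 1 + m + int j) {} v \<noteq> 0} \<subseteq> {..<J}"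
  proof (rule subsetI, rule ccontr)
    fix j assume "j \<in> {j. (of_int (- 1 - m) gchoose j) *\<^sub>C Y (Y a (- 1 - k - int j) I b) (n + 1 + m + int j) {} v \<noteq> 0}" "j \<notin> {..<J}"
    then show False using *[of j] by (simp add: Y_zero)
  qed
qed simp

text \<open>Multiplication by \<open>z - w\<close> takes
  \<open>\<partial>_w^j \<delta>(z, w) / j!\<close> to the same expression with \<open>j - 1\<close>
  and kills \<open>\<delta>(z, w)\<close> itself; in coefficients this is Pascal's rule.\<close>

lemma singular_part_Suc:
  "singular_part a I b (k + 1) m n v = singular_part a I b k (m - 1) n v - singular_part a I b k m (n - 1) v"
proof -
  obtain M where M: "\<And>m. m < M \<Longrightarrow> Y a m I b = 0"
    using Y_field by blast
  define J where "J = nat (- k - M + 1)"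
  have J: "- 1 - k - int J < M" "- 1 - (k + 1) - int J < M" "- 1 - k - int (Suc J) < M" by (auto simp: J_def)
  define t where "t j = Y (Y a (- 1 - k - int j) I b) (n + m + int j) {} v" for j
  define c where "c x j = ((of_int x :: complex) gchoose j)" for x :: int and j :: nat
  have c0: "c x 0 = 1" for x by (simp add: c_def)
  have cS: "c (- m) (Suc j) = c (- 1 - m) (Suc j) + c (- 1 - m) j" for j
    using gbinomial_Suc_Suc[of "of_int (- 1 - m) :: complex" j] by (simp add: c_def algebra_simps)
  have 1: "singular_part a I b (k + 1) m n v = (\<Sum>j<J. c (- 1 - m) j *\<^sub>C t (Suc j))"
    using singular_part_eq_sum[OF M J(2), of m n v] by (simp add: t_def c_def algebra_simps)
  have 2: "singular_part a I b k (m - 1) n v = (\<Sum>j<Suc J. c (- m) j *\<^sub>C t j)"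
    using singular_part_eq_sum[OF M J(3), of "m - 1" n v] by (simp add: t_def c_def algebra_simps)
  have 3: "singular_part a I b k m (n - 1) v = (\<Sum>j<Suc J. c (- 1 - m) j *\<^sub>C t j)"
    using singular_part_eq_sum[OF M J(3), of m "n - 1" v] by (simp add: t_def c_def algebra_simps)
  show ?thesis
    unfolding 1 2 3 sum.lessThan_Suc_shift by (simp add: c0 cS superspace.scale_left_distrib sum.distrib)
qed

text \<open>Derivatives in \<open>w\<close> of the delta distribution have no residue in
  \<open>z\<close>, so only \<open>j = 0\<close> survives.\<close>

lemma singular_part_m1: "singular_part a I b k (- 1) n v = Y (Y a (- 1 - k) I b) n {} v"
proof -
  have "singular_part a I b k (- 1) n v = Sum_any (\<lambda>j::nat. if j = 0 then Y (Y a (- 1 - k) I b) n {} v else 0)"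
    unfolding singular_part_def by (rule Sum_any.cong) (auto simp: gbinomial_0_left)
  then show ?thesis by simp
qed

text \<open>In the second product every term applies a negative mode exponent of
  \<open>Y(a, Z)\<close> to the vacuum. In the first, regularity of \<open>Y(b, w)|0>\<close> leaves
  nothing for \<open>n < 0\<close> and only \<open>j = 0\<close> for \<open>n = 0\<close>.\<close>

lemma ope_vac:
  shows "n < 0 \<Longrightarrow> ope k \<epsilon> (\<lambda>m. Y a m I) (\<lambda>n. Y b n {}) (- 1) n vac = 0"
    and "ope k \<epsilon> (\<lambda>m. Y a m I) (\<lambda>n. Y b n {}) (- 1) 0 vac = Y a (- 1 - k) I b"
proof -
  have A: "expansion k (\<lambda>n m. Y b n {} (Y a m I vac)) n (- 1) = 0" for n
    using expansion_eq_sum[of 0 k "\<lambda>n m. Y b n {} (Y a m I vac)" n "- 1"]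
    by (simp add: vacuum_regular Y_coeff_zero)
  show "ope k \<epsilon> (\<lambda>m. Y a m I) (\<lambda>n. Y b n {}) (- 1) n vac = 0" if "n < 0"
    using that expansion_eq_sum[of 0 k "\<lambda>m n. Y a m I (Y b n {} vac)" "- 1" n] A
    by (simp add: vacuum_regular Y_coeff_zero ope_def)
  show "ope k \<epsilon> (\<lambda>m. Y a m I) (\<lambda>n. Y b n {}) (- 1) 0 vac = Y a (- 1 - k) I b"
    using expansion_eq_sum[of 1 k "\<lambda>m n. Y a m I (Y b n {} vac)" "- 1" 0] A
    by (simp add: vacuum_regular vacuum_value Y_coeff_zero ope_def)
qed

text \<open>Truncation leaves finitely many fields, so their exponents have a maximum. The states
  \<open>e j\<close> have the same parity, so one sign fits all.\<close>

lemma singular_part_annihilated: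
  assumes a: "a \<in> homog p" and b: "b \<in> homog q" and c: "c \<in> homog s"
  shows "\<exists>r. \<forall>v. annihilated r (\<lambda>m n l. singular_part a I b k m n (Y c l {} v)
    - (- 1) ^ ((p + card I + q) * s) *\<^sub>C Y c l {} (singular_part a I b k m n v))"
proof -
  obtain M where M: "\<And>m. m < M \<Longrightarrow> Y a m I b = 0"
    using Y_field by blast
  define J where "J = nat (- k - M + 1)"
  have J: "- 1 - k - int J < M" by (auto simp: J_def)
  define e where "e j = Y a (- 1 - k - int j) I b" for j
  define \<sigma> where "\<sigma> = ((- 1) ^ ((p + card I + q) * s) :: complex)"
  have "\<exists>r. \<forall>v. (mul_diff ^^ r) (bracket \<sigma> (\<lambda>n. Y (e j) n {}) (\<lambda>l. Y c l {}) v) = (\<lambda>_ _. 0)" for j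
    using locality_coeff[OF Y_homog[OF a b] c] unfolding e_def \<sigma>_def
    by (metis add.right_neutral card.empty)
  then obtain r where r: "\<And>j v. (mul_diff ^^ r j) (bracket \<sigma> (\<lambda>n. Y (e j) n {}) (\<lambda>l. Y c l {}) v) = (\<lambda>_ _. 0)"
    by metis
  define R where "R = Max (r ` {..<J})"
  have R: "(mul_diff ^^ R) (bracket \<sigma> (\<lambda>n. Y (e j) n {}) (\<lambda>l. Y c l {}) v) = (\<lambda>_ _. 0)" if "j \<in> {..<J}" for j v
    by (rule funpow_mul_diff_mono[OF r]) (use that in \<open>simp add: R_def\<close>)
  have s: "singular_part a I b k m n v = (\<Sum>j<J. (of_int (- 1 - m) gchoose j) *\<^sub>C Y (e j) (n + (1 + m + int j)) {} v)" for m n v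
    using singular_part_eq_sum[OF M J] unfolding e_def by (simp add: add_ac)
  have "annihilated R (\<lambda>m n l. singular_part a I b k m n (Y c l {} v) - \<sigma> *\<^sub>C Y c l {} (singular_part a I b k m n v))" for v
  proof -
    have "annihilated R (\<lambda>m n l. \<Sum>j<J. (of_int (- 1 - m) gchoose j) *\<^sub>C
      bracket \<sigma> (\<lambda>n. Y (e j) n {}) (\<lambda>l. Y c l {}) v (n + (1 + m + int j)) l)"
      by (rule annihilated_wx_sum[OF R]) auto
    moreover have "singular_part a I b k m n (Y c l {} v) - \<sigma> *\<^sub>C Y c l {} (singular_part a I b k m n v)
      = (\<Sum>j<J. (of_int (- 1 - m) gchoose j) *\<^sub>C
      bracket \<sigma> (\<lambda>n. Y (e j) n {}) (\<lambda>l. Y c l {}) v (n + (1 + m + int j)) l)" for m n l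
      unfolding s bracket_def linC_sum[OF Y_coeff_linear] linC_scale[OF Y_coeff_linear]
      by (simp add: superspace.scale_sum_right superspace.scale_right_diff_distrib sum_subtractf scaleC_scaleC mult.commute)
    ultimately show ?thesis by simp
  qed
  then show ?thesis unfolding \<sigma>_def by blast
qed

lemma ope_annihilated:
  assumes a: "a \<in> homog p" and b: "b \<in> homog q" and c: "c \<in> homog s"
  shows "\<exists>r. \<forall>v. annihilated r (\<lambda>m n l. ope k \<epsilon> (\<lambda>m. Y a m I) (\<lambda>n. Y b n {}) m n (Y c l {} v)
    - (- 1) ^ ((p + card I + q) * s) *\<^sub>C Y c l {} (ope k \<epsilon> (\<lambda>m. Y a m I) (\<lambda>n. Y b n {}) m n v))"
proof -
  obtain r1 where r1: "\<And>I L v. (mul_diff ^^ r1) (bracket ((- 1) ^ ((p + card I) * (s + card L))) (\<lambda>m. Y a m I) (\<lambda>n. Y c n L) v) = (\<lambda>_ _. 0)"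
    using locality_coeff[OF a c] by blast
  obtain r2 where r2: "\<And>I L v. (mul_diff ^^ r2) (bracket ((- 1) ^ ((q + card I) * (s + card L))) (\<lambda>m. Y b m I) (\<lambda>n. Y c n L) v) = (\<lambda>_ _. 0)"
    using locality_coeff[OF b c] by blast
  define r where "r = max r1 r2"
  have A: "(mul_diff ^^ r) (bracket ((- 1) ^ ((p + card I) * s)) (\<lambda>m. Y a m I) (\<lambda>n. Y c n {}) v) = (\<lambda>_ _. 0)" for v
    using funpow_mul_diff_mono[OF r1[of I "{}" v], of r] by (simp add: r_def)
  have B: "(mul_diff ^^ r) (bracket ((- 1) ^ (q * s)) (\<lambda>m. Y b m {}) (\<lambda>n. Y c n {}) v) = (\<lambda>_ _. 0)" for v
    using funpow_mul_diff_mono[OF r2[of "{}" "{}" v], of r] by (simp add: r_def)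
  have \<sigma>: "(- 1) ^ ((p + card I + q) * s) = ((- 1) ^ ((p + card I) * s) * (- 1) ^ (q * s) :: complex)"
    by (simp add: power_add algebra_simps)
  show ?thesis
    unfolding \<sigma> by (intro exI[of _ r] allI annihilated_ope A B field_Y Y_coeff_linear)
qed

text \<open>The sign \<open>\<epsilon>\<close> is arbitrary: covariance, the values on the vacuum
  and locality with a third field hold for any combination of the two products.\<close>

lemma ordinary_borcherds_step:
  assumes a: "a \<in> homog p" and b: "b \<in> homog q"
    and IH: "\<And>m n v. ope (k + 1) \<epsilon> (\<lambda>m. Y a m I) (\<lambda>n. Y b n {}) m n v = singular_part a I b (k + 1) m n v"
  shows "ope k \<epsilon> (\<lambda>m. Y a m I) (\<lambda>n. Y b n {}) m n v = singular_part a I b k m n v"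
proof -
  let ?o = "ope k \<epsilon> (\<lambda>m. Y a m I) (\<lambda>n. Y b n {})"
  define D where "D m n v = ?o m n v - singular_part a I b k m n v" for m n v
  define d where "d n v = D (- 1) n v" for n v
  define e where "e = Y a (- 1 - k) I b"
  have e: "e \<in> homog (p + card I + q)" unfolding e_def by (rule Y_homog[OF a b])
  have d: "d n v = ?o (- 1) n v - Y e n {} v" for n v
    by (simp add: d_def D_def singular_part_m1 e_def)
  have "D (m - 1) n v = D m (n - 1) v" for m n v
  proof -
    have "?o (m - 1) n v - ?o m (n - 1) v
      = singular_part a I b k (m - 1) n v - singular_part a I b k m (n - 1) v"
      using IH[of m n v] unfolding ope_Suc[OF field_Y field_Y] singular_part_Suc .
    then show ?thesis unfolding D_def by (simp add: algebra_simps)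
  qed
  then have Dd: "D m n v = d (m + n + 1) v" for m n v
    unfolding d_def using antidiagonal_constant[of "\<lambda>m n. D m n v"] by blast
  have lin: "linC (d n)" for n
    unfolding d by (intro linC_minus linC_ope field_Y Y_coeff_linear)
  have "d n v = 0" for n v
  proof (rule goddard_uniqueness[where d = d])
    \<comment> \<open>At \<open>m = - 1\<close> the contribution of \<open>\<partial>_z\<close> has
      the coefficient \<open>m + 1 = 0\<close>: a derivative has no residue.\<close>
    have "covariant T (?o (- 1))"
      unfolding covariant_def
      by (simp add: ope_commutator[OF T_linear field_Y field_Y covariant_Y[OF a] covariant_Y[OF b]])
    then show "covariant T d"
      unfolding d[abs_def] by (rule covariant_minus[OF T_linear _ covariant_Y[OF e]])
    show "d n vac = 0" if "n < 0" for n
      using that by (simp add: d ope_vac vacuum_regular)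
    show "d 0 vac = 0"
      by (simp add: d ope_vac vacuum_value e_def)
    fix c :: 'v and s assume c: "c \<in> homog s"
    define \<sigma> where "\<sigma> = ((- 1) ^ ((p + card I + q) * s) :: complex)"
    obtain r1 r2 where "\<And>v. annihilated r1 (\<lambda>m n l. ?o m n (Y c l {} v) - \<sigma> *\<^sub>C Y c l {} (?o m n v))"
      "\<And>v. annihilated r2 (\<lambda>m n l. singular_part a I b k m n (Y c l {} v) - \<sigma> *\<^sub>C Y c l {} (singular_part a I b k m n v))"
      using ope_annihilated[OF a b c] singular_part_annihilated[OF a b c] unfolding \<sigma>_def by blast
    then have "annihilated (max r1 r2) (\<lambda>m n l. ?o m n (Y c l {} vac) - \<sigma> *\<^sub>C Y c l {} (?o m n vac))"
      "annihilated (max r1 r2) (\<lambda>m n l. singular_part a I b k m n (Y c l {} vac) - \<sigma> *\<^sub>C Y c l {} (singular_part a I b k m n vac))"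
      by (meson annihilated_mono max.cobounded1 max.cobounded2)+
    then have "annihilated (max r1 r2) (\<lambda>m n l. (?o m n (Y c l {} vac) - \<sigma> *\<^sub>C Y c l {} (?o m n vac)) -
       1 *\<^sub>C (singular_part a I b k m n (Y c l {} vac) - \<sigma> *\<^sub>C Y c l {} (singular_part a I b k m n vac)))"
      by (rule annihilated_diff_linC)
    moreover have "(?o m n (Y c l {} vac) - \<sigma> *\<^sub>C Y c l {} (?o m n vac)) -
       1 *\<^sub>C (singular_part a I b k m n (Y c l {} vac) - \<sigma> *\<^sub>C Y c l {} (singular_part a I b k m n vac))
      = bracket \<sigma> d (\<lambda>l. Y c l {}) vac (m + n + 1) l" for m n l
      unfolding bracket_def Dd[symmetric]
      by (simp add: D_def linC_diff[OF Y_coeff_linear] superspace.scale_right_diff_distrib)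
    ultimately have "annihilated (max r1 r2) (\<lambda>m n l. bracket \<sigma> d (\<lambda>l. Y c l {}) vac (m + n + 1) l)"
      by simp
    then show "\<exists>r \<sigma>. (mul_diff ^^ r) (bracket \<sigma> d (\<lambda>l. Y c l {}) vac) = (\<lambda>_ _. 0)"
      using annihilated_diagonal by blast
  qed (rule lin)
  then have "D m n v = 0" by (simp add: Dd)
  then show ?thesis by (simp add: D_def)
qed

lemma ordinary_borcherds:
  assumes a: "a \<in> homog p" and b: "b \<in> homog q"
  shows "ope k ((- 1) ^ ((p + card I) * q)) (\<lambda>m. Y a m I) (\<lambda>n. Y b n {}) m n v = singular_part a I b k m n v"
proof -
  let ?o = "\<lambda>k. ope k ((- 1) ^ ((p + card I) * q)) (\<lambda>m. Y a m I) (\<lambda>n. Y b n {})"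
  obtain M where M: "\<And>m. m < M \<Longrightarrow> Y a m I b = 0"
    using Y_field by blast
  obtain r where r: "\<And>I L v. (mul_diff ^^ r) (bracket ((- 1) ^ ((p + card I) * (q + card L))) (\<lambda>m. Y a m I) (\<lambda>n. Y b n L) v) = (\<lambda>_ _. 0)"
    using locality_coeff[OF a b] by blast
  \<comment> \<open>From \<open>r\<close> on, locality makes the left side vanish;
    \<open>nat (- M)\<close> ensures \<open>- 1 - r' < M\<close>, so that every mode on the right
    vanishes too.\<close>
  define r' where "r' = max r (nat (- M))"
  have base: "?o (int r') m n v = singular_part a I b (int r') m n v" for m n v
  proof -
    have "(mul_diff ^^ r') (bracket ((- 1) ^ ((p + card I) * q)) (\<lambda>m. Y a m I) (\<lambda>n. Y b n {}) v) = (\<lambda>_ _. 0)"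
      using funpow_mul_diff_mono[OF r[of I "{}" v], of r'] by (simp add: r'_def)
    then have "?o (int r') m n v = 0"
      unfolding funpow_mul_diff_ope[OF field_Y field_Y] by (simp add: fun_eq_iff)
    moreover have "singular_part a I b (int r') m n v = 0"
      by (subst singular_part_eq_sum[where M = M and J = 0]) (auto simp: M r'_def)
    ultimately show ?thesis by simp
  qed
  have down: "?o (int r' - int t) m n v = singular_part a I b (int r' - int t) m n v" for t m n v
  proof (induction t arbitrary: m n v)
    case (Suc t)
    have "int r' - int (Suc t) + 1 = int r' - int t" by simp
    then show ?case
      using ordinary_borcherds_step[OF a b, of "int r' - int (Suc t)"] Suc by metis
  qed (simp add: base)
  have up: "?o (int r' + int t) m n v = singular_part a I b (int r' + int t) m n v" for t m n v
  proof (induction t arbitrary: m n v)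
    case (Suc t)
    have "int r' + int (Suc t) = (int r' + int t) + 1" by simp
    then show ?case
      by (simp only: ope_Suc[OF field_Y field_Y] singular_part_Suc Suc)
  qed (simp add: base)
  show ?thesis
    using up[of "nat (k - int r')"] down[of "nat (int r' - k)"] by (cases "int r' \<le> k") simp_all
qed

text \<open>\<open>state L b\<close> is the coefficient of \<open>\<zeta>\<^sup>L\<close> in \<open>e\<^sup>\<zeta>\<^sup>S b\<close>.\<close>

definition state :: "nat set \<Rightarrow> 'v \<Rightarrow> 'v" where
  "state L x = Y x 0 L vac"

lemma linC_state: "linC (state L)"
  unfolding state_def[abs_def] by (rule Y_linear)

lemma S_state:
  assumes "x \<in> homog s" "i \<in> {1..N}" "finite P" "\<And>l. l \<in> P \<Longrightarrow> i < l"
  shows "S i (state P x) = (- 1) ^ card P *\<^sub>C state (insert i P) x"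
proof -
  have "{l \<in> P. l < i} = {}" "i \<notin> P" using assms(4) by (auto dest: less_asym)
  then have "(- 1) ^ card P *\<^sub>C S i (state P x) = state (insert i P) x"
    using S_commutator[OF assms(1,2), of P 0 vac] assms(2)
    by (simp only: state_def S_vac Y_coeff_zero) simp
  then have "(- 1) ^ card P *\<^sub>C (- 1) ^ card P *\<^sub>C S i (state P x) = (- 1) ^ card P *\<^sub>C state (insert i P) x"
    by simp
  then show ?thesis by (simp add: scaleC_scaleC flip: power_mult_distrib)
qed

text \<open>The coefficient of \<open>\<theta>\<^sup>I \<zeta>\<^sup>L\<close> in \<open>Y(a, Z) e\<^sup>\<zeta>\<^sup>S b = e\<^sup>\<zeta>\<^sup>S Y(a, (z, \<theta> - \<zeta>)) b\<close>.\<close>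

lemma Y_state:
  assumes a: "a \<in> homog p" and b: "b \<in> homog q" and "finite I" "L \<subseteq> {1..N}"
  shows "(- 1) ^ ((p + card I) * card L) *\<^sub>C Y a m I (state L b)
    = (\<Sum>L1\<in>Pow L. shuffle_sign I L1 L *\<^sub>C state (L - L1) (Y a m (I \<union> L1) b))"
proof -
  have "finite L" using assms(4) finite_subset by blast
  then show ?thesis using assms(3,4)
  \<comment> \<open>The new index is the least, so that \<open>S i\<close> acts outermost on the
    state, as \<open>S_state\<close> requires. \<open>I\<close> varies because commuting
    \<open>S i\<close> with \<open>Y(a, Z)\<close> produces \<open>insert i I\<close>.\<close>
  proof (induction L arbitrary: I rule: finite_linorder_min_induct)
    case empty
    then show ?case by (simp add: state_def vacuum_value shuffle_sign_def)
  next
    case (insert i L)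
    have i: "i \<in> {1..N}" "L \<subseteq> {1..N}" "i \<notin> L" "\<And>l. l \<in> L \<Longrightarrow> i < l" using insert by auto
    note fin = \<open>finite L\<close> \<open>finite I\<close>
    let ?v = "state L b"
    let ?X = "if i \<in> I then 0 else (- 1) ^ card {l \<in> I. l < i} *\<^sub>C Y a m (insert i I) ?v"
    have s: "(- 1) ^ n *\<^sub>C (- 1) ^ n *\<^sub>C x = x" for n and x :: 'v
      by (simp add: scaleC_scaleC flip: power_mult_distrib)
    have S: "Y a m I (S i ?v) = (- 1) ^ (p + card I) *\<^sub>C S i (Y a m I ?v) - (- 1) ^ p *\<^sub>C ?X"
    proof -
      have "(- 1) ^ p *\<^sub>C ?X = (- 1) ^ p *\<^sub>C ((- 1) ^ card I *\<^sub>C S i (Y a m I ?v) - (- 1) ^ p *\<^sub>C Y a m I (S i ?v))"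
        unfolding S_commutator[OF a i(1), of I m ?v] ..
      then show ?thesis
        by (simp only: superspace.scale_right_diff_distrib s) (simp add: scaleC_scaleC power_add)
    qed
    have bL: "state (insert i L) b = (- 1) ^ card L *\<^sub>C S i ?v"
      using S_state[OF b i(1) fin(1) i(4)] s by simp
    have IH: "(- 1) ^ ((p + card I) * card L) *\<^sub>C Y a m I ?v
      = (\<Sum>L1\<in>Pow L. shuffle_sign I L1 L *\<^sub>C state (L - L1) (Y a m (I \<union> L1) b))" if "finite I" for I
      using insert.IH[OF that i(2)] .
    let ?P = "(- 1) ^ ((p + card I) * card L) :: complex"
    \<comment> \<open>Here \<open>\<zeta>^i\<close> stays in the exponential: \<open>S i\<close> is
      applied to the induction hypothesis.\<close>
    have first: "(- 1) ^ card L *\<^sub>C ?P *\<^sub>C S i (Y a m I ?v)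
      = (\<Sum>L1\<in>Pow L. shuffle_sign I L1 (insert i L) *\<^sub>C state (insert i L - L1) (Y a m (I \<union> L1) b))"
    proof -
      have "?P *\<^sub>C S i (Y a m I ?v) = (\<Sum>L1\<in>Pow L. shuffle_sign I L1 L *\<^sub>C S i (state (L - L1) (Y a m (I \<union> L1) b)))"
        unfolding linC_scale[OF S_linear[OF i(1)], symmetric] IH[OF fin(2)]
        by (simp add: linC_sum[OF S_linear[OF i(1)]] linC_scale[OF S_linear[OF i(1)]])
      then have "(- 1) ^ card L *\<^sub>C ?P *\<^sub>C S i (Y a m I ?v)
        = (\<Sum>L1\<in>Pow L. (- 1) ^ card L *\<^sub>C shuffle_sign I L1 L *\<^sub>C S i (state (L - L1) (Y a m (I \<union> L1) b)))"
        by (simp add: superspace.scale_sum_right)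
      also have "\<dots> = (\<Sum>L1\<in>Pow L. shuffle_sign I L1 (insert i L) *\<^sub>C state (insert i L - L1) (Y a m (I \<union> L1) b))"
      proof (rule sum.cong[OF refl])
        fix L1 assume "L1 \<in> Pow L"
        then have L1: "L1 \<subseteq> L" by simp
        have c: "card L = card L1 + card (L - L1)"
          using L1 fin card_Diff_subset[of L1 L] card_mono[of L L1] finite_subset by fastforce
        have d: "insert i L - L1 = insert i (L - L1)" using i L1 by auto
        have "S i (state (L - L1) (Y a m (I \<union> L1) b)) = (- 1) ^ card (L - L1) *\<^sub>C state (insert i L - L1) (Y a m (I \<union> L1) b)"
          unfolding d by (rule S_state[OF Y_homog[OF a b] i(1)]) (use fin i in auto)
        then show "(- 1) ^ card L *\<^sub>C shuffle_sign I L1 L *\<^sub>C S i (state (L - L1) (Y a m (I \<union> L1) b))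
          = shuffle_sign I L1 (insert i L) *\<^sub>C state (insert i L - L1) (Y a m (I \<union> L1) b)"
          using shuffle_sign_insert(1)[OF fin(2,1) i(4) L1]
          unfolding c by (simp add: scaleC_scaleC power_add mult_ac)
      qed
      finally show ?thesis .
    qed
    \<comment> \<open>Here \<open>\<zeta>^i\<close> comes from
      \<open>\<theta>^i - \<zeta>^i\<close>: it is the derivative by \<open>\<theta>^i\<close> in
      the commutator with \<open>S i\<close>.\<close>
    have second: "- ((- 1) ^ (card L + card I) *\<^sub>C ?P *\<^sub>C ?X)
      = (\<Sum>L1\<in>Pow L. shuffle_sign I (insert i L1) (insert i L) *\<^sub>C state (L - L1) (Y a m (insert i (I \<union> L1)) b))"
    proof (cases "i \<in> I")
      case True
      then show ?thesis
        using shuffle_sign_insert(3)[OF fin(2,1) i(4)] by (simp add: sum.neutral)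
    next
      case False
      have "(- 1) ^ ((p + card (insert i I)) * card L) = (- 1) ^ card L * ?P"
        using False fin by (simp add: power_add algebra_simps)
      then have "(- 1) ^ card L *\<^sub>C ?P *\<^sub>C Y a m (insert i I) ?v
        = (\<Sum>L1\<in>Pow L. shuffle_sign (insert i I) L1 L *\<^sub>C state (L - L1) (Y a m (insert i I \<union> L1) b))"
        using IH[of "insert i I"] fin by (simp add: scaleC_scaleC)
      then have "- ((- 1) ^ (card I + card {l \<in> I. l < i}) *\<^sub>C (- 1) ^ card L *\<^sub>C ?P *\<^sub>C Y a m (insert i I) ?v)
        = (\<Sum>L1\<in>Pow L. - ((- 1) ^ (card I + card {l \<in> I. l < i}) *\<^sub>C shuffle_sign (insert i I) L1 L *\<^sub>C state (L - L1) (Y a m (insert i I \<union> L1) b)))"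
        by (simp add: superspace.scale_sum_right sum_negf)
      also have "\<dots> = (\<Sum>L1\<in>Pow L. shuffle_sign I (insert i L1) (insert i L) *\<^sub>C state (L - L1) (Y a m (insert i (I \<union> L1)) b))"
        by (intro sum.cong refl) (simp add: shuffle_sign_insert(2)[OF fin(2,1) i(4) _ False] scaleC_scaleC)
      finally show ?thesis
        using False by (simp add: scaleC_scaleC power_add mult_ac)
    qed
    have "(- 1) ^ ((p + card I) * card (insert i L)) *\<^sub>C Y a m I (state (insert i L) b)
      = (- 1) ^ card L *\<^sub>C ?P *\<^sub>C S i (Y a m I ?v) - (- 1) ^ (card L + card I) *\<^sub>C ?P *\<^sub>C ?X"
    proof -
      have "(- 1) ^ ((p + card I) * card (insert i L)) = (- 1) ^ (p + card I) * ?P"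
        using i(3) fin by (simp add: power_add algebra_simps)
      then have "(- 1) ^ ((p + card I) * card (insert i L)) *\<^sub>C Y a m I (state (insert i L) b)
        = ((- 1) ^ (p + card I) * ?P * (- 1) ^ card L) *\<^sub>C Y a m I (S i ?v)"
        unfolding bL by (simp add: linC_scale[OF Y_coeff_linear] scaleC_scaleC)
      also have "\<dots> = ((- 1) ^ (p + card I) * ?P * (- 1) ^ card L * (- 1) ^ (p + card I)) *\<^sub>C S i (Y a m I ?v)
         - ((- 1) ^ (p + card I) * ?P * (- 1) ^ card L * (- 1) ^ p) *\<^sub>C ?X"
        unfolding S by (simp only: superspace.scale_right_diff_distrib scaleC_scaleC)
      also have "(- 1) ^ (p + card I) * ?P * (- 1) ^ card L * (- 1) ^ (p + card I) = (- 1) ^ card L * ?P"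
        by (simp add: power_add mult_ac)
      also have "(- 1) ^ (p + card I) * ?P * (- 1) ^ card L * (- 1) ^ p = (- 1) ^ (card L + card I) * ?P"
        by (simp add: power_add mult_ac)
      finally show ?thesis by (simp only: scaleC_scaleC)
    qed
    also have "\<dots> = (\<Sum>L1\<in>Pow L. shuffle_sign I L1 (insert i L) *\<^sub>C state (insert i L - L1) (Y a m (I \<union> L1) b))
      + (\<Sum>L1\<in>Pow L. shuffle_sign I (insert i L1) (insert i L) *\<^sub>C state (L - L1) (Y a m (insert i (I \<union> L1)) b))"
      unfolding first second[symmetric] by simp
    also have "\<dots> = (\<Sum>L1\<in>Pow (insert i L). shuffle_sign I L1 (insert i L) *\<^sub>C state (insert i L - L1) (Y a m (I \<union> L1) b))"
    proof -
      have "insert i L - insert i L1 = L - L1" if "L1 \<in> Pow L" for L1 using that i by auto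
      then show ?thesis
        unfolding sum_Pow_insert[OF fin(1) i(3)] sum.distrib by simp
    qed
    finally show ?case .
  qed
qed

section \<open>Restoring the odd variables\<close>

lemma od_mult_ZW:
  assumes "a \<in> homog p" "finite I" "finite L"
  shows "od_mult (in_Z (Y a)) (in_W (Y b)) m I n L v = (- 1) ^ ((p + card I) * card L) *\<^sub>C Y a m I (Y b n L v)"
  using assms Y_parity Y_coeff_linear by (intro od_mult_in_Z_in_W_homog) auto

lemma od_mult_WZ:
  assumes "b \<in> homog q" "finite I" "finite L"
  shows "od_mult (in_W (Y b)) (in_Z (Y a)) m I n L v = (- 1) ^ (q * card I) *\<^sub>C Y b n L (Y a m I v)"
  using assms Y_parity Y_coeff_linear by (intro od_mult_in_W_in_Z_homog) auto

text \<open>One coefficient of the case \<open>K = {}\<close>. The even identity is applied to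
  \<open>a\<close> and the state that carries \<open>\<zeta>^L\<close>; \<open>Y_state\<close> then
  moves the \<open>\<zeta>\<close>'s out of the modes, and \<open>Y_lower\<close> returns those left
  in the state to the field.\<close>

lemma borcherds_coeff:
  assumes a: "a \<in> homog p" and b: "b \<in> homog q" and fin: "finite I" "finite L"
    and M: "\<And>m I. m < M \<Longrightarrow> Y a m I b = 0" and J: "- 1 - k - int J < M"
  shows "expansion k (\<lambda>m n. od_mult (in_Z (Y a)) (in_W (Y b)) m I n L v) m n
      - ((- 1) ^ (p * q) * (- 1) powi k) *\<^sub>C expansion k (\<lambda>n m. od_mult (in_W (Y b)) (in_Z (Y a)) m I n L v) n m
    = (\<Sum>j<J. (of_int (- 1 - m) gchoose j) *\<^sub>C (\<Sum>L1\<in>Pow L. shuffle_sign I L1 L *\<^sub>C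
        Y (Y a (- 1 - k - int j) (I \<union> L1) b) (n + 1 + m + int j) (L - L1) v))"
proof (cases "L \<subseteq> {1..N}")
  case False
  have "Y (Y a (- 1 - k - int j) (I \<union> L1) b) (n + 1 + m + int j) (L - L1) v = 0" if "L1 \<in> Pow L" for j L1
  proof (cases "L1 \<subseteq> {1..N}")
    case True
    then have "\<not> L - L1 \<subseteq> {1..N}" using False by blast
    then show ?thesis by (simp add: Y_support)
  next
    case False
    then have "\<not> I \<union> L1 \<subseteq> {1..N}" by blast
    then show ?thesis by (simp add: Y_support Y_zero)
  qed
  then have "(\<Sum>L1\<in>Pow L. shuffle_sign I L1 L *\<^sub>C
        Y (Y a (- 1 - k - int j) (I \<union> L1) b) (n + 1 + m + int j) (L - L1) v) = 0" for j
    by (intro sum.neutral ballI) simp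
  moreover have "Y b n L = 0" for n using False by (rule Y_support)
  ultimately show ?thesis
    by (simp add: od_mult_ZW[OF a fin] od_mult_WZ[OF b fin] Y_coeff_zero expansion_def)
next
  case True
  define s where "s = ((- 1) ^ ((p + card I) * card L) :: complex)"
  have sb: "state L b \<in> homog (q + card L)"
    unfolding state_def using Y_homog[OF b vac_even, of 0 L] by simp
  have Yb: "Y b n L = Y (state L b) n {}" for n
    using Y_lower[OF b] unfolding state_def by (intro ext)
  have lb: "lower_bounded (\<lambda>m n. Y a m I (Y b n L v))" "lower_bounded (\<lambda>n m. Y b n L (Y a m I v))"
    by (rule lower_bounded_field; use Y_coeff_linear field_Y in auto)+
  \<comment> \<open>Modes on \<open>state L b\<close> are combinations of states of modes on
    \<open>b\<close>, so the bound \<open>M\<close> and the cut-off \<open>J\<close> do not depend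
    on \<open>L\<close>.\<close>
  have sM: "Y a m I (state L b) = 0" if "m < M" for m
  proof -
    have "(- 1) ^ ((p + card I) * card L) *\<^sub>C Y a m I (state L b) = 0"
      unfolding Y_state[OF a b fin(1) True] using M[OF that] linC_zero[OF linC_state] by (simp add: sum.neutral)
    then show ?thesis by simp
  qed
  have "expansion k (\<lambda>m n. od_mult (in_Z (Y a)) (in_W (Y b)) m I n L v) m n
      - ((- 1) ^ (p * q) * (- 1) powi k) *\<^sub>C expansion k (\<lambda>n m. od_mult (in_W (Y b)) (in_Z (Y a)) m I n L v) n m
    = s *\<^sub>C expansion k (\<lambda>m n. Y a m I (Y b n L v)) m n
      - ((- 1) ^ (p * q) * (- 1) powi k * (- 1) ^ (q * card I)) *\<^sub>C expansion k (\<lambda>n m. Y b n L (Y a m I v)) n m"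
    unfolding od_mult_ZW[OF a fin] od_mult_WZ[OF b fin] expansion_scaleC[OF lb(1)] expansion_scaleC[OF lb(2)]
    by (simp add: s_def scaleC_scaleC)
  \<comment> \<open>Apart from the factor \<open>s\<close> common to both products, this is the sign
    for coefficients of parities \<open>p + card I\<close> and \<open>q + card L\<close>.\<close>
  also have "(- 1) ^ (p * q) * (- 1) powi k * (- 1) ^ (q * card I) = s * ((- 1) ^ ((p + card I) * (q + card L)) * (- 1) powi k)"
    unfolding s_def by (simp add: minus_one_power_iff)
  also have "s *\<^sub>C expansion k (\<lambda>m n. Y a m I (Y b n L v)) m n
      - (s * ((- 1) ^ ((p + card I) * (q + card L)) * (- 1) powi k)) *\<^sub>C expansion k (\<lambda>n m. Y b n L (Y a m I v)) n m
    = s *\<^sub>C ope k ((- 1) ^ ((p + card I) * (q + card L))) (\<lambda>m. Y a m I) (\<lambda>n. Y (state L b) n {}) m n v"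
    unfolding ope_def Yb by (simp add: superspace.scale_right_diff_distrib scaleC_scaleC)
  also have "\<dots> = s *\<^sub>C (\<Sum>j<J. (of_int (- 1 - m) gchoose j) *\<^sub>C Y (Y a (- 1 - k - int j) I (state L b)) (n + 1 + m + int j) {} v)"
    using singular_part_eq_sum[OF sM J, of m n v] by (simp only: ordinary_borcherds[OF a sb])
  also have "\<dots> = (\<Sum>j<J. (of_int (- 1 - m) gchoose j) *\<^sub>C Y (s *\<^sub>C Y a (- 1 - k - int j) I (state L b)) (n + 1 + m + int j) {} v)"
    by (simp add: superspace.scale_sum_right scaleC_scaleC linC_scale[OF Y_linear] mult.commute)
  also have "\<dots> = (\<Sum>j<J. (of_int (- 1 - m) gchoose j) *\<^sub>C (\<Sum>L1\<in>Pow L. shuffle_sign I L1 L *\<^sub>C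
        Y (Y a (- 1 - k - int j) (I \<union> L1) b) (n + 1 + m + int j) (L - L1) v))"
    unfolding s_def Y_state[OF a b fin(1) True] linC_sum[OF Y_linear] linC_scale[OF Y_linear]
      Y_lower[OF Y_homog[OF a b], folded state_def] ..
  finally show ?thesis .
qed

lemma borcherds_left:
  assumes a: "a \<in> homog p" and b: "b \<in> homog q" and fin: "finite I" "finite L"
    and M: "\<And>m I. m < M \<Longrightarrow> Y a m I b = 0" and J: "- 1 - k - int J < M" and K: "K \<subseteq> {1..N}"
  shows "od_smult (exp_zw k K) (od_mult (in_Z (Y a)) (in_W (Y b))) m I n L v
      - (- 1) ^ (p * q) *\<^sub>C od_smult (exp_wz k K) (od_mult (in_W (Y b)) (in_Z (Y a))) m I n L v
    = (\<Sum>j<J. (of_int (- 1 - m) gchoose j) *\<^sub>C (\<Sum>L2\<in>Pow L. \<Sum>U\<in>Pow {1..N}.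
        (sig L2 (L - L2) * (sig K U * theta_minus_zeta (K \<union> U) I L2))
          *\<^sub>C Y (Y a (- 1 - k - int j) U b) (n + 1 + m + int j) (L - L2) v))"
proof -
  define y where "y j U P = Y (Y a (- 1 - k - int j) U b) (n + 1 + m + int j) P v" for j U P
  define C where "C j = (of_int (- 1 - m) gchoose j :: complex)" for j :: nat
  define c where "c I1 K1 = koszul I1 K1 (I - I1) (L - K1) * theta_minus_zeta K I1 K1" for I1 K1
  let ?X = "od_mult (in_Z (Y a)) (in_W (Y b))" and ?X' = "od_mult (in_W (Y b)) (in_Z (Y a))"
  let ?s = "(- 1) ^ (p * q) :: complex" and ?e = "(- 1) powi k :: complex"
  have fin': "finite I'" "finite L'" if "I' \<subseteq> I" "L' \<subseteq> L" for I' L'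
    using that fin finite_subset by auto
  have lb: "lower_bounded (\<lambda>m n. Y a m I' (Y b n L' v))" "lower_bounded (\<lambda>n m. Y b n L' (Y a m I' v))" for I' L'
    by (rule lower_bounded_field; use Y_coeff_linear field_Y in auto)+
  have lb1: "lower_bounded (\<lambda>m n. ?X m I' n L' v)" if "I' \<subseteq> I" "L' \<subseteq> L" for I' L'
    unfolding od_mult_ZW[OF a fin'[OF that]]
    using lb(1)[of I' L'] unfolding lower_bounded_def by (metis superspace.scale_zero_right)
  have lb2: "lower_bounded (\<lambda>n m. ?X' m I' n L' v)" if "I' \<subseteq> I" "L' \<subseteq> L" for I' L'
    unfolding od_mult_WZ[OF b fin'[OF that]]
    using lb(2)[of L' I'] unfolding lower_bounded_def by (metis superspace.scale_zero_right)
  have "od_smult (exp_zw k K) ?X m I n L v - ?s *\<^sub>C od_smult (exp_wz k K) ?X' m I n L v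
    = (\<Sum>I1\<in>Pow I. \<Sum>K1\<in>Pow L. c I1 K1 *\<^sub>C (expansion k (\<lambda>m n. ?X m (I - I1) n (L - K1) v) m n
      - (?s * ?e) *\<^sub>C expansion k (\<lambda>n m. ?X' m (I - I1) n (L - K1) v) n m))"
  proof -
    have "od_smult (exp_zw k K) ?X m I n L v = (\<Sum>I1\<in>Pow I. \<Sum>K1\<in>Pow L. c I1 K1
      *\<^sub>C expansion k (\<lambda>m n. ?X m (I - I1) n (L - K1) v) m n)"
      unfolding c_def using lb1 by (intro od_smult_exp_zw fin) auto
    moreover have "od_smult (exp_wz k K) ?X' m I n L v = (\<Sum>I1\<in>Pow I. \<Sum>K1\<in>Pow L. c I1 K1
      *\<^sub>C ?e *\<^sub>C expansion k (\<lambda>n m. ?X' m (I - I1) n (L - K1) v) n m)"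
      unfolding c_def using lb2 by (intro od_smult_exp_wz fin) auto
    ultimately show ?thesis
      by (simp add: superspace.scale_sum_right sum_subtractf superspace.scale_right_diff_distrib scaleC_scaleC mult_ac)
  qed
  also have "\<dots> = (\<Sum>I1\<in>Pow I. \<Sum>K1\<in>Pow L. c I1 K1 *\<^sub>C (\<Sum>j<J. C j *\<^sub>C (\<Sum>L1\<in>Pow (L - K1).
      shuffle_sign (I - I1) L1 (L - K1) *\<^sub>C y j ((I - I1) \<union> L1) (L - K1 - L1))))"
    unfolding y_def C_def using fin
    by (intro sum.cong refl arg_cong2[of _ _ _ _ scaleC] borcherds_coeff[OF a b _ _ M J]) auto
  also have "\<dots> = (\<Sum>I1\<in>Pow I. \<Sum>K1\<in>Pow L. \<Sum>j<J. C j *\<^sub>C (\<Sum>L1\<in>Pow (L - K1).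
      (c I1 K1 * shuffle_sign (I - I1) L1 (L - K1)) *\<^sub>C y j ((I - I1) \<union> L1) (L - K1 - L1)))"
    by (simp add: superspace.scale_sum_right scaleC_scaleC mult_ac)
  also have "\<dots> = (\<Sum>j<J. \<Sum>I1\<in>Pow I. \<Sum>K1\<in>Pow L. C j *\<^sub>C (\<Sum>L1\<in>Pow (L - K1).
      (c I1 K1 * shuffle_sign (I - I1) L1 (L - K1)) *\<^sub>C y j ((I - I1) \<union> L1) (L - K1 - L1)))"
    by (subst (2) sum.swap, subst sum.swap, rule refl)
  also have "\<dots> = (\<Sum>j<J. C j *\<^sub>C (\<Sum>I1\<in>Pow I. \<Sum>K1\<in>Pow L. \<Sum>L1\<in>Pow (L - K1).
      (c I1 K1 * shuffle_sign (I - I1) L1 (L - K1)) *\<^sub>C y j ((I - I1) \<union> L1) (L - K1 - L1)))"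
    by (simp add: superspace.scale_sum_right)
  also have "\<dots> = (\<Sum>j<J. C j *\<^sub>C (\<Sum>L2\<in>Pow L. \<Sum>U\<in>Pow {1..N}.
        (sig L2 (L - L2) * (sig K U * theta_minus_zeta (K \<union> U) I L2)) *\<^sub>C y j U (L - L2)))"
    unfolding c_def
    by (intro sum.cong refl arg_cong2[of _ _ _ _ scaleC] borcherds_signs_left fin K) (simp add: y_def Y_support Y_zero)
  finally show ?thesis unfolding y_def C_def .
qed

lemma borcherds_right_term:
  assumes fin: "finite I" "finite L" and K: "K \<subseteq> {1..N}"
  shows "(\<Sum>J\<in>Pow {1..N}. od_scale (sig J K * sig1 N (J \<union> K))
          (od_smult (deriv_W j J (super_delta N)) (in_W (Y (mode N Y a (k + int j) (K \<union> J) b))))) m I n L v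
    = (of_int (- 1 - m) gchoose j) *\<^sub>C (\<Sum>L2\<in>Pow L. \<Sum>U\<in>Pow {1..N}.
        (sig L2 (L - L2) * (sig K U * theta_minus_zeta (K \<union> U) I L2))
          *\<^sub>C Y (Y a (- 1 - k - int j) U b) (n + 1 + m + int j) (L - L2) v)"
proof -
  define y where "y U P = Y (Y a (- 1 - k - int j) U b) (n + 1 + m + int j) P v" for U P
  define C where "C = (of_int (- 1 - m) gchoose j :: complex)"
  have fL: "finite K1" if "K1 \<subseteq> L" for K1 using that fin finite_subset by auto
  have t: "od_smult (deriv_W j J (super_delta N)) (in_W (Y (mode N Y a (k + int j) (K \<union> J) b))) m I n L v
    = C *\<^sub>C (\<Sum>L2\<in>Pow L. (sig L2 (L - L2) * (sig1 N J * theta_minus_zeta ({1..N} - J) I L2)) *\<^sub>C y ({1..N} - (K \<union> J)) (L - L2))"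
    if J: "J \<subseteq> {1..N}" for J
  proof -
    have "od_smult (deriv_W j J (super_delta N)) (in_W (Y (mode N Y a (k + int j) (K \<union> J) b))) m I n L v
      = (\<Sum>L2\<in>Pow L. (sig L2 (L - L2) * deriv_W j J (super_delta N) m I (- 1 - int j - m) L2)
         *\<^sub>C Y (mode N Y a (k + int j) (K \<union> J) b) (n - (- 1 - int j - m)) (L - L2) v)"
      by (rule od_smult_in_W[OF fin]) (simp add: deriv_W_super_delta[OF J fin(1) fL])
    also have "\<dots> = (\<Sum>L2\<in>Pow L. C *\<^sub>C (sig L2 (L - L2) * (sig1 N J * theta_minus_zeta ({1..N} - J) I L2)) *\<^sub>C y ({1..N} - (K \<union> J)) (L - L2))"
      by (intro sum.cong refl)
        (simp add: deriv_W_super_delta[OF J fin(1) fL] C_def y_def mode_def scaleC_scaleC algebra_simps)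
    finally show ?thesis by (simp only: superspace.scale_sum_right)
  qed
  define G where "G J = (\<Sum>L2\<in>Pow L. (sig L2 (L - L2) * (sig1 N J * theta_minus_zeta ({1..N} - J) I L2)) *\<^sub>C y ({1..N} - (K \<union> J)) (L - L2))" for J
  have "(\<Sum>J\<in>Pow {1..N}. od_scale (sig J K * sig1 N (J \<union> K))
          (od_smult (deriv_W j J (super_delta N)) (in_W (Y (mode N Y a (k + int j) (K \<union> J) b))))) m I n L v
    = (\<Sum>J\<in>Pow {1..N}. (sig J K * sig1 N (J \<union> K)) *\<^sub>C C *\<^sub>C G J)"
    unfolding sum_apply_fun od_scale_def by (intro sum.cong refl) (simp add: t G_def)
  also have "\<dots> = C *\<^sub>C (\<Sum>J\<in>Pow {1..N}. (sig J K * sig1 N (J \<union> K)) *\<^sub>C G J)"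
    by (simp add: superspace.scale_sum_right scaleC_scaleC mult_ac)
  finally show ?thesis
    unfolding G_def borcherds_signs_right[OF K] by (simp only: C_def y_def)
qed

lemma borcherds_identity:
  assumes a: "a \<in> homog p" and b: "b \<in> homog q" and K: "K \<subseteq> {1..N}"
  shows "od_smult (exp_zw k K) (od_mult (in_Z (Y a)) (in_W (Y b)))
      - od_scale ((- 1) ^ (p * q)) (od_smult (exp_wz k K) (od_mult (in_W (Y b)) (in_Z (Y a))))
    = Sum_any (\<lambda>j::nat. \<Sum>J\<in>Pow {1..N}.
        od_scale (sig J K * sig1 N (J \<union> K))
          (od_smult (deriv_W j J (super_delta N))
            (in_W (Y (mode N Y a (k + int j) (K \<union> J) b)))))"
    (is "?lhs = Sum_any ?F")
proof -
  obtain M where M: "\<And>m I. m < M \<Longrightarrow> Y a m I b = 0"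
    using Y_field by blast
  \<comment> \<open>\<open>M\<close> is uniform in the odd index, so one cut-off makes all modes
    with \<open>j \<ge> J\<close> vanish, for every \<open>J \<union> K\<close>-type index set at
    once.\<close>
  define J where "J = nat (- k - M + 1)"
  have J: "- 1 - k - int J < M" by (auto simp: J_def)
  have "Sum_any ?F = (\<Sum>j<J. ?F j)"
  proof (rule Sum_any.expand_superset)
    show "{j. ?F j \<noteq> 0} \<subseteq> {..<J}"
    proof (rule subsetI, rule ccontr)
      fix j assume j: "j \<in> {j. ?F j \<noteq> 0}" "j \<notin> {..<J}"
      have "mode N Y a (k + int j) L b = 0" for L
        unfolding mode_def by (rule M) (use j J in auto)
      moreover have "in_W (Y 0) m I n L v = 0" for m I n L v
        by (simp add: in_W_def Y_zero)
      ultimately have "?F j m I n L v = 0" for m I n L v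
        by (simp add: sum_apply_fun od_scale_def od_smult_def case_prod_beta')
      then have "?F j = 0" by (intro ext) simp
      then show False using j by simp
    qed
  qed simp
  moreover have "?lhs m I n L v = (\<Sum>j<J. ?F j) m I n L v" for m I n L v
  proof (cases "finite I \<and> finite L")
    case True
    then have fin: "finite I" "finite L" by auto
    have "?lhs m I n L v = (\<Sum>j<J. ?F j m I n L v)"
      unfolding borcherds_right_term[OF fin K]
      using borcherds_left[OF a b fin M J K, of m n v] by (simp add: od_scale_def)
    then show ?thesis
      using sum_apply_coeff[of ?F "{..<J}" m I n L v] by (simp only:)
  next
    case False
    then show ?thesis
      by (simp add: sum_apply_fun od_scale_def od_smult_infinite)
  qed
  ultimately show ?thesis by (intro ext) simp
qed

end

theorem theorem3p3p21:
  fixes N :: nat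
    and vac :: "'v::superspace"
    and T :: "'v \<Rightarrow> 'v"
    and S :: "nat \<Rightarrow> 'v \<Rightarrow> 'v"
    and Y :: "'v \<Rightarrow> int \<Rightarrow> nat set \<Rightarrow> 'v \<Rightarrow> 'v"
    and a b :: 'v
    and p q :: nat
    and k :: int
    and K :: "nat set"
  assumes "NW_SUSY_vertex_algebra N vac T S Y"
    and "a \<in> homog p"
    and "b \<in> homog q"
    and "K \<subseteq> {1..N}"
  shows "od_smult (exp_zw k K) (od_mult (in_Z (Y a)) (in_W (Y b)))
      - od_scale ((- 1) ^ (p * q)) (od_smult (exp_wz k K) (od_mult (in_W (Y b)) (in_Z (Y a))))
    = Sum_any (\<lambda>j::nat. \<Sum>J\<in>Pow {1..N}.
        od_scale (sig J K * sig1 N (J \<union> K))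
          (od_smult (deriv_W j J (super_delta N))
            (in_W (Y (mode N Y a (k + int j) (K \<union> J) b)))))"
  using NW_SUSY_vertex_algebra.borcherds_identity[OF assms] .

end
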